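(* Consider the branch-and-bound algorithm described in the context, for given $\boldsymbol{\alpha},\beta_1,\beta_2$, and assume that the priority mapping $E\mapsto\Pi(E)$ is taken to be $$\Pi(E)=\Gamma_{\boldsymbol{\alpha}}^{\beta_1,\beta_2}(E).$$ Then the upper bounds $\mathrm{UB}$ and the lower bounds $\ell$ output by the algorithm both converge to $G_{\boldsymbol{\alpha}}^{\beta_1,\beta_2}$ as the number of iterations tends to infinity.
   Context: Let $H=\mathbb{R}\times[0,1]$. For $\alpha\in[0,\pi/2]$ and $\mathbf{u}=(u_1,u_2)\in\mathbb{R}^2$ let $$L_\alpha(\mathbf{u})=\{(x,y): u_1\le x\cos\alpha+y\sin\alpha\le u_1+1,\ -x\sin\alpha+y\cos\alpha\le u_2+1\}\cup\{(x,y): x\cos\alpha+y\sin\alpha\le u_1+1,\ u_2\le -x\sin\alpha+y\cos\alpha\le u_2+1\}.$$ For angles $\beta_1,\beta_2$ let $$B(\beta_1,\beta_2)=\{(x,y): 0\le x\cos\beta_1+y\sin\beta_1,\ x\cos\beta_2+y\sin\beta_2\le 1\}\cup\{(x,y): x\cos\beta_1+y\sin\beta_1\le 1,\ 0\le x\cos\beta_2+y\sin\beta_2\}.$$ Let $\lambda^*(X)$ be the maximal area of a connected component of $X\subset\mathbb{R}^2$. Fix $k\ge1$, $\boldsymbol{\alpha}=(\alpha_1,\ldots,\alpha_k)$ with $0<\alpha_1<\cdots<\alpha_k<\pi/2$ and $\beta_1\le\beta_2$ in $(\alpha_k,\pi/2]$. Define, for $\mathbf{u}=(\mathbf{u}_1,\ldots,\mathbf{u}_k)\in(\mathbb{R}^2)^k=\mathbb{R}^{2k}$,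 $$g_{\boldsymbol{\alpha}}^{\beta_1,\beta_2}(\mathbf{u})=\lambda^*\Big(H\cap\bigcap_{j=1}^k L_{\alpha_j}(\mathbf{u}_j)\cap B(\beta_1,\beta_2)\Big),\qquad G_{\boldsymbol{\alpha}}^{\beta_1,\beta_2}=\sup_{\mathbf{u}\in\mathbb{R}^{2k}}g_{\boldsymbol{\alpha}}^{\beta_1,\beta_2}(\mathbf{u}).$$ A box is a product $E=I_1\times\cdots\times I_{2k}\subset\mathbb{R}^{2k}$ of compact intervals $I_i=[a_i,b_i]$, $a_i\le b_i$. For intervals $I,J$ let $\widehat L_\alpha(I,J)=\bigcup_{u\in I,v\in J}L_\alpha(u,v)$, and let $$\Gamma_{\boldsymbol{\alpha}}^{\beta_1,\beta_2}(E)=\lambda^*\Big(H\cap\bigcap_{j=1}^k\widehat L_{\alpha_j}(I_{2j-1},I_{2j})\cap B(\beta_1,\beta_2)\Big).$$ Let $P_{\mathrm{mid}}(E)$ be the midpoint of $E$. For $1\le i\le 2k$ let $\mathrm{split}_{i,1}(E)$, $\mathrm{split}_{i,2}(E)$ be the boxes obtained from $E$ by replacing $I_i$ by $[a_i,\frac12(a_i+b_i)]$, respectively $[\frac12(a_i+b_i),b_i]$. Initial box $\Omega=\Omega_{\boldsymbol{\alpha}}^{\beta_1,\beta_2}=I_1\times J_1\times\cdots\times I_k\times J_k$. For an interval $[x_1,x_2]$ and $0<\alpha<\pi/2$ put $I(\alpha;x_1,x_2)=[x_1\cos\alpha-1,\ x_2\cos\alpha+\sin\alpha]$, $J(\alpha;x_1,x_2)=[-x_2\sin\alpha-1,\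 -x_1\sin\alpha+\cos\alpha]$. If $\beta_2<\pi/2$, take $I_i=I(\alpha_i;x_1,x_2)$, $J_i=J(\alpha_i;x_1,x_2)$ for all $i$, with $x_1=-\tan\beta_2$, $x_2=\sec\beta_2$. If $\beta_2=\pi/2$, fix some $j\in\{1,\ldots,k\}$, take $I_j=\{0\}$, $J_j=[-\tan\alpha_j-1,\sec\alpha_j]$, and for $i\ne j$ take $I_i=I(\alpha_i;x_1,x_2)$, $J_i=J(\alpha_i;x_1,x_2)$ with $x_1=-(1+\sec\alpha_j)\csc\alpha_j$, $x_2=\sec\alpha_j$ (so that $H\cap L_{\alpha_j}(0,v)\subseteq[x_1,x_2]\times[0,1]$ for $v\in J_j$). This box satisfies $G_{\boldsymbol{\alpha}}^{\beta_1,\beta_2}=\max_{\mathbf{u}\in\Omega}g_{\boldsymbol{\alpha}}^{\beta_1,\beta_2}(\mathbf{u})$. Algorithm data: (a) a splitting rule $E\mapsto\mathrm{ind}(E)\in\{1,\ldots,2k\}$, i.e. a map such that, starting from any box and iterating $E\mapsto\mathrm{split}_{\mathrm{ind}(E),j}(E)$ with arbitrary choices $j\in\{1,2\}$ at each step, the resulting sequence of indices contains every coordinate infinitely often; (b) a real-valued priority map $\Pi$ on boxes with $\Pi(E)\ge\Gamma_{\boldsymbol{\alpha}}^{\beta_1,\beta_2}(E)$ for all $E$; (c) a real number $\ell_0\le G_{\boldsymbol{\alpha}}^{\beta_1,\beta_2}$. Algorithm: initialize a priority queue $Q$ containing only $\Omega$, with priority $\Pi(\Omega)$, and set $\ell:=\ell_0$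 (the best lower bound so far). Repeat forever: remove a box $E$ of highest priority from $Q$; set $\mathrm{UB}:=\Pi(E)$ (the best upper bound so far); set $\ell:=\max(\ell,g_{\boldsymbol{\alpha}}^{\beta_1,\beta_2}(P_{\mathrm{mid}}(E)))$; let $i=\mathrm{ind}(E)$; for $j=1,2$ let $E'=\mathrm{split}_{i,j}(E)$ and, if $\Pi(E')\ge\ell$, insert $E'$ into $Q$ with priority $\Pi(E')$ (otherwise discard $E'$); report (output) the current values of $\mathrm{UB}$ and $\ell$. *)

theory Defs
  imports "HOL-Analysis.Analysis" "HOL-Library.Multiset"
begin

definition strip :: "(real \<times> real) set" where
  "strip = UNIV \<times> {0..1}"

definition hallway :: "real \<Rightarrow> real \<Rightarrow> real \<Rightarrow> (real \<times> real) set" where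
  "hallway \<alpha> u1 u2 =
     {(x, y). u1 \<le> x * cos \<alpha> + y * sin \<alpha> \<and> x * cos \<alpha> + y * sin \<alpha> \<le> u1 + 1
            \<and> - x * sin \<alpha> + y * cos \<alpha> \<le> u2 + 1}
   \<union> {(x, y). x * cos \<alpha> + y * sin \<alpha> \<le> u1 + 1
            \<and> u2 \<le> - x * sin \<alpha> + y * cos \<alpha> \<and> - x * sin \<alpha> + y * cos \<alpha> \<le> u2 + 1}"

definition butterfly :: "real \<Rightarrow> real \<Rightarrow> (real \<times> real) set" where
  "butterfly \<beta>1 \<beta>2 =
     {(x, y). 0 \<le> x * cos \<beta>1 + y * sin \<beta>1 \<and> x * cos \<beta>2 + y * sin \<beta>2 \<le> 1}
   \<union> {(x, y). x * cos \<beta>1 + y * sin \<beta>1 \<le> 1 \<and> 0 \<le> x * cos \<beta>2 + y * sin \<beta>2}"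

text \<open>
  The largest area of a connected component. It is applied below only to sets that are bounded
  (for angles strictly between 0 and pi/2 and at least one hallway) and are finite unions of convex
  sets, so the supremum is finite and is a maximum. The empty set has no component and gets the
  value 0.
\<close>
definition max_component_area :: "(real \<times> real) set \<Rightarrow> real" where
  "max_component_area X =
     (if X = {} then 0 else (SUP C\<in>components X. measure lebesgue C))"

text \<open>
  The angles form a list of length k. A vector of R^(2k) is a list of length 2k, whose entries
  2j and 2j+1 are the two coordinates of the j-th hallway position. All indices start at 0.
\<close>
definition sofa_g :: "real list \<Rightarrow> real \<Rightarrow> real \<Rightarrow> real list \<Rightarrow> real" where
  "sofa_g \<alpha> \<beta>1 \<beta>2 u =
     max_component_area
       (strip \<inter> (\<Inter>j<length \<alpha>. hallway (\<alpha> ! j) (u ! (2 * j)) (u ! (2 * j + 1)))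
              \<inter> butterfly \<beta>1 \<beta>2)"

definition sofa_G :: "real list \<Rightarrow> real \<Rightarrow> real \<Rightarrow> real" where
  "sofa_G \<alpha> \<beta>1 \<beta>2 = (SUP u\<in>{u. length u = 2 * length \<alpha>}. sofa_g \<alpha> \<beta>1 \<beta>2 u)"

text \<open>A product of compact intervals is the list of the pairs of their endpoints.\<close>
type_synonym ibox = "(real \<times> real) list"

definition is_ibox :: "nat \<Rightarrow> ibox \<Rightarrow> bool" where
  "is_ibox n E \<longleftrightarrow> length E = n \<and> (\<forall>(a, b)\<in>set E. a \<le> b)"

definition ival :: "real \<times> real \<Rightarrow> real set" where
  "ival p = {fst p..snd p}"

definition hallway_hull :: "real \<Rightarrow> real set \<Rightarrow> real set \<Rightarrow> (real \<times> real) set" where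
  "hallway_hull \<alpha> I J = (\<Union>u\<in>I. \<Union>v\<in>J. hallway \<alpha> u v)"

definition sofa_Gamma :: "real list \<Rightarrow> real \<Rightarrow> real \<Rightarrow> ibox \<Rightarrow> real" where
  "sofa_Gamma \<alpha> \<beta>1 \<beta>2 E =
     max_component_area
       (strip \<inter> (\<Inter>j<length \<alpha>. hallway_hull (\<alpha> ! j) (ival (E ! (2 * j))) (ival (E ! (2 * j + 1))))
              \<inter> butterfly \<beta>1 \<beta>2)"

definition ibox_mid :: "ibox \<Rightarrow> real list" where
  "ibox_mid E = map (\<lambda>(a, b). (a + b) / 2) E"

definition split_lo :: "nat \<Rightarrow> ibox \<Rightarrow> ibox" where
  "split_lo i E = E[i := (fst (E ! i), (fst (E ! i) + snd (E ! i)) / 2)]"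

definition split_hi :: "nat \<Rightarrow> ibox \<Rightarrow> ibox" where
  "split_hi i E = E[i := ((fst (E ! i) + snd (E ! i)) / 2, snd (E ! i))]"

definition I_range :: "real \<Rightarrow> real \<Rightarrow> real \<Rightarrow> real \<times> real" where
  "I_range \<alpha> x1 x2 = (x1 * cos \<alpha> - 1, x2 * cos \<alpha> + sin \<alpha>)"

definition J_range :: "real \<Rightarrow> real \<Rightarrow> real \<Rightarrow> real \<times> real" where
  "J_range \<alpha> x1 x2 = (- x2 * sin \<alpha> - 1, - x1 * sin \<alpha> + cos \<alpha>)"

text \<open>
  The index j is used only for \<beta>2 = pi/2: the problem is then invariant under horizontal
  translation, and this is removed by fixing the first coordinate of the j-th hallway to be 0.
\<close>
definition initial_ibox :: "real list \<Rightarrow> real \<Rightarrow> nat \<Rightarrow> ibox" where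
  "initial_ibox \<alpha> \<beta>2 j =
     (if \<beta>2 < pi / 2 then
        (let x1 = - tan \<beta>2; x2 = 1 / cos \<beta>2
         in concat (map (\<lambda>i. [I_range (\<alpha> ! i) x1 x2, J_range (\<alpha> ! i) x1 x2]) [0..<length \<alpha>]))
      else
        (let x1 = - (1 + 1 / cos (\<alpha> ! j)) / sin (\<alpha> ! j); x2 = 1 / cos (\<alpha> ! j)
         in concat (map (\<lambda>i. if i = j then [(0, 0), (- tan (\<alpha> ! j) - 1, 1 / cos (\<alpha> ! j))]
                             else [I_range (\<alpha> ! i) x1 x2, J_range (\<alpha> ! i) x1 x2]) [0..<length \<alpha>])))"

text \<open>
  Splitting a degenerate interval {a} returns the same box, so a rule that depends only on the box
  can never get past a degenerate coordinate once it has selected it; asking that such coordinates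
  be selected infinitely often as well would make the definition unsatisfiable. Hence this is
  required of the non-degenerate coordinates of the starting box (all of them, for a box
  with nonempty interior); non-degeneracy is preserved by splitting.
\<close>
definition splitting_rule :: "nat \<Rightarrow> (ibox \<Rightarrow> nat) \<Rightarrow> bool" where
  "splitting_rule n ind \<longleftrightarrow>
     (\<forall>E. is_ibox n E \<longrightarrow> ind E < n) \<and>
     (\<forall>S :: nat \<Rightarrow> ibox.
        is_ibox n (S 0) \<and>
        (\<forall>m. S (Suc m) = split_lo (ind (S m)) (S m) \<or> S (Suc m) = split_hi (ind (S m)) (S m))
        \<longrightarrow> (\<forall>i<n. fst (S 0 ! i) < snd (S 0 ! i) \<longrightarrow> infinite {m. ind (S m) = i}))"

text \<open>
  One iteration on states (queue, upper bound, lower bound). The queue is a multiset, because both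
  halves of a degenerate interval are the same. The choice among boxes of equal highest priority is
  left open. The rule \<open>idle\<close> is a convention for an empty queue; it makes every run
  infinite, so that a statement about all runs is not vacuously true for an algorithm that gets
  stuck.
\<close>
inductive bb_step ::
  "(real list \<Rightarrow> real) \<Rightarrow> (ibox \<Rightarrow> real) \<Rightarrow> (ibox \<Rightarrow> nat) \<Rightarrow>
   ibox multiset \<times> real \<times> real \<Rightarrow> ibox multiset \<times> real \<times> real \<Rightarrow> bool"
  for g :: "real list \<Rightarrow> real" and prio :: "ibox \<Rightarrow> real" and ind :: "ibox \<Rightarrow> nat" where
  process: "\<lbrakk> E \<in># Q; \<forall>F\<in>#Q. prio F \<le> prio E; l' = max l (g (ibox_mid E)) \<rbrakk> \<Longrightarrow>
     bb_step g prio ind (Q, UB, l)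
       (Q - {#E#} + filter_mset (\<lambda>F. prio F \<ge> l') {#split_lo (ind E) E, split_hi (ind E) E#},
        prio E, l')"
| idle: "bb_step g prio ind ({#}, UB, l) ({#}, UB, l)"

text \<open>
  The values reported by the n-th iteration (n \<open>\<ge>\<close> 1) are \<open>UB n\<close> and
  \<open>l n\<close>; \<open>UB 0\<close> is an unspecified value present before the first iteration.
\<close>
definition bb_run ::
  "(real list \<Rightarrow> real) \<Rightarrow> (ibox \<Rightarrow> real) \<Rightarrow> (ibox \<Rightarrow> nat) \<Rightarrow> ibox \<Rightarrow> real \<Rightarrow>
   (nat \<Rightarrow> ibox multiset) \<Rightarrow> (nat \<Rightarrow> real) \<Rightarrow> (nat \<Rightarrow> real) \<Rightarrow> bool" where
  "bb_run g prio ind E0 l0 Q UB l \<longleftrightarrow>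
     Q 0 = {#E0#} \<and> l 0 = l0 \<and>
     (\<forall>n. bb_step g prio ind (Q n, UB n, l n) (Q (Suc n), UB (Suc n), l (Suc n)))"

end

theory Submission imports Defs begin

text \<open>
  Fix the corner positions of the hallways. At each abscissa, a hallway bounds the ordinate from above by
  its two outer walls, which are lines, and from below by its inner corner, the minimum of two lines; the
  strip and the butterfly add a lower and an upper bound of similar kind. So the region is the set between two piecewise
  linear graphs, and so is the region of a whole box of positions: there the outer walls are those of the largest position and
  the inner corners those of the smallest one (\<open>region_between_graphs\<close>). Writing \<open>gap\<close> for the
  upper minus the lower boundary, the components are the parts over the maximal intervals on which
  \<open>gap\<close> is nonnegative, and the largest component area is the supremum of the integrals of \<open>gap\<close>
  over such intervals, for a single position (the objective) as for a box (its priority).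

  The upper bounds. Some box in the queue always contains positions with values arbitrarily near the
  supremum G, hence has priority at least G; so the queue never runs empty and the reported upper
  bounds decrease to some \<open>L \<ge> G\<close>. A run replaces a processed box by at most two others, so if
  the processed boxes contained no infinite chain of successive halves, the well-foundedness of the
  multiset order would stop the run. Along such a chain the splitting rule shrinks the boxes to one
  position \<open>u\<close>, all priorities are at least \<open>L\<close>, and a compactness argument
  (\<open>feasible_limit\<close>) yields an interval on which \<open>gap\<close> is nonnegative at \<open>u\<close> with
  integral at least \<open>L\<close>. Hence \<open>L = G\<close>, and \<open>u\<close> is a maximiser. It also follows that
  every half of a processed box whose priority exceeds G is itself processed later.

  The lower bounds. The objective is upper but not lower semicontinuous: if \<open>gap\<close> vanishes at an
  interior point of the optimal interval, a \<^emph>\<open>pinch\<close>, then arbitrarily near positions can cut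
  the component in two. Without a pinch the midpoints along the chain have values tending to G
  (\<open>optimal_unpinched\<close>). A pinch is handled by a second-order argument. The component is
  thin near a pinch, so closing or shifting it there by \<open>d\<close> costs only an area of order \<open>d\<^sup>2\<close>, and an
  optimal component admits no such variation with a gain of first order (\<open>no_linear_gain\<close>). This shows
  that a pinch never lies on an outer wall (\<open>no_pinch_at_outer_right\<close>,
  \<open>no_pinch_at_butterfly\<close>, \<open>no_pinch_at_outer_left\<close>): it lies on the upper edge of the strip,
  where inner corners touch it. Moreover it is the only pinch, exactly one inner corner
  touches there (\<open>touching_single\<close>), and both outer walls of that hallway bound the component
  along intervals of positive length (\<open>outer_right_visible\<close>, \<open>outer_left_visible\<close>).

  Now let \<open>slide d u\<close> move the left walls of all hallways to the right by \<open>d\<close>. This opens the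
  pinch, so near \<open>slide d u\<close> the values exceed any given \<open>c < G\<close> when \<open>d\<close> is
  small. Assume that all processed midpoints have values at most \<open>c\<close>. A box that contains both
  \<open>u\<close> and \<open>slide d u\<close> has priority larger than G, because its lower boundary is strictly lower
  than that of \<open>u\<close> on an interval. A box that contains \<open>slide d u\<close> and a midpoint \<open>z\<close> near \<open>u\<close> of
  value at most \<open>c\<close> has priority larger than G as well: the inner corner of \<open>z\<close> sticks out of the strip,
  which forces the box to raise one of the two visible outer walls by a multiple of \<open>d\<close>, a gain of
  first order against a loss of second order (\<open>optimal_pinched\<close>). So the halves containing
  \<open>slide d u\<close> are processed, without end, and shrink to \<open>slide d u\<close>; the values of their midpoints
  eventually exceed \<open>c\<close>, a contradiction.
\<close>

section \<open>Regions between two graphs\<close>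

definition between_graphs :: "(real \<Rightarrow> real) \<Rightarrow> (real \<Rightarrow> real) \<Rightarrow> real set \<Rightarrow> (real \<times> real) set" where
  "between_graphs l h S = {(x, y). x \<in> S \<and> l x \<le> y \<and> y \<le> h x}"

lemma compact_between_graphs:
  assumes "continuous_on UNIV l" "continuous_on UNIV h" "bounded {x. l x \<le> h x}" "closed S"
  shows "compact (between_graphs l h S)"
proof -
  have cl: "closed (between_graphs l h S)"
  proof -
    have eq: "between_graphs l h S = (fst -` S) \<inter> {z. l (fst z) \<le> snd z} \<inter> {z. snd z \<le> h (fst z)}"
      by (auto simp: between_graphs_def)
    have c1: "continuous_on UNIV (\<lambda>z::real\<times>real. l (fst z))"
      by (rule continuous_on_compose2[OF assms(1)]) (auto intro: continuous_intros)
    have c2: "continuous_on UNIV (\<lambda>z::real\<times>real. h (fst z))"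
      by (rule continuous_on_compose2[OF assms(2)]) (auto intro: continuous_intros)
    have s1: "closed (fst -` S :: (real\<times>real) set)"
      using assms(4) by (intro closed_vimage) (auto intro: continuous_intros)
    have s2: "closed {z. l (fst z) \<le> snd z}" "closed {z. snd z \<le> h (fst z)}"
      by (intro closed_Collect_le c1 c2 continuous_intros)+
    show ?thesis unfolding eq using s1 s2 by (intro closed_Int)
  qed
  have "bounded (between_graphs l h S)"
  proof -
    obtain B where B: "\<And>x. l x \<le> h x \<Longrightarrow> \<bar>x\<bar> \<le> B" using assms(3) by (auto simp: bounded_iff)
    have cc: "compact {-B..B}" by simp
    have "bounded (l ` {-B..B})" "bounded (h ` {-B..B})"
      using assms(1,2) by (auto intro!: compact_imp_bounded compact_continuous_image intro: continuous_on_subset)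
    then obtain L U where LU: "\<And>x. x \<in> {-B..B} \<Longrightarrow> \<bar>l x\<bar> \<le> L" "\<And>x. x \<in> {-B..B} \<Longrightarrow> \<bar>h x\<bar> \<le> U"
      unfolding bounded_iff real_norm_def ball_simps by meson
    have "between_graphs l h S \<subseteq> {-B..B} \<times> {-L..U}"
    proof (clarsimp simp: between_graphs_def)
      fix x y assume *: "l x \<le> y" "y \<le> h x"
      then have "\<bar>x\<bar> \<le> B" using B by force
      then have "x \<in> {-B..B}" by auto
      with LU[OF this] * \<open>\<bar>x\<bar> \<le> B\<close> show "- B \<le> x \<and> x \<le> B \<and> - L \<le> y \<and> y \<le> U" by auto
    qed
    then show ?thesis by (rule bounded_subset[rotated]) (simp add: bounded_Times)
  qed
  with cl show ?thesis by (simp add: compact_eq_bounded_closed)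
qed

text \<open>
  Fubini: the vertical section at \<open>x\<close> is an interval of length \<open>h x - l x\<close>.
\<close>
lemma measure_between_graphs:
  fixes l h :: "real \<Rightarrow> real"
  assumes l: "continuous_on UNIV l" and h: "continuous_on UNIV h"
    and le: "\<And>x. x \<in> {a..b} \<Longrightarrow> l x \<le> h x"
  shows "measure lebesgue (between_graphs l h {a..b}) = integral {a..b} (\<lambda>x. h x - l x)"
    and "between_graphs l h {a..b} \<in> lmeasurable"
proof -
  let ?R = "between_graphs l h {a..b}"
  define f where "f = (\<lambda>x. h x - l x)"
  have cf: "continuous_on {a..b} f"
    unfolding f_def by (intro continuous_intros continuous_on_subset[OF l] continuous_on_subset[OF h]) auto
  have closed: "closed ?R"
  proof -
    have eq: "?R = (fst -` {a..b}) \<inter> {z. l (fst z) \<le> snd z} \<inter> {z. snd z \<le> h (fst z)}"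
      by (auto simp: between_graphs_def)
    have c1: "continuous_on UNIV (\<lambda>z::real\<times>real. l (fst z))"
      by (rule continuous_on_compose2[OF l]) (auto intro: continuous_intros)
    have c2: "continuous_on UNIV (\<lambda>z::real\<times>real. h (fst z))"
      by (rule continuous_on_compose2[OF h]) (auto intro: continuous_intros)
    show ?thesis unfolding eq
      by (intro closed_Int closed_vimage closed_Collect_le c1 c2 continuous_intros)
  qed
  then have sets: "?R \<in> sets borel" by auto
  then have sets2: "?R \<in> sets (lborel \<Otimes>\<^sub>M lborel)" by (subst lborel_prod) simp
  have "emeasure lborel ?R = emeasure (lborel \<Otimes>\<^sub>M lborel) ?R" by (simp add: lborel_prod)
  also have "\<dots> = (\<integral>\<^sup>+x. emeasure lborel (Pair x -` ?R) \<partial>lborel)"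
    by (rule lborel.emeasure_pair_measure_alt[OF sets2])
  also have "\<dots> = (\<integral>\<^sup>+x. ennreal (f x) * indicator {a..b} x \<partial>lborel)"
  proof (rule nn_integral_cong)
    fix x
    have "Pair x -` ?R = (if x \<in> {a..b} then {l x..h x} else {})"
      by (auto simp: between_graphs_def)
    then show "emeasure lborel (Pair x -` ?R) = ennreal (f x) * indicator {a..b} x"
      using le[of x] by (auto simp: f_def indicator_def)
  qed
  also have "\<dots> = ennreal (integral {a..b} f)"
  proof -
    have "(f has_integral integral {a..b} f) {a..b}"
      using cf integrable_continuous_real integrable_integral by blast
    then have "integral\<^sup>N lborel (\<lambda>x. ennreal (indicator {a..b} x * f x)) = ennreal (integral {a..b} f)"
    proof (intro nn_integral_has_integral_lebesgue)
      show "0 \<le> f x" if "x \<in> {a..b}" for x using le[OF that] by (auto simp: f_def)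
    qed
    moreover have "ennreal (f x) * indicator {a..b} x = ennreal (indicator {a..b} x * f x)" for x
      by (auto simp: indicator_def)
    ultimately show ?thesis by simp
  qed
  finally have em: "emeasure lborel ?R = ennreal (integral {a..b} f)" .
  have nn: "0 \<le> integral {a..b} f"
    using cf le by (intro integral_nonneg integrable_continuous_real) (auto simp: f_def)
  have "emeasure lebesgue ?R = ennreal (integral {a..b} f)"
    using em sets by (simp add: emeasure_completion)
  then show "measure lebesgue ?R = integral {a..b} (\<lambda>x. h x - l x)"
    using nn by (simp add: measure_def f_def)
  show "?R \<in> lmeasurable"
    using em sets by (intro fmeasurableI) (auto simp: emeasure_completion)
qed

text \<open>
  The region is a continuous image of a rectangle, sections being parametrised by \<open>[0, 1]\<close>.
\<close>
lemma connected_between_graphs: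
  fixes l h :: "real \<Rightarrow> real"
  assumes l: "continuous_on UNIV l" and h: "continuous_on UNIV h"
    and le: "\<And>x. x \<in> {a..b} \<Longrightarrow> l x \<le> h x"
  shows "connected (between_graphs l h {a..b})"
proof -
  let ?f = "\<lambda>(x, t). (x, (1 - t) * l x + t * h x)"
  have "between_graphs l h {a..b} = ?f ` ({a..b} \<times> {0..1})"
  proof (intro equalityI subsetI)
    fix z assume "z \<in> between_graphs l h {a..b}"
    then obtain x y where z: "z = (x, y)" "x \<in> {a..b}" "l x \<le> y" "y \<le> h x"
      by (auto simp: between_graphs_def)
    then have "y \<in> closed_segment (l x) (h x)" by (simp add: closed_segment_eq_real_ivl)
    then obtain t where "0 \<le> t" "t \<le> 1" "y = (1 - t) * l x + t * h x"
      by (auto simp: closed_segment_def)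
    with z show "z \<in> ?f ` ({a..b} \<times> {0..1})" by (auto intro!: image_eqI[of _ _ "(x, t)"])
  next
    fix z assume "z \<in> ?f ` ({a..b} \<times> {0..1})"
    then obtain x t where z: "z = (x, (1 - t) * l x + t * h x)" "x \<in> {a..b}" "0 \<le> t" "t \<le> 1" by auto
    then have "(1 - t) * l x + t * h x \<in> closed_segment (l x) (h x)"
      by (auto simp: closed_segment_def)
    with le[OF z(2)] z show "z \<in> between_graphs l h {a..b}"
      by (auto simp: between_graphs_def closed_segment_eq_real_ivl)
  qed
  moreover have "continuous_on ({a..b} \<times> {0..1}) ?f"
    unfolding case_prod_unfold
    by (intro continuous_intros continuous_on_compose2[OF l] continuous_on_compose2[OF h]) auto
  ultimately show ?thesis
    by (simp add: connected_continuous_image convex_connected convex_Times)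
qed

text \<open>
  Over an interval on which the upper graph stays above the lower one the region is connected, hence
  contained in a component.
\<close>
lemma max_component_area_ge:
  fixes l h :: "real \<Rightarrow> real"
  assumes l: "continuous_on UNIV l" and h: "continuous_on UNIV h" and bd: "bounded {x. l x \<le> h x}"
    and ab: "a \<le> b" and le: "\<And>x. x \<in> {a..b} \<Longrightarrow> l x \<le> h x"
  shows "integral {a..b} (\<lambda>x. h x - l x) \<le> max_component_area (between_graphs l h UNIV)"
proof -
  let ?X = "between_graphs l h UNIV" and ?R = "between_graphs l h {a..b}"
  have cX: "compact ?X" by (rule compact_between_graphs[OF l h bd]) simp
  have sub: "?R \<subseteq> ?X" by (auto simp: between_graphs_def)
  have ne: "(a, l a) \<in> ?R" using ab le[of a] by (auto simp: between_graphs_def)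
  obtain C where C: "C \<in> components ?X" "?R \<subseteq> C"
    using exists_component_superset[OF sub _ connected_between_graphs[OF l h le]] ne sub by blast
  have lm: "D \<in> lmeasurable" if "D \<in> components ?X" for D
    using that cX by (meson compact_components lmeasurable_compact)
  have "measure lebesgue ?R \<le> measure lebesgue C"
    using measure_between_graphs(2)[OF l h le] lm[OF C(1)] C(2) by (intro measure_mono_fmeasurable) auto
  also have "\<dots> \<le> (SUP C\<in>components ?X. measure lebesgue C)"
  proof (rule cSUP_upper[OF C(1)])
    show "bdd_above (measure lebesgue ` components ?X)"
    proof (rule bdd_aboveI2)
      fix D assume "D \<in> components ?X"
      then show "measure lebesgue D \<le> measure lebesgue ?X"
        using lm[of D] cX in_components_subset by (intro measure_mono_fmeasurable) (auto intro: lmeasurable_compact)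
    qed
  qed
  finally show ?thesis
    using measure_between_graphs(1)[OF l h le] ne sub by (auto simp: max_component_area_def)
qed

text \<open>
  The projection of a component to the x-axis is a compact interval, and the component lies over it.
\<close>
lemma max_component_area_le:
  fixes l h :: "real \<Rightarrow> real"
  assumes l: "continuous_on UNIV l" and h: "continuous_on UNIV h" and bd: "bounded {x. l x \<le> h x}"
    and M: "0 \<le> M"
    and le: "\<And>a b. a \<le> b \<Longrightarrow> (\<And>x. x \<in> {a..b} \<Longrightarrow> l x \<le> h x) \<Longrightarrow> integral {a..b} (\<lambda>x. h x - l x) \<le> M"
  shows "max_component_area (between_graphs l h UNIV) \<le> M"
proof (cases "between_graphs l h UNIV = {}")
  case True
  then show ?thesis using M by (simp add: max_component_area_def)
next
  case False
  let ?X = "between_graphs l h UNIV"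
  have cX: "compact ?X" by (rule compact_between_graphs[OF l h bd]) simp
  have "measure lebesgue C \<le> M" if C: "C \<in> components ?X" for C
  proof -
    have cC: "compact C" using C cX by (rule compact_components[rotated])
    have "connected (fst ` C)" "compact (fst ` C)"
      using C cC by (auto intro!: connected_continuous_image compact_continuous_image continuous_intros
          dest: in_components_connected)
    then obtain a b where ab: "fst ` C = {a..b}" by (metis connected_compact_interval_1 box_real(2))
    have "C \<noteq> {}" using C in_components_nonempty by auto
    then have "a \<le> b" using ab by (metis atLeastatMost_empty_iff2 image_is_empty)
    have le': "l x \<le> h x" if "x \<in> {a..b}" for x
    proof -
      have "x \<in> fst ` C" using ab that by simp
      then obtain y where "(x, y) \<in> C" by force
      then have "(x, y) \<in> ?X" using C in_components_subset by blast
      then show ?thesis by (auto simp: between_graphs_def)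
    qed
    have "C \<subseteq> between_graphs l h {a..b}"
    proof
      fix z assume "z \<in> C"
      then have "z \<in> ?X" "fst z \<in> {a..b}" using C in_components_subset ab by blast+
      then show "z \<in> between_graphs l h {a..b}" by (auto simp: between_graphs_def)
    qed
    then have "measure lebesgue C \<le> measure lebesgue (between_graphs l h {a..b})"
      using measure_between_graphs(2)[OF l h le'] fmeasurableD[OF lmeasurable_compact[OF cC]]
      by (intro measure_mono_fmeasurable) auto
    also have "\<dots> \<le> M" using le[OF \<open>a \<le> b\<close> le'] measure_between_graphs(1)[OF l h le'] by simp
    finally show ?thesis .
  qed
  moreover have "components ?X \<noteq> {}" using False by simp
  ultimately show ?thesis using False by (auto simp: max_component_area_def intro!: cSUP_least)
qed

section \<open>The lower and the upper boundary of a region\<close>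

lemma finite_pos_lower_bound:
  fixes f :: "'a \<Rightarrow> real"
  assumes "finite S" "\<And>x. x \<in> S \<Longrightarrow> 0 < f x"
  obtains c where "0 < c" "\<And>x. x \<in> S \<Longrightarrow> c \<le> f x"
proof
  show "0 < Min (insert 1 (f ` S))" using assms by (subst Min_gr_iff) auto
  show "Min (insert 1 (f ` S)) \<le> f x" if "x \<in> S" for x using assms(1) that by (intro Min_le) auto
qed

lemma finite_upper_bound:
  fixes f :: "'a \<Rightarrow> real"
  assumes "finite S"
  obtains c where "0 < c" "\<And>x. x \<in> S \<Longrightarrow> f x \<le> c"
proof
  show "0 < Max (insert 1 (f ` S))" using assms by (subst Max_gr_iff) auto
  show "f x \<le> Max (insert 1 (f ` S))" if "x \<in> S" for x using assms that by (intro Max_ge) auto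
qed

locale sofa =
  fixes \<alpha> :: "real list" and \<beta>1 \<beta>2 :: real
  assumes length_pos: "1 \<le> length \<alpha>"
    and angles_sorted: "sorted_wrt (<) \<alpha>"
    and angles_range: "\<forall>a\<in>set \<alpha>. 0 < a \<and> a < pi / 2"
    and angles_less: "last \<alpha> < \<beta>1"
    and beta_le: "\<beta>1 \<le> \<beta>2"
    and beta_le_half_pi: "\<beta>2 \<le> pi / 2"
begin

abbreviation k :: nat where "k \<equiv> length \<alpha>"
abbreviation si :: "nat \<Rightarrow> real" where "si m \<equiv> sin (\<alpha> ! m)"
abbreviation co :: "nat \<Rightarrow> real" where "co m \<equiv> cos (\<alpha> ! m)"

text \<open>
  A position of the k hallways is a function on the indices below \<open>2 * k\<close>. Hallway \<open>m\<close> has four walls,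
  written as ordinates over \<open>x\<close>: \<open>oR\<close> and \<open>iR\<close> are the outer and the inner wall of its right arm, which
  fall with slope \<open>- cot\<close> of the angle; \<open>oL\<close> and \<open>iL\<close> are those of the left arm, rising with slope
  \<open>tan\<close>. A point lies in the hallway iff it is below both outer walls and above at least one inner wall.
  For a box, outer walls are taken at its largest position \<open>q\<close> and inner walls at its smallest
  position \<open>p\<close>. The butterfly is the set between \<open>W0\<close> and \<open>W1\<close>.
\<close>
definition oR :: "(nat \<Rightarrow> real) \<Rightarrow> nat \<Rightarrow> real \<Rightarrow> real" where
  "oR q m x = (q (2 * m) + 1 - x * co m) / si m"
definition oL :: "(nat \<Rightarrow> real) \<Rightarrow> nat \<Rightarrow> real \<Rightarrow> real" where
  "oL q m x = (q (2 * m + 1) + 1 + x * si m) / co m"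
definition iR :: "(nat \<Rightarrow> real) \<Rightarrow> nat \<Rightarrow> real \<Rightarrow> real" where
  "iR p m x = (p (2 * m) - x * co m) / si m"
definition iL :: "(nat \<Rightarrow> real) \<Rightarrow> nat \<Rightarrow> real \<Rightarrow> real" where
  "iL p m x = (p (2 * m + 1) + x * si m) / co m"
definition W1 :: "real \<Rightarrow> real" where
  "W1 x = max ((1 - x * cos \<beta>1) / sin \<beta>1) ((1 - x * cos \<beta>2) / sin \<beta>2)"
definition W0 :: "real \<Rightarrow> real" where
  "W0 x = min (- x * cos \<beta>1 / sin \<beta>1) (- x * cos \<beta>2 / sin \<beta>2)"
definition up :: "(nat \<Rightarrow> real) \<Rightarrow> real \<Rightarrow> real" where
  "up q x = Min (insert 1 (insert (W1 x) ((\<lambda>m. oR q m x) ` {..<k} \<union> (\<lambda>m. oL q m x) ` {..<k})))"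
definition lo :: "(nat \<Rightarrow> real) \<Rightarrow> real \<Rightarrow> real" where
  "lo p x = Max (insert 0 (insert (W0 x) ((\<lambda>m. min (iR p m x) (iL p m x)) ` {..<k})))"
definition gap :: "(nat \<Rightarrow> real) \<Rightarrow> (nat \<Rightarrow> real) \<Rightarrow> real \<Rightarrow> real" where
  "gap p q x = up q x - lo p x"
definition near :: "real \<Rightarrow> (nat \<Rightarrow> real) \<Rightarrow> (nat \<Rightarrow> real) \<Rightarrow> bool" where
  "near d p q \<longleftrightarrow> (\<forall>i<2 * k. \<bar>p i - q i\<bar> \<le> d)"
definition feasible :: "(nat \<Rightarrow> real) \<Rightarrow> (nat \<Rightarrow> real) \<Rightarrow> real \<Rightarrow> real \<Rightarrow> bool" where
  "feasible p q a b \<longleftrightarrow> a \<le> b \<and> (\<forall>x\<in>{a..b}. 0 \<le> gap p q x)"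
definition area :: "(nat \<Rightarrow> real) \<Rightarrow> (nat \<Rightarrow> real) \<Rightarrow> real \<Rightarrow> real \<Rightarrow> real" where
  "area p q a b = integral {a..b} (gap p q)"
definition maxarea :: "(nat \<Rightarrow> real) \<Rightarrow> (nat \<Rightarrow> real) \<Rightarrow> real" where
  "maxarea p q = max_component_area (between_graphs (lo p) (up q) UNIV)"

lemma angle_pos: "m < k \<Longrightarrow> 0 < \<alpha> ! m" and angle_less_half_pi: "m < k \<Longrightarrow> \<alpha> ! m < pi / 2"
  using angles_range nth_mem by blast+

lemma angle_mono: "m < n \<Longrightarrow> n < k \<Longrightarrow> \<alpha> ! m < \<alpha> ! n"
  using angles_sorted by (auto simp: sorted_wrt_iff_nth_less)

lemma angle_less_beta1: "m < k \<Longrightarrow> \<alpha> ! m < \<beta>1"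
proof -
  assume m: "m < k"
  have "\<alpha> \<noteq> []" using m by auto
  then have l: "last \<alpha> = \<alpha> ! (k - 1)" by (rule last_conv_nth)
  have "\<alpha> ! m \<le> \<alpha> ! (k - 1)"
    using angle_mono[of m "k - 1"] m by (cases "m = k - 1") (auto simp: less_eq_real_def)
  then show ?thesis using angles_less l by simp
qed

lemma beta1_pos: "0 < \<beta>1" using angle_pos[of 0] angle_less_beta1[of 0] length_pos by fastforce

lemma si_pos: "m < k \<Longrightarrow> 0 < si m" using angle_pos[of m] angle_less_half_pi[of m]
  by (intro sin_gt_zero) auto
lemma co_pos: "m < k \<Longrightarrow> 0 < co m" using angle_pos[of m] angle_less_half_pi[of m]
  by (intro cos_gt_zero) auto
lemma sin_beta_pos: "0 < sin \<beta>1" "0 < sin \<beta>2"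
  using beta1_pos beta_le beta_le_half_pi by (auto intro!: sin_gt_zero)
lemma cos_beta_nonneg: "0 \<le> cos \<beta>1" "0 \<le> cos \<beta>2"
  using beta1_pos beta_le beta_le_half_pi by (auto intro!: cos_ge_zero)

lemma up_ge_iff: "y \<le> up q x \<longleftrightarrow> y \<le> 1 \<and> y \<le> W1 x \<and> (\<forall>m<k. y \<le> oR q m x) \<and> (\<forall>m<k. y \<le> oL q m x)"
  unfolding up_def by (subst Min_ge_iff) auto
lemma lo_le_iff: "lo p x \<le> y \<longleftrightarrow> 0 \<le> y \<and> W0 x \<le> y \<and> (\<forall>m<k. min (iR p m x) (iL p m x) \<le> y)"
  unfolding lo_def by (subst Max_le_iff) auto

lemma up_cases:
  obtains "up q x = 1" | "up q x = W1 x" | m where "m < k" "up q x = oR q m x"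
    | m where "m < k" "up q x = oL q m x"
proof -
  have "up q x \<in> insert 1 (insert (W1 x) ((\<lambda>m. oR q m x) ` {..<k} \<union> (\<lambda>m. oL q m x) ` {..<k}))"
    unfolding up_def by (rule Min_in) auto
  then show thesis using that by auto
qed

lemma lo_cases:
  obtains "lo p x = 0" | "lo p x = W0 x" | m where "m < k" "lo p x = min (iR p m x) (iL p m x)"
proof -
  have "lo p x \<in> insert 0 (insert (W0 x) ((\<lambda>m. min (iR p m x) (iL p m x)) ` {..<k}))"
    unfolding lo_def by (rule Max_in) auto
  then show thesis using that by auto
qed

lemma up_le: "up q x \<le> 1" "up q x \<le> W1 x" "m < k \<Longrightarrow> up q x \<le> oR q m x" "m < k \<Longrightarrow> up q x \<le> oL q m x"
  using up_ge_iff[of "up q x" q x] by auto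
lemma lo_ge: "0 \<le> lo p x" "W0 x \<le> lo p x" "m < k \<Longrightarrow> min (iR p m x) (iL p m x) \<le> lo p x"
  using lo_le_iff[of p x "lo p x"] by auto

lemma gap_le_1: "gap p q x \<le> 1"
  using up_le(1)[of q x] lo_ge(1)[of p x] by (simp add: gap_def)

lemma oR_mono: "m < k \<Longrightarrow> q (2*m) \<le> q' (2*m) \<Longrightarrow> oR q m x \<le> oR q' m x"
  using si_pos[of m] by (simp add: oR_def divide_right_mono)
lemma oL_mono: "m < k \<Longrightarrow> q (2*m+1) \<le> q' (2*m+1) \<Longrightarrow> oL q m x \<le> oL q' m x"
  using co_pos[of m] by (simp add: oL_def divide_right_mono)
lemma iR_mono: "m < k \<Longrightarrow> q (2*m) \<le> q' (2*m) \<Longrightarrow> iR q m x \<le> iR q' m x"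
  using si_pos[of m] by (simp add: iR_def divide_right_mono)
lemma iL_mono: "m < k \<Longrightarrow> q (2*m+1) \<le> q' (2*m+1) \<Longrightarrow> iL q m x \<le> iL q' m x"
  using co_pos[of m] by (simp add: iL_def divide_right_mono)

lemma up_mono: assumes "\<And>i. i < 2*k \<Longrightarrow> q i \<le> q' i" shows "up q x \<le> up q' x"
  unfolding up_ge_iff
  using up_le(1,2)[of q x] assms by (auto intro!: order.trans[OF up_le(3) oR_mono] order.trans[OF up_le(4) oL_mono])

lemma lo_mono: assumes "\<And>i. i < 2*k \<Longrightarrow> p i \<le> p' i" shows "lo p x \<le> lo p' x"
proof -
  have "min (iR p m x) (iL p m x) \<le> lo p' x" if m: "m < k" for m
    using lo_ge(3)[OF m, of p' x] iR_mono[OF m, of p p' x] iL_mono[OF m, of p p' x] assms[of "2*m"] assms[of "2*m+1"] m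
    by (auto simp: min_le_iff_disj min_def split: if_splits)
  then show ?thesis unfolding lo_le_iff using lo_ge(1)[of p' x] lo_ge(2)[of x p'] by auto
qed

lemma gap_mono:
  assumes "\<And>i. i < 2*k \<Longrightarrow> p' i \<le> p i" "\<And>i. i < 2*k \<Longrightarrow> q i \<le> q' i"
  shows "gap p q x \<le> gap p' q' x"
  using up_mono[of q q' x] lo_mono[of p' p x] assms unfolding gap_def by fastforce

lemma up_cong: assumes "\<And>i. i < 2*k \<Longrightarrow> q i = q' i" shows "up q x = up q' x"
  using up_mono[of q q' x] up_mono[of q' q x] assms by force
lemma lo_cong: assumes "\<And>i. i < 2*k \<Longrightarrow> q i = q' i" shows "lo q x = lo q' x"
  using lo_mono[of q q' x] lo_mono[of q' q x] assms by force

lemma maxarea_cong: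
  assumes "\<And>i. i < 2*k \<Longrightarrow> p i = p' i" "\<And>i. i < 2*k \<Longrightarrow> q i = q' i"
  shows "maxarea p q = maxarea p' q'"
proof -
  have "lo p = lo p'" "up q = up q'" using lo_cong[of p p'] up_cong[of q q'] assms by blast+
  then show ?thesis by (simp add: maxarea_def)
qed

text \<open>
  One constant serves all positions and all abscissas: position and abscissa enter every wall linearly.
\<close>
lemma pieces_lipschitz:
  obtains K where "0 < K"
    "\<And>d p q x x' m. near d p q \<Longrightarrow> \<bar>x - x'\<bar> \<le> d \<Longrightarrow> m < k \<Longrightarrow> \<bar>oR p m x - oR q m x'\<bar> \<le> K * d"
    "\<And>d p q x x' m. near d p q \<Longrightarrow> \<bar>x - x'\<bar> \<le> d \<Longrightarrow> m < k \<Longrightarrow> \<bar>oL p m x - oL q m x'\<bar> \<le> K * d"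
    "\<And>d p q x x' m. near d p q \<Longrightarrow> \<bar>x - x'\<bar> \<le> d \<Longrightarrow> m < k \<Longrightarrow> \<bar>iR p m x - iR q m x'\<bar> \<le> K * d"
    "\<And>d p q x x' m. near d p q \<Longrightarrow> \<bar>x - x'\<bar> \<le> d \<Longrightarrow> m < k \<Longrightarrow> \<bar>iL p m x - iL q m x'\<bar> \<le> K * d"
    "\<And>d x x'. \<bar>x - x'\<bar> \<le> d \<Longrightarrow> \<bar>W1 x - W1 x'\<bar> \<le> K * d"
    "\<And>d x x'. \<bar>x - x'\<bar> \<le> d \<Longrightarrow> \<bar>W0 x - W0 x'\<bar> \<le> K * d"
proof -
  obtain A where A: "0 < A" "\<And>m. m \<in> {..<k} \<Longrightarrow> 2 / si m \<le> A"
    by (rule finite_upper_bound[of "{..<k}" "\<lambda>m. 2 / si m"]) auto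
  obtain B where B: "0 < B" "\<And>m. m \<in> {..<k} \<Longrightarrow> 2 / co m \<le> B"
    by (rule finite_upper_bound[of "{..<k}" "\<lambda>m. 2 / co m"]) auto
  define L where "L = A + B + cos \<beta>1 / sin \<beta>1 + cos \<beta>2 / sin \<beta>2"
  have c: "0 \<le> cos \<beta>1 / sin \<beta>1" "0 \<le> cos \<beta>2 / sin \<beta>2"
    using sin_beta_pos cos_beta_nonneg by auto
  have L: "0 < L" "A \<le> L" "B \<le> L" "cos \<beta>1 / sin \<beta>1 \<le> L" "cos \<beta>2 / sin \<beta>2 \<le> L"
    using A(1) B(1) c by (auto simp: L_def)
  have piece: "\<bar>(u - x * c) / s - (u' - x' * c) / s\<bar> \<le> L * d"
    if "\<bar>u - u'\<bar> \<le> d" "\<bar>x - x'\<bar> \<le> d" "\<bar>c\<bar> \<le> 1" "0 < s" "2 / s \<le> L" for u u' x x' c s d :: real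
  proof -
    have d: "0 \<le> d" using that(1) by linarith
    have "\<bar>(u - x * c) / s - (u' - x' * c) / s\<bar> = \<bar>(u - u') - (x - x') * c\<bar> / s"
      using that(4) by (simp add: abs_divide flip: diff_divide_distrib) (simp add: algebra_simps)
    also have "\<bar>(u - u') - (x - x') * c\<bar> \<le> \<bar>u - u'\<bar> + \<bar>x - x'\<bar> * \<bar>c\<bar>"
      by (metis abs_mult abs_triangle_ineq4)
    also have "\<dots> \<le> d + d * 1" using that d by (intro add_mono mult_mono) auto
    finally have "\<bar>(u - x * c) / s - (u' - x' * c) / s\<bar> \<le> (2 / s) * d" using that(4) by (simp add: divide_right_mono)
    also have "\<dots> \<le> L * d" using that d by (intro mult_right_mono) auto
    finally show ?thesis .
  qed
  have pR: "\<bar>oR q m x - oR q' m x'\<bar> \<le> L * d" "\<bar>iR q m x - iR q' m x'\<bar> \<le> L * d"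
    "\<bar>oL q m x - oL q' m x'\<bar> \<le> L * d" "\<bar>iL q m x - iL q' m x'\<bar> \<le> L * d"
    if n: "near d q q'" and xx: "\<bar>x - x'\<bar> \<le> d" and m: "m < k" for d q q' x x' m
  proof -
    have q: "\<bar>q (2*m) - q' (2*m)\<bar> \<le> d" "\<bar>q (2*m+1) - q' (2*m+1)\<bar> \<le> d"
      using n m by (auto simp: near_def)
    have A': "2 / si m \<le> L" "2 / co m \<le> L" using A(2)[of m] B(2)[of m] m L by auto
    show "\<bar>oR q m x - oR q' m x'\<bar> \<le> L * d"
      using piece[of "q (2*m) + 1" "q' (2*m) + 1" d x x' "co m" "si m"] q xx A' si_pos[OF m] by (simp add: oR_def)
    show "\<bar>iR q m x - iR q' m x'\<bar> \<le> L * d"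
      using piece[of "q (2*m)" "q' (2*m)" d x x' "co m" "si m"] q xx A' si_pos[OF m] by (simp add: iR_def)
    show "\<bar>oL q m x - oL q' m x'\<bar> \<le> L * d"
      using piece[of "q (2*m+1) + 1" "q' (2*m+1) + 1" d x x' "- si m" "co m"] q xx A' co_pos[OF m] by (simp add: oL_def)
    show "\<bar>iL q m x - iL q' m x'\<bar> \<le> L * d"
      using piece[of "q (2*m+1)" "q' (2*m+1)" d x x' "- si m" "co m"] q xx A' co_pos[OF m] by (simp add: iL_def)
  qed
  have ln: "\<bar>(v - x * cos \<beta>) / sin \<beta> - (v - x' * cos \<beta>) / sin \<beta>\<bar> \<le> L * d"
    if "\<bar>x - x'\<bar> \<le> d" "\<beta> = \<beta>1 \<or> \<beta> = \<beta>2" for v x x' d \<beta>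
  proof -
    have cs: "0 \<le> cos \<beta> / sin \<beta>" "cos \<beta> / sin \<beta> \<le> L" using that(2) c L by auto
    have "(v - x * cos \<beta>) / sin \<beta> - (v - x' * cos \<beta>) / sin \<beta> = (x' - x) * (cos \<beta> / sin \<beta>)"
      by (simp add: left_diff_distrib diff_divide_distrib)
    then have "\<bar>(v - x * cos \<beta>) / sin \<beta> - (v - x' * cos \<beta>) / sin \<beta>\<bar> = \<bar>x - x'\<bar> * (cos \<beta> / sin \<beta>)"
      using abs_of_nonneg[OF cs(1)] by (metis abs_mult abs_minus_commute)
    also have "\<dots> \<le> d * L" using that(1) cs by (intro mult_mono) auto
    finally show ?thesis by (simp add: mult.commute)
  qed
  have w1: "\<bar>W1 x - W1 x'\<bar> \<le> L * d" if "\<bar>x - x'\<bar> \<le> d" for x x' d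
    using ln[OF that, of \<beta>1 1] ln[OF that, of \<beta>2 1] by (auto simp: W1_def max_def abs_le_iff)
  have w0: "\<bar>W0 x - W0 x'\<bar> \<le> L * d" if "\<bar>x - x'\<bar> \<le> d" for x x' d
    using ln[OF that, of \<beta>1 0] ln[OF that, of \<beta>2 0] by (auto simp: W0_def min_def abs_le_iff)
  show thesis by (rule that[OF L(1) pR(1) pR(3) pR(2) pR(4) w1 w0])
qed

lemma gap_lipschitz:
  obtains K where "0 < K"
    "\<And>d p q p' q' x x'. near d p p' \<Longrightarrow> near d q q' \<Longrightarrow> \<bar>x - x'\<bar> \<le> d \<Longrightarrow> \<bar>up q x - up q' x'\<bar> \<le> K * d"
    "\<And>d p q p' q' x x'. near d p p' \<Longrightarrow> near d q q' \<Longrightarrow> \<bar>x - x'\<bar> \<le> d \<Longrightarrow> \<bar>lo p x - lo p' x'\<bar> \<le> K * d"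
    "\<And>d p q p' q' x x'. near d p p' \<Longrightarrow> near d q q' \<Longrightarrow> \<bar>x - x'\<bar> \<le> d \<Longrightarrow> \<bar>gap p q x - gap p' q' x'\<bar> \<le> K * d"
proof -
  obtain L where L: "0 < L"
    "\<And>d p q x x' m. near d p q \<Longrightarrow> \<bar>x - x'\<bar> \<le> d \<Longrightarrow> m < k \<Longrightarrow> \<bar>oR p m x - oR q m x'\<bar> \<le> L * d"
    "\<And>d p q x x' m. near d p q \<Longrightarrow> \<bar>x - x'\<bar> \<le> d \<Longrightarrow> m < k \<Longrightarrow> \<bar>oL p m x - oL q m x'\<bar> \<le> L * d"
    "\<And>d p q x x' m. near d p q \<Longrightarrow> \<bar>x - x'\<bar> \<le> d \<Longrightarrow> m < k \<Longrightarrow> \<bar>iR p m x - iR q m x'\<bar> \<le> L * d"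
    "\<And>d p q x x' m. near d p q \<Longrightarrow> \<bar>x - x'\<bar> \<le> d \<Longrightarrow> m < k \<Longrightarrow> \<bar>iL p m x - iL q m x'\<bar> \<le> L * d"
    "\<And>d x x'. \<bar>x - x'\<bar> \<le> d \<Longrightarrow> \<bar>W1 x - W1 x'\<bar> \<le> L * d"
    "\<And>d x x'. \<bar>x - x'\<bar> \<le> d \<Longrightarrow> \<bar>W0 x - W0 x'\<bar> \<le> L * d"
    by (rule pieces_lipschitz, rule that) assumption+
  have upl: "up q x - L * d \<le> up q' x'" if n: "near d q q'" and xx: "\<bar>x - x'\<bar> \<le> d" for d q q' x x'
  proof -
    have "0 \<le> d" using xx by linarith
    then have "0 \<le> L * d" using L(1) by simp
    moreover have "up q x - L * d \<le> oR q' m x'" "up q x - L * d \<le> oL q' m x'" if m: "m < k" for m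
      using L(2,3)[OF n xx m] up_le(3,4)[OF m, of q x] by (auto simp: abs_le_iff)
    ultimately show ?thesis unfolding up_ge_iff
      using L(6)[OF xx] up_le(1,2)[of q x] by (auto simp: abs_le_iff)
  qed
  have lol: "lo q x \<le> lo q' x' + L * d" if n: "near d q q'" and xx: "\<bar>x - x'\<bar> \<le> d" for d q q' x x'
  proof -
    have "0 \<le> d" using xx by linarith
    then have "0 \<le> L * d" using L(1) by simp
    moreover have "min (iR q m x) (iL q m x) \<le> lo q' x' + L * d" if m: "m < k" for m
      using L(4,5)[OF n xx m] lo_ge(3)[OF m, of q' x'] by (auto simp: abs_le_iff min_le_iff_disj)
    ultimately show ?thesis unfolding lo_le_iff
      using L(7)[OF xx] lo_ge(2)[of x' q'] lo_ge(1)[of q' x'] by (auto simp: abs_le_iff)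
  qed
  have sym: "near d q' q" if "near d q q'" for d q q' using that by (auto simp: near_def abs_minus_commute)
  have U: "\<bar>up q x - up q' x'\<bar> \<le> L * d" if "near d q q'" "\<bar>x - x'\<bar> \<le> d" for d q q' x x'
    using upl[OF that] upl[OF sym[OF that(1)], of x' x] that(2) by (auto simp: abs_le_iff)
  have Lo: "\<bar>lo q x - lo q' x'\<bar> \<le> L * d" if "near d q q'" "\<bar>x - x'\<bar> \<le> d" for d q q' x x'
    using lol[OF that] lol[OF sym[OF that(1)], of x' x] that(2) by (auto simp: abs_le_iff)
  show thesis
  proof (rule that[of "2 * L"])
    show "0 < 2 * L" using L(1) by simp
    fix d p q p' q' x x' assume n: "near d p p'" "near d q q'" "\<bar>x - x'\<bar> \<le> d"
    have "0 \<le> L * d" using n(3) L(1) by (intro mult_nonneg_nonneg) auto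
    then show "\<bar>up q x - up q' x'\<bar> \<le> 2 * L * d" "\<bar>lo p x - lo p' x'\<bar> \<le> 2 * L * d"
        "\<bar>gap p q x - gap p' q' x'\<bar> \<le> 2 * L * d"
      using U[OF n(2,3)] Lo[OF n(1,3)] by (auto simp: gap_def abs_le_iff)
  qed
qed

lemma near_refl: "0 \<le> d \<Longrightarrow> near d p p" by (simp add: near_def)

lemma lipschitz_imp_continuous:
  fixes f :: "real \<Rightarrow> real"
  assumes "0 < K" "\<And>x x'. \<bar>f x - f x'\<bar> \<le> K * \<bar>x - x'\<bar>"
  shows "continuous_on S f"
proof (rule continuous_on_subset[OF _ subset_UNIV], unfold continuous_on_iff, intro ballI allI impI)
  fix x e :: real assume "0 < e"
  then show "\<exists>d>0. \<forall>x'\<in>UNIV. dist x' x < d \<longrightarrow> dist (f x') (f x) < e"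
  proof (intro exI[of _ "e / K"] conjI ballI impI)
    show "0 < e / K" using \<open>0 < e\<close> assms(1) by simp
    fix x' assume "dist x' x < e / K"
    then have "K * \<bar>x' - x\<bar> < e" using assms(1) by (simp add: dist_real_def field_simps)
    then show "dist (f x') (f x) < e" using assms(2)[of x' x] by (simp add: dist_real_def)
  qed
qed

lemma continuous_up: "continuous_on S (up q)" and continuous_lo: "continuous_on S (lo p)"
  and continuous_gap: "continuous_on S (gap p q)"
proof -
  obtain K where K: "0 < K"
    "\<And>d p q p' q' x x'. near d p p' \<Longrightarrow> near d q q' \<Longrightarrow> \<bar>x - x'\<bar> \<le> d \<Longrightarrow> \<bar>up q x - up q' x'\<bar> \<le> K * d"
    "\<And>d p q p' q' x x'. near d p p' \<Longrightarrow> near d q q' \<Longrightarrow> \<bar>x - x'\<bar> \<le> d \<Longrightarrow> \<bar>lo p x - lo p' x'\<bar> \<le> K * d"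
    using gap_lipschitz by metis
  show u: "continuous_on S (up q)" for S
    by (rule lipschitz_imp_continuous[OF K(1)], rule K(2)[of _ undefined undefined]) (auto simp: near_refl)
  show l: "continuous_on S (lo p)" for S
    by (rule lipschitz_imp_continuous[OF K(1)], rule K(3)[of _ _ _ undefined undefined]) (auto simp: near_refl)
  show "continuous_on S (gap p q)"
    unfolding gap_def by (intro continuous_intros u l)
qed

lemma gap_integrable: "gap p q integrable_on {a..b}"
  by (intro integrable_continuous_real continuous_gap)

lemma gap_nonneg_bounds:
  assumes "0 \<le> gap p q x"
  shows "x \<le> (q 0 + 1) / co 0" "- (q 1 + 1) / si 0 \<le> x"
proof -
  have k0: "0 < k" using length_pos by linarith
  have "0 \<le> up q x" using assms lo_ge(1)[of p x] by (simp add: gap_def)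
  then have "0 \<le> oR q 0 x" "0 \<le> oL q 0 x" using up_le(3,4)[OF k0, of q x] by linarith+
  then show "x \<le> (q 0 + 1) / co 0" "- (q 1 + 1) / si 0 \<le> x"
    using si_pos[OF k0] co_pos[OF k0] by (simp_all add: oR_def oL_def field_simps)
qed

lemma bounded_gap: "bounded {x. lo p x \<le> up q x}"
proof -
  have "{x. lo p x \<le> up q x} \<subseteq> {- (q 1 + 1) / si 0 .. (q 0 + 1) / co 0}"
    using gap_nonneg_bounds[of p q] by (auto simp: gap_def)
  then show ?thesis using bounded_closed_interval bounded_subset by blast
qed

lemma area_le_maxarea: "feasible p q a b \<Longrightarrow> area p q a b \<le> maxarea p q"
  using max_component_area_ge[OF continuous_lo continuous_up bounded_gap, of a b p q]
  by (auto simp: feasible_def area_def maxarea_def gap_def[abs_def])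

lemma maxarea_le:
  assumes "0 \<le> c" "\<And>a b. feasible p q a b \<Longrightarrow> area p q a b \<le> c"
  shows "maxarea p q \<le> c"
  unfolding maxarea_def
  using assms(2) by (intro max_component_area_le continuous_lo continuous_up bounded_gap assms(1))
    (auto simp: feasible_def area_def gap_def[abs_def])

lemma less_maxarea:
  assumes "0 \<le> c" "c < maxarea p q"
  obtains a b where "feasible p q a b" "c < area p q a b"
  using maxarea_le[OF assms(1), of p q] assms(2) by fastforce

lemma max_component_area_nonneg:
  fixes l h :: "real \<Rightarrow> real"
  assumes "continuous_on UNIV l" "continuous_on UNIV h" "bounded {x. l x \<le> h x}"
  shows "0 \<le> max_component_area (between_graphs l h UNIV)"
proof (cases "\<exists>x. l x \<le> h x")
  case True
  then obtain x where "l x \<le> h x" by blast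
  then show ?thesis using max_component_area_ge[OF assms, of x x] by simp
next
  case False
  then have "between_graphs l h UNIV = {}" by (auto simp: between_graphs_def) (meson order_trans)
  then show ?thesis by (simp add: max_component_area_def)
qed

lemma maxarea_nonneg: "0 \<le> maxarea p q"
  unfolding maxarea_def by (intro max_component_area_nonneg continuous_lo continuous_up bounded_gap)

lemma maxarea_mono:
  assumes "\<And>x. gap p q x \<le> gap p' q' x"
  shows "maxarea p q \<le> maxarea p' q'"
proof (rule maxarea_le[OF maxarea_nonneg])
  fix a b assume f: "feasible p q a b"
  then have "feasible p' q' a b" using assms by (auto simp: feasible_def intro: order_trans)
  then have "area p' q' a b \<le> maxarea p' q'" by (rule area_le_maxarea)
  moreover have "area p q a b \<le> area p' q' a b"
    unfolding area_def by (intro integral_le gap_integrable assms)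
  ultimately show "area p q a b \<le> maxarea p' q'" by simp
qed

text \<open>
  Upper semicontinuity: as boxes shrink to \<open>u\<close>, intervals carrying almost the area \<open>c\<close> stay bounded, so
  their endpoints converge along a subsequence, and nonnegativity of the gap passes to the limit by the
  uniform Lipschitz bound. Nonnegativity holds on the whole limit interval, so a pinch can appear in
  the limit but the interval is not cut there.
\<close>
lemma feasible_limit:
  assumes lim: "\<And>i. i < 2*k \<Longrightarrow> (\<lambda>n. P n i) \<longlonglongrightarrow> u i" "\<And>i. i < 2*k \<Longrightarrow> (\<lambda>n. Q n i) \<longlonglongrightarrow> u i"
    and c: "0 < c" and ge: "\<And>n. c \<le> maxarea (P n) (Q n)"
  obtains a b where "feasible u u a b" "c \<le> area u u a b"
proof -
  obtain K where K: "0 < K"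
    "\<And>d p q p' q' x x'. near d p p' \<Longrightarrow> near d q q' \<Longrightarrow> \<bar>x - x'\<bar> \<le> d \<Longrightarrow> \<bar>gap p q x - gap p' q' x'\<bar> \<le> K * d"
    using gap_lipschitz by metis
  define e where "e n = c * (1 - 1 / real (n + 2))" for n
  have e: "0 \<le> e n" "e n < c" for n using c by (auto simp: e_def field_simps)
  have elim: "e \<longlonglongrightarrow> c"
  proof -
    have "(\<lambda>n. 1 / real (n + 2)) \<longlonglongrightarrow> 0"
      using LIMSEQ_ignore_initial_segment[OF lim_inverse_n', of 2] by simp
    then have "(\<lambda>n. c * (1 - 1 / real (n + 2))) \<longlonglongrightarrow> c * (1 - 0)" by (intro tendsto_intros)
    then show ?thesis by (simp add: e_def[abs_def])
  qed
  have "\<exists>a b. feasible (P n) (Q n) a b \<and> e n < area (P n) (Q n) a b" for n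
    using less_maxarea[OF e(1), of n "P n" "Q n"] e(2)[of n] ge[of n] by (metis order_less_le_trans)
  then obtain A B where AB: "\<And>n. feasible (P n) (Q n) (A n) (B n)" "\<And>n. e n < area (P n) (Q n) (A n) (B n)"
    by metis
  define d where "d n = (\<Sum>i<2*k. \<bar>P n i - u i\<bar> + \<bar>Q n i - u i\<bar>)" for n
  have dlim: "d \<longlonglongrightarrow> 0"
  proof -
    have "(\<lambda>n. \<Sum>i<2*k. \<bar>P n i - u i\<bar> + \<bar>Q n i - u i\<bar>) \<longlonglongrightarrow> (\<Sum>i<2*k. \<bar>u i - u i\<bar> + \<bar>u i - u i\<bar>)"
      using lim by (intro tendsto_intros) auto
    then show ?thesis by (simp add: d_def[abs_def])
  qed
  have d0: "0 \<le> d n" for n by (auto simp: d_def intro!: sum_nonneg)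
  have nearPQ: "near (d n) (P n) u" "near (d n) (Q n) u" for n
  proof -
    have "\<bar>P n i - u i\<bar> + \<bar>Q n i - u i\<bar> \<le> d n" if "i < 2*k" for i
      unfolding d_def using that by (intro member_le_sum) auto
    then show "near (d n) (P n) u" "near (d n) (Q n) u" by (force simp: near_def)+
  qed
  have k0: "0 < k" "0 < 2*k" "1 < 2*k" using length_pos by linarith+
  have "(\<lambda>n. (Q n 0 + 1) / co 0) \<longlonglongrightarrow> (u 0 + 1) / co 0" "(\<lambda>n. - (Q n 1 + 1) / si 0) \<longlonglongrightarrow> - (u 1 + 1) / si 0"
    using lim(2)[OF k0(2)] lim(2)[OF k0(3)] si_pos[OF k0(1)] co_pos[OF k0(1)] by (auto intro!: tendsto_intros)
  then have "Bseq (\<lambda>n. (Q n 0 + 1) / co 0)" "Bseq (\<lambda>n. - (Q n 1 + 1) / si 0)"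
    by (auto intro: convergent_imp_Bseq convergentI)
  then obtain b1 b2 where b: "\<And>n. \<bar>(Q n 0 + 1) / co 0\<bar> \<le> b1" "\<And>n. \<bar>- (Q n 1 + 1) / si 0\<bar> \<le> b2"
    unfolding Bseq_def real_norm_def by blast
  define R where "R = max b1 b2"
  have R: "A n \<in> {-R..R}" "B n \<in> {-R..R}" "A n \<le> B n" for n
  proof -
    have f: "A n \<le> B n" "0 \<le> gap (P n) (Q n) (A n)" "0 \<le> gap (P n) (Q n) (B n)"
      using AB(1)[of n] by (auto simp: feasible_def)
    show "A n \<in> {-R..R}" "B n \<in> {-R..R}" "A n \<le> B n"
      using f(1) gap_nonneg_bounds[OF f(2)] gap_nonneg_bounds[OF f(3)] b(1)[of n, unfolded abs_le_iff] b(2)[of n, unfolded abs_le_iff]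
      unfolding R_def atLeastAtMost_iff by linarith+
  qed
  have "compact ({-R..R} \<times> {-R..R})" by (simp add: compact_Times)
  moreover have "\<forall>n. (A n, B n) \<in> {-R..R} \<times> {-R..R}" using R by auto
  ultimately obtain l r where lr: "strict_mono r" "((\<lambda>n. (A n, B n)) \<circ> r) \<longlonglongrightarrow> l" "l \<in> {-R..R} \<times> {-R..R}"
    unfolding compact_def by meson
  define a b where "a = fst l" and "b = snd l"
  have ar: "(\<lambda>n. A (r n)) \<longlonglongrightarrow> a" and br: "(\<lambda>n. B (r n)) \<longlonglongrightarrow> b"
    using tendsto_fst[OF lr(2)] tendsto_snd[OF lr(2)] by (auto simp: a_def b_def o_def)
  have dr: "(\<lambda>n. d (r n)) \<longlonglongrightarrow> 0" using LIMSEQ_subseq_LIMSEQ[OF dlim lr(1)] by (simp add: o_def)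
  have er: "(\<lambda>n. e (r n)) \<longlonglongrightarrow> c" using LIMSEQ_subseq_LIMSEQ[OF elim lr(1)] by (simp add: o_def)
  have ab: "a \<le> b" using R(3) by (intro LIMSEQ_le[OF ar br]) auto
  have feas: "feasible u u a b"
    unfolding feasible_def
  proof (intro conjI ballI)
    show "a \<le> b" by (rule ab)
    fix x assume x: "x \<in> {a..b}"
    define X where "X n = max (A (r n)) (min (B (r n)) x)" for n
    have "X \<longlonglongrightarrow> max a (min b x)"
      unfolding X_def[abs_def] by (intro tendsto_max tendsto_min ar br tendsto_const)
    moreover have "max a (min b x) = x" using x by auto
    ultimately have Xl: "X \<longlonglongrightarrow> x" by simp
    have Xin: "X n \<in> {A (r n)..B (r n)}" for n using R(3)[of "r n"] by (auto simp: X_def)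
    have "0 \<le> gap u u x + K * (d (r n) + \<bar>X n - x\<bar>)" for n
    proof -
      have "0 \<le> gap (P (r n)) (Q (r n)) (X n)" using AB(1)[of "r n"] Xin[of n] by (auto simp: feasible_def)
      moreover have "\<bar>gap (P (r n)) (Q (r n)) (X n) - gap u u x\<bar> \<le> K * (d (r n) + \<bar>X n - x\<bar>)"
        using nearPQ[of "r n"] d0[of "r n"] by (intro K(2)) (auto simp: near_def intro: add_increasing2)
      ultimately show ?thesis by linarith
    qed
    moreover have "(\<lambda>n. gap u u x + K * (d (r n) + \<bar>X n - x\<bar>)) \<longlonglongrightarrow> gap u u x + K * (0 + \<bar>x - x\<bar>)"
      by (intro tendsto_intros dr Xl)
    ultimately show "0 \<le> gap u u x" using LIMSEQ_le_const[of "\<lambda>n. gap u u x + K * (d (r n) + \<bar>X n - x\<bar>)" "gap u u x" 0] by auto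
  qed
  define \<Phi> where "\<Phi> x = integral {-R..x} (gap u u)" for x
  have cPhi: "continuous_on {-R..R} \<Phi>"
    unfolding \<Phi>_def[abs_def] by (rule indefinite_integral_continuous_1[OF gap_integrable])
  have PhiD: "integral {x..y} (gap u u) = \<Phi> y - \<Phi> x" if "-R \<le> x" "x \<le> y" for x y
    using Henstock_Kurzweil_Integration.integral_combine[OF that gap_integrable, of u u] by (simp add: \<Phi>_def)
  have abR: "a \<in> {-R..R}" "b \<in> {-R..R}" using lr(3) by (auto simp: a_def b_def)
  have P1: "(\<lambda>n. \<Phi> (A (r n))) \<longlonglongrightarrow> \<Phi> a" "(\<lambda>n. \<Phi> (B (r n))) \<longlonglongrightarrow> \<Phi> b"
    using abR R by (auto intro!: continuous_on_tendsto_compose[OF cPhi] ar br)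
  have "e (r n) \<le> \<Phi> (B (r n)) - \<Phi> (A (r n)) + K * d (r n) * (B (r n) - A (r n))" for n
  proof -
    let ?n = "r n"
    have "area (P ?n) (Q ?n) (A ?n) (B ?n) \<le> integral {A ?n..B ?n} (\<lambda>x. gap u u x + K * d ?n)"
      unfolding area_def
    proof (intro integral_le gap_integrable integrable_continuous_real continuous_intros continuous_gap)
      fix x assume "x \<in> {A ?n..B ?n}"
      show "gap (P ?n) (Q ?n) x \<le> gap u u x + K * d ?n"
        using K(2)[OF nearPQ[of ?n], of x x] d0[of ?n] by simp
    qed
    also have "\<dots> = integral {A ?n..B ?n} (gap u u) + K * d ?n * (B ?n - A ?n)"
      using R(3)[of ?n] by (subst Henstock_Kurzweil_Integration.integral_add) (auto intro: gap_integrable)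
    also have "integral {A ?n..B ?n} (gap u u) = \<Phi> (B ?n) - \<Phi> (A ?n)"
      using R[of ?n] by (intro PhiD) auto
    finally show ?thesis using AB(2)[of ?n] by simp
  qed
  moreover have "(\<lambda>n. \<Phi> (B (r n)) - \<Phi> (A (r n)) + K * d (r n) * (B (r n) - A (r n))) \<longlonglongrightarrow> \<Phi> b - \<Phi> a + K * 0 * (b - a)"
    by (intro tendsto_intros P1 dr ar br)
  ultimately have "c \<le> \<Phi> b - \<Phi> a"
    using LIMSEQ_le[OF er] by force
  then have "c \<le> area u u a b" using PhiD[of a b] ab abR by (simp add: area_def)
  with feas show thesis by (rule that)
qed

end

section \<open>Variations of an optimal component\<close>

lemma integral_gain:
  fixes f g :: "real \<Rightarrow> real"
  assumes "continuous_on {p..q} f" "continuous_on {p..q} g" "\<And>x. x \<in> {p..q} \<Longrightarrow> f x \<le> g x"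
    and "p \<le> e1" "e1 \<le> e2" "e2 \<le> q" "\<And>x. x \<in> {e1..e2} \<Longrightarrow> f x + c \<le> g x"
  shows "integral {p..q} f + c * (e2 - e1) \<le> integral {p..q} g"
proof -
  have i: "f integrable_on {r..s}" "g integrable_on {r..s}" if "p \<le> r" "s \<le> q" for r s
    using that assms(1,2) by (auto intro!: integrable_continuous_real elim!: continuous_on_subset)
  have sp: "integral {p..q} h = integral {p..e1} h + integral {e1..e2} h + integral {e2..q} h"
    if "h integrable_on {p..q}" for h :: "real \<Rightarrow> real"
  proof -
    have "h integrable_on {p..e2}" using that assms(4-6) by (elim integrable_on_subinterval) auto
    then have "integral {p..e2} h = integral {p..e1} h + integral {e1..e2} h"
      using assms(4-6) by (intro Henstock_Kurzweil_Integration.integral_combine[symmetric]) auto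
    moreover have "integral {p..q} h = integral {p..e2} h + integral {e2..q} h"
      using assms(4-6) that by (intro Henstock_Kurzweil_Integration.integral_combine[symmetric]) auto
    ultimately show ?thesis by simp
  qed
  have 1: "integral {p..e1} f \<le> integral {p..e1} g" "integral {e2..q} f \<le> integral {e2..q} g"
    using assms(3-6) by (auto intro!: integral_le i)
  have "integral {e1..e2} f + c * (e2 - e1) = integral {e1..e2} (\<lambda>x. f x + c)"
    using assms(4-6) by (subst Henstock_Kurzweil_Integration.integral_add) (auto intro!: i)
  also have "\<dots> \<le> integral {e1..e2} g"
    using assms(4-7) by (intro integral_le i integrable_add) auto
  finally have 2: "integral {e1..e2} f + c * (e2 - e1) \<le> integral {e1..e2} g" .
  have "p \<le> q" using assms by linarith
  then show ?thesis using sp[OF i(1)] sp[OF i(2)] 1 2 by simp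
qed

text \<open>
  Cut the graph of \<open>f\<close> at its zero \<open>x0\<close>, shift the left part to the right by \<open>lam\<close> and the right part to the
  left by \<open>mu\<close>. What is lost lies within distance \<open>2 * C + lam + mu\<close> of \<open>x0\<close>, where \<open>f\<close> is at most linear in
  the distance, so the loss is quadratic. On one interval \<open>h\<close> is larger by \<open>g\<close> than the shifted \<open>f\<close>.
\<close>
lemma surgery:
  fixes f h :: "real \<Rightarrow> real"
  assumes cf: "continuous_on UNIV f" and ch: "continuous_on UNIV h"
    and nn: "0 \<le> lam" "0 \<le> mu" "0 \<le> C" "a + lam \<le> x0 - C" "x0 + C \<le> b - mu" "0 \<le> K"
    and K: "\<And>x. f x \<le> K * \<bar>x - x0\<bar>"
    and f0: "\<And>x. x \<in> {a..b} \<Longrightarrow> 0 \<le> f x"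
    and left: "\<And>x. x \<in> {a + lam..x0 - C} \<Longrightarrow> f (x - lam) \<le> h x"
    and right: "\<And>x. x \<in> {x0 + C..b - mu} \<Longrightarrow> f (x + mu) \<le> h x"
    and mid: "\<And>x. x \<in> {x0 - C..x0 + C} \<Longrightarrow> 0 \<le> h x"
    and gain: "(a + lam \<le> e1 \<and> e2 \<le> x0 - C \<and> (\<forall>x\<in>{e1..e2}. f (x - lam) + g \<le> h x)) \<or>
      (x0 + C \<le> e1 \<and> e2 \<le> b - mu \<and> (\<forall>x\<in>{e1..e2}. f (x + mu) + g \<le> h x))" and e12: "e1 \<le> e2"
  shows "\<And>x. x \<in> {a + lam..b - mu} \<Longrightarrow> 0 \<le> h x"
    and "integral {a..b} f + g * (e2 - e1) - K * (2 * C + lam + mu)\<^sup>2 \<le> integral {a + lam..b - mu} h"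
proof -
  have i: "f integrable_on {p..q}" "h integrable_on {p..q}" for p q
    using cf ch by (auto intro!: integrable_continuous_real elim!: continuous_on_subset)
  have sh: "integral {p..q} (\<lambda>x. f (x + c)) = integral {p + c..q + c} f" for p q c
    using integral_shift_Icc_real[of p q f c] by (simp add: o_def add.commute)
  have co: "continuous_on S (\<lambda>x. f (x + c))" for S c
    by (intro continuous_on_compose2[OF cf] continuous_intros) auto
  have spl: "integral {p..s} g = integral {p..q} g + integral {q..r} g + integral {r..s} g"
    if "p \<le> q" "q \<le> r" "r \<le> s" "\<And>p q. g integrable_on {p..q}" for p q r s and g :: "real \<Rightarrow> real"
  proof -
    have "integral {p..r} g = integral {p..q} g + integral {q..r} g"
      using that by (intro Henstock_Kurzweil_Integration.integral_combine[symmetric]) auto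
    moreover have "integral {p..s} g = integral {p..r} g + integral {r..s} g"
      using that by (intro Henstock_Kurzweil_Integration.integral_combine[symmetric]) auto
    ultimately show ?thesis by simp
  qed
  show "0 \<le> h x" if x: "x \<in> {a + lam..b - mu}" for x
  proof -
    consider "x \<in> {a + lam..x0 - C}" | "x \<in> {x0 - C..x0 + C}" | "x \<in> {x0 + C..b - mu}"
      using x by fastforce
    then show ?thesis
    proof cases
      case 1
      then have "0 \<le> f (x - lam)" using nn by (intro f0) auto
      with left[OF 1] show ?thesis by simp
    next
      case 2 then show ?thesis by (rule mid)
    next
      case 3
      then have "0 \<le> f (x + mu)" using nn by (intro f0) auto
      with right[OF 3] show ?thesis by simp
    qed
  qed
  have L: "integral {a..x0 - C - lam} f + c * (l2 - l1) \<le> integral {a + lam..x0 - C} h"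
    if "a + lam \<le> l1" "l1 \<le> l2" "l2 \<le> x0 - C" "\<And>x. x \<in> {l1..l2} \<Longrightarrow> f (x - lam) + c \<le> h x" for l1 l2 c
    using integral_gain[OF co[of _ "- lam"] continuous_on_subset[OF ch subset_UNIV], of "a + lam" "x0 - C" l1 l2 c]
      left that sh[of "a + lam" "x0 - C" "- lam"] by (simp add: algebra_simps)
  have R: "integral {x0 + C + mu..b} f + c * (r2 - r1) \<le> integral {x0 + C..b - mu} h"
    if "x0 + C \<le> r1" "r1 \<le> r2" "r2 \<le> b - mu" "\<And>x. x \<in> {r1..r2} \<Longrightarrow> f (x + mu) + c \<le> h x" for r1 r2 c
    using integral_gain[OF co[of _ mu] continuous_on_subset[OF ch subset_UNIV], of "x0 + C" "b - mu" r1 r2 c]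
      right that sh[of "x0 + C" "b - mu" "mu"] by (simp add: algebra_simps)
  have LR: "integral {a..x0 - C - lam} f + integral {x0 + C + mu..b} f + g * (e2 - e1)
      \<le> integral {a + lam..x0 - C} h + integral {x0 + C..b - mu} h"
    using gain
  proof
    assume "a + lam \<le> e1 \<and> e2 \<le> x0 - C \<and> (\<forall>x\<in>{e1..e2}. f (x - lam) + g \<le> h x)"
    then show ?thesis using L[of e1 e2 g] R[of "x0 + C" "x0 + C" 0] e12 right[of "x0 + C"] nn by simp
  next
    assume "x0 + C \<le> e1 \<and> e2 \<le> b - mu \<and> (\<forall>x\<in>{e1..e2}. f (x + mu) + g \<le> h x)"
    then show ?thesis using R[of e1 e2 g] L[of "a + lam" "a + lam" 0] e12 left[of "a + lam"] nn by simp
  qed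
  have M: "0 \<le> integral {x0 - C..x0 + C} h" using mid by (intro integral_nonneg i) auto
  let ?w = "2 * C + lam + mu"
  have "integral {x0 - C - lam..x0 + C + mu} f \<le> integral {x0 - C - lam..x0 + C + mu} (\<lambda>x. K * ?w)"
  proof (intro integral_le i integrable_continuous_real continuous_intros)
    fix x assume "x \<in> {x0 - C - lam..x0 + C + mu}"
    then have "\<bar>x - x0\<bar> \<le> ?w" using nn by (auto simp: abs_le_iff)
    then show "f x \<le> K * ?w" using K[of x] nn(6) by (meson mult_left_mono order_trans)
  qed
  also have "\<dots> = K * ?w\<^sup>2" using nn by (simp add: power2_eq_square)
  finally have F: "integral {x0 - C - lam..x0 + C + mu} f \<le> K * ?w\<^sup>2" .
  have "integral {a..b} f = integral {a..x0 - C - lam} f + integral {x0 - C - lam..x0 + C + mu} f + integral {x0 + C + mu..b} f"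
    using nn by (intro spl i) auto
  moreover have "integral {a + lam..b - mu} h = integral {a + lam..x0 - C} h + integral {x0 - C..x0 + C} h + integral {x0 + C..b - mu} h"
    using nn by (intro spl i) auto
  ultimately show "integral {a..b} f + g * (e2 - e1) - K * ?w\<^sup>2 \<le> integral {a + lam..b - mu} h"
    using LR M F by linarith
qed

lemma eventually_small:
  fixes K \<eta> :: real
  assumes "0 < \<eta>" shows "\<forall>\<^sub>F e in at_right 0. K * e < \<eta>"
proof -
  have "((\<lambda>e. K * e) \<longlongrightarrow> K * 0) (at_right 0)" by (intro tendsto_intros)
  then show ?thesis using assms by (auto dest: order_tendstoD(2))
qed

lemma eventually_right_pos: "\<forall>\<^sub>F e in at_right (0::real). 0 < e"
  by (simp add: eventually_at_right_less)

context sofa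
begin

definition optimal :: "(nat \<Rightarrow> real) \<Rightarrow> real \<Rightarrow> real \<Rightarrow> bool" where
  "optimal u a b \<longleftrightarrow> feasible u u a b \<and> 0 < area u u a b \<and>
     (\<forall>v c d. feasible v v c d \<longrightarrow> area v v c d \<le> area u u a b)"

lemma gap_bound_at_zero:
  obtains K where "0 < K" "\<And>u x0 x. gap u u x0 = 0 \<Longrightarrow> gap u u x \<le> K * \<bar>x - x0\<bar>"
proof -
  obtain K where K: "0 < K"
    "\<And>d p q p' q' x x'. near d p p' \<Longrightarrow> near d q q' \<Longrightarrow> \<bar>x - x'\<bar> \<le> d \<Longrightarrow> \<bar>gap p q x - gap p' q' x'\<bar> \<le> K * d"
    using gap_lipschitz by metis
  show thesis
  proof (rule that[OF K(1)])
    fix u x0 x assume "gap u u x0 = 0"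
    then show "gap u u x \<le> K * \<bar>x - x0\<bar>"
      using K(2)[of "\<bar>x - x0\<bar>" u u u u x x0] by (simp add: near_refl)
  qed
qed

text \<open>
  The positions \<open>v e\<close> are perturbations of size \<open>e\<close> of \<open>u\<close> for which the two sides of the pinch are moved
  towards each other by at most a multiple of \<open>e\<close>. By the quadratic loss at the pinch, a gain of \<open>g * e\<close> on an
  interval on either side would improve the optimum for small \<open>e\<close>.
\<close>
lemma no_linear_gain:
  assumes opt: "optimal u a b" and x0: "a < x0" "x0 < b" "gap u u x0 = 0"
    and nn: "0 \<le> C" "0 \<le> lam" "0 \<le> mu" "0 < g"
    and left: "\<forall>\<^sub>F e in at_right 0. \<forall>x\<in>{a + lam * e..x0 - C * e}. gap u u (x - lam * e) \<le> gap (v e) (v e) x"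
    and right: "\<forall>\<^sub>F e in at_right 0. \<forall>x\<in>{x0 + C * e..b - mu * e}. gap u u (x + mu * e) \<le> gap (v e) (v e) x"
    and mid: "\<forall>\<^sub>F e in at_right 0. \<forall>x\<in>{x0 - C * e..x0 + C * e}. 0 \<le> gap (v e) (v e) x"
    and gain: "(a < e1 \<and> e1 < e2 \<and> e2 < x0 \<and>
         (\<forall>\<^sub>F e in at_right 0. \<forall>x\<in>{e1..e2}. gap u u (x - lam * e) + g * e \<le> gap (v e) (v e) x)) \<or>
       (x0 < e1 \<and> e1 < e2 \<and> e2 < b \<and>
         (\<forall>\<^sub>F e in at_right 0. \<forall>x\<in>{e1..e2}. gap u u (x + mu * e) + g * e \<le> gap (v e) (v e) x))"
  shows False
proof -
  obtain K where K: "0 < K" "\<And>u x0 x. gap u u x0 = 0 \<Longrightarrow> gap u u x \<le> K * \<bar>x - x0\<bar>"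
    using gap_bound_at_zero by metis
  have e12: "0 < e2 - e1" using gain by auto
  have small: "\<forall>\<^sub>F e in at_right 0. (lam + C) * e < x0 - a \<and> (mu + C) * e < b - x0 \<and>
     K * (2 * C + lam + mu)\<^sup>2 * e < g * (e2 - e1)"
    using x0 nn e12 by (intro eventually_conj eventually_small) auto
  have f: "feasible u u a b" and mx: "\<And>v c d. feasible v v c d \<Longrightarrow> area v v c d \<le> area u u a b"
    using opt by (auto simp: optimal_def)
  have f0: "0 \<le> gap u u x" if "x \<in> {a..b}" for x using f that by (auto simp: feasible_def)
  have place: "\<forall>\<^sub>F e in at_right 0.
      (a + lam * e \<le> e1 \<and> e2 \<le> x0 - C * e \<and> (\<forall>x\<in>{e1..e2}. gap u u (x - lam * e) + g * e \<le> gap (v e) (v e) x)) \<or>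
      (x0 + C * e \<le> e1 \<and> e2 \<le> b - mu * e \<and> (\<forall>x\<in>{e1..e2}. gap u u (x + mu * e) + g * e \<le> gap (v e) (v e) x))"
    using gain
  proof (elim disjE conjE)
    assume G: "a < e1" "e2 < x0" "\<forall>\<^sub>F e in at_right 0. \<forall>x\<in>{e1..e2}. gap u u (x - lam * e) + g * e \<le> gap (v e) (v e) x"
    then have p: "0 < e1 - a" "0 < x0 - e2" by auto
    from G(3) eventually_small[OF p(1), of lam] eventually_small[OF p(2), of C] show ?thesis
      by eventually_elim auto
  next
    assume G: "x0 < e1" "e2 < b" "\<forall>\<^sub>F e in at_right 0. \<forall>x\<in>{e1..e2}. gap u u (x + mu * e) + g * e \<le> gap (v e) (v e) x"
    then have p: "0 < e1 - x0" "0 < b - e2" by auto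
    from G(3) eventually_small[OF p(1), of C] eventually_small[OF p(2), of mu] show ?thesis
      by eventually_elim auto
  qed
  have "\<forall>\<^sub>F e in at_right (0::real). False"
    using small left right mid place eventually_right_pos
  proof eventually_elim
    case (elim e)
    have e: "0 \<le> C * e" "0 \<le> lam * e" "0 \<le> mu * e" using elim(6) nn by auto
    have c: "a + lam * e \<le> x0 - C * e" "x0 + C * e \<le> b - mu * e" using elim(1) by (auto simp: algebra_simps)
    note S = surgery[OF continuous_gap continuous_gap e(2) e(3) e(1) c less_imp_le[OF K(1)] K(2)[OF x0(3)] f0
        bspec[OF elim(2)] bspec[OF elim(3)] bspec[OF elim(4)] elim(5)]
    have le: "e1 \<le> e2" using e12 by simp
    have "area u u a b + g * e * (e2 - e1) - K * (2 * (C * e) + lam * e + mu * e)\<^sup>2 \<le> area (v e) (v e) (a + lam * e) (b - mu * e)"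
      unfolding area_def by (rule S(2)[OF _ _ _ _ le])
    moreover have "feasible (v e) (v e) (a + lam * e) (b - mu * e)"
      using S(1)[OF _ _ _ _ le] c e by (auto simp: feasible_def)
    ultimately have "g * e * (e2 - e1) \<le> K * (2 * (C * e) + lam * e + mu * e)\<^sup>2" using mx by force
    also have "\<dots> = (K * (2 * C + lam + mu)\<^sup>2 * e) * e" by (simp add: power2_eq_square algebra_simps)
    also have "\<dots> < (g * (e2 - e1)) * e" using elim(1,6) by (intro mult_strict_right_mono) auto
    finally show False by (simp add: algebra_simps)
  qed
  then show False by (simp add: trivial_limit_at_right_real)
qed

text \<open>
  The walls of a right arm have slope \<open>- ct m\<close>, those of a left arm slope \<open>tn m\<close>.
\<close>
abbreviation ct :: "nat \<Rightarrow> real" where "ct m \<equiv> co m / si m"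
abbreviation tn :: "nat \<Rightarrow> real" where "tn m \<equiv> si m / co m"

lemma oR_shift: "m < k \<Longrightarrow> oR q m x' = oR q m x - (x' - x) * ct m"
  and iR_shift: "m < k \<Longrightarrow> iR q m x' = iR q m x - (x' - x) * ct m"
  using si_pos[of m] by (auto simp: oR_def iR_def field_simps)
lemma oL_shift: "m < k \<Longrightarrow> oL q m x' = oL q m x + (x' - x) * tn m"
  and iL_shift: "m < k \<Longrightarrow> iL q m x' = iL q m x + (x' - x) * tn m"
  using co_pos[of m] by (auto simp: oL_def iL_def field_simps)
lemma iR_oR: "m < k \<Longrightarrow> iR q m x = oR q m x - 1 / si m"
  and iL_oL: "m < k \<Longrightarrow> iL q m x = oL q m x - 1 / co m"
  using si_pos[of m] co_pos[of m] by (auto simp: iR_def oR_def iL_def oL_def field_simps)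
lemma oR_change: "m < k \<Longrightarrow> oR q' m x = oR q m x + (q' (2*m) - q (2*m)) / si m"
  and iR_change: "m < k \<Longrightarrow> iR q' m x = iR q m x + (q' (2*m) - q (2*m)) / si m"
  using si_pos[of m] by (auto simp: iR_def oR_def field_simps)
lemma oL_change: "m < k \<Longrightarrow> oL q' m x = oL q m x + (q' (2*m+1) - q (2*m+1)) / co m"
  and iL_change: "m < k \<Longrightarrow> iL q' m x = iL q m x + (q' (2*m+1) - q (2*m+1)) / co m"
  using co_pos[of m] by (auto simp: iL_def oL_def field_simps)

lemma ct_pos: "m < k \<Longrightarrow> 0 < ct m" and tn_pos: "m < k \<Longrightarrow> 0 < tn m"
  using si_pos[of m] co_pos[of m] by auto
lemma si_less_1: "m < k \<Longrightarrow> si m < 1"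
  using sin_monotone_2pi[of "\<alpha> ! m" "pi/2"] angle_pos[of m] angle_less_half_pi[of m] by auto
lemma co_less_1: "m < k \<Longrightarrow> co m < 1"
  using cos_monotone_0_pi[of 0 "\<alpha> ! m"] angle_pos[of m] angle_less_half_pi[of m] by auto

lemma cot_less:
  fixes a b :: real
  assumes "0 < a" "a < b" "b \<le> pi / 2" shows "cos b / sin b < cos a / sin a"
proof -
  have s: "0 < sin a" "0 < sin b" using assms by (auto intro!: sin_gt_zero)
  have "0 < sin (b - a)" using assms by (intro sin_gt_zero) auto
  then show ?thesis using s by (simp add: sin_diff field_simps)
qed

lemma ct_less: "m < n \<Longrightarrow> n < k \<Longrightarrow> ct n < ct m"
  using cot_less[OF angle_pos[of m] angle_mono[of m n]] angle_less_half_pi[of n] by auto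
lemma tn_less: "m < n \<Longrightarrow> n < k \<Longrightarrow> tn m < tn n"
  using ct_less[of m n] si_pos[of m] co_pos[of m] si_pos[of n] co_pos[of n] by (auto simp: field_simps)
lemma cot_beta_le: "cos \<beta>2 / sin \<beta>2 \<le> cos \<beta>1 / sin \<beta>1"
  using cot_less[OF beta1_pos, of \<beta>2] beta_le beta_le_half_pi by (cases "\<beta>1 = \<beta>2") auto
lemma cot_beta1_less: "m < k \<Longrightarrow> cos \<beta>1 / sin \<beta>1 < ct m"
  using cot_less[OF angle_pos angle_less_beta1, of m] beta_le beta_le_half_pi by auto

lemma W1_shift:
  assumes "0 \<le> d"
  shows "W1 x - d * (cos \<beta>1 / sin \<beta>1) \<le> W1 (x + d)" "W1 (x + d) \<le> W1 x - d * (cos \<beta>2 / sin \<beta>2)"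
    "W1 (x + d) \<le> W1 x"
proof -
  have e: "(1 - (x + d) * cos \<beta>) / sin \<beta> = (1 - x * cos \<beta>) / sin \<beta> - d * (cos \<beta> / sin \<beta>)" for \<beta>
    by (simp add: algebra_simps diff_divide_distrib add_divide_distrib)
  have "d * (cos \<beta>2 / sin \<beta>2) \<le> d * (cos \<beta>1 / sin \<beta>1)" using cot_beta_le assms by (rule mult_left_mono)
  moreover have "0 \<le> d * (cos \<beta>2 / sin \<beta>2)" using assms sin_beta_pos cos_beta_nonneg by auto
  ultimately show "W1 x - d * (cos \<beta>1 / sin \<beta>1) \<le> W1 (x + d)" "W1 (x + d) \<le> W1 x - d * (cos \<beta>2 / sin \<beta>2)"
    "W1 (x + d) \<le> W1 x"
    unfolding W1_def e by (auto simp: max_def)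
qed

lemma W0_shift:
  assumes "0 \<le> d"
  shows "W0 x \<le> W0 (x + d) + d * (cos \<beta>1 / sin \<beta>1)" "W0 (x + d) \<le> W0 x"
proof -
  have e: "- (x + d) * cos \<beta> / sin \<beta> = - x * cos \<beta> / sin \<beta> - d * (cos \<beta> / sin \<beta>)" for \<beta>
    by (simp add: algebra_simps diff_divide_distrib add_divide_distrib)
  have "d * (cos \<beta>2 / sin \<beta>2) \<le> d * (cos \<beta>1 / sin \<beta>1)" using cot_beta_le assms by (rule mult_left_mono)
  moreover have "0 \<le> d * (cos \<beta>2 / sin \<beta>2)" using assms sin_beta_pos cos_beta_nonneg by auto
  ultimately show "W0 x \<le> W0 (x + d) + d * (cos \<beta>1 / sin \<beta>1)" "W0 (x + d) \<le> W0 x"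
    unfolding W0_def e by (auto simp: min_def)
qed

lemma iL_mono_x: "m < k \<Longrightarrow> x \<le> x' \<Longrightarrow> iL q m x \<le> iL q m x'"
  and oL_mono_x: "m < k \<Longrightarrow> x \<le> x' \<Longrightarrow> oL q m x \<le> oL q m x'"
  and iR_anti_x: "m < k \<Longrightarrow> x \<le> x' \<Longrightarrow> iR q m x' \<le> iR q m x"
  and oR_anti_x: "m < k \<Longrightarrow> x \<le> x' \<Longrightarrow> oR q m x' \<le> oR q m x"
  using iL_shift[of m q x' x] oL_shift[of m q x' x] iR_shift[of m q x' x] oR_shift[of m q x' x]
    mult_nonneg_nonneg[of "x' - x" "tn m"] mult_nonneg_nonneg[of "x' - x" "ct m"] tn_pos[of m] ct_pos[of m]
  by auto

end

context sofa
begin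

section \<open>A pinch does not lie on an outer wall\<close>

text \<open>
  The part of the component to the right of the pinch is translated by \<open>e\<close> times the vector
  \<open>(- sin \<theta>, cos \<theta>)\<close>, into the pinch. The right walls of the hallways of index below \<open>i\<close>, whose angles
  are smaller than \<open>\<theta>\<close>, move along (\<open>v\<close>, \<open>shR\<close>); all other walls stay. The hypotheses say
  that the stationary walls leave room for the translated part, and a gain of \<open>g * e\<close> below the outer
  ones, once the abscissa is a multiple of \<open>e\<close> away from the pinch. This is used with \<open>\<theta>\<close> slightly
  larger than the angle of the wall at the pinch, and with \<open>\<theta> = pi / 2\<close>.
\<close>
lemma right_shift_contradiction:
  assumes opt: "optimal u a b" and x0: "a < x0" "x0 < b" "gap u u x0 = 0"
    and i: "i \<le> k" and th: "0 < \<theta>" "\<theta> \<le> pi / 2" "\<And>m. m < i \<Longrightarrow> \<alpha> ! m < \<theta>"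
    and slack: "\<And>m. m < i \<Longrightarrow> up u x0 < oR u m x0"
    and gm: "0 < \<gamma>" and fall: "\<And>d. 0 \<le> d \<Longrightarrow> up u (x0 + d) \<le> up u x0 - \<gamma> * d"
    and left: "\<And>m d. m < i \<Longrightarrow> 0 \<le> d \<Longrightarrow> up u (x0 - d) + \<gamma> * d \<le> oR u m (x0 - d)"
    and g: "0 < g" "0 \<le> C1"
    and W1c: "\<And>e d. 0 < e \<Longrightarrow> C1 * e \<le> d \<Longrightarrow> e * sin \<theta> \<le> d \<Longrightarrow>
        up u (x0 + d) + e * cos \<theta> + g * e \<le> W1 (x0 + d - e * sin \<theta>)"
    and Rc: "\<And>m e d. i \<le> m \<Longrightarrow> m < k \<Longrightarrow> 0 < e \<Longrightarrow> C1 * e \<le> d \<Longrightarrow> e * sin \<theta> \<le> d \<Longrightarrow>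
        up u (x0 + d) + e * cos \<theta> + g * e \<le> oR u m (x0 + d - e * sin \<theta>)"
    and Tc: "\<And>m e d. i \<le> m \<Longrightarrow> m < k \<Longrightarrow> 0 < e \<Longrightarrow> e * sin \<theta> \<le> d \<Longrightarrow>
        min (iR u m (x0 + d - e * sin \<theta>)) (iL u m (x0 + d - e * sin \<theta>)) \<le> lo u (x0 + d) + e * cos \<theta>"
    and W0c: "\<And>e d. 0 < e \<Longrightarrow> e * sin \<theta> \<le> d \<Longrightarrow> W0 (x0 + d - e * sin \<theta>) \<le> lo u (x0 + d) + e * cos \<theta>"
  shows False
proof -
  define v where "v e n = (if even n \<and> n div 2 < i then u n - e * sin (\<theta> - \<alpha> ! (n div 2)) else u n)" for e n
  have v: "v e (2 * m) = (if m < i then u (2 * m) - e * sin (\<theta> - \<alpha> ! m) else u (2 * m))"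
      "v e (2 * m + 1) = u (2 * m + 1)" for e m
    by (auto simp: v_def)
  have sth: "0 < sin \<theta>" "sin \<theta> \<le> 1" "0 \<le> cos \<theta>" "cos \<theta> \<le> 1"
    using th by (auto intro!: sin_gt_zero cos_ge_zero)
  have sdiff: "0 < sin (\<theta> - \<alpha> ! m)" if "m < i" for m
    using th(2) th(3)[OF that] angle_pos[of m] i that by (intro sin_gt_zero) auto
  have vle: "v e n \<le> u n" if "0 < e" for e n
    using that sdiff[of "n div 2"] by (auto simp: v_def)
  have lov: "lo (v e) x \<le> lo u x" if "0 < e" for e x using vle[OF that] by (intro lo_mono)
  have oRv: "oR (v e) m x = oR u m x - e * (sin (\<theta> - \<alpha> ! m) / si m)" if "m < i" for e m x
    using oR_change[of m "v e" x u] that i v(1)[of e m] by simp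
  have oRv': "oR (v e) m x = oR u m x" if "i \<le> m" for e m x using that by (simp add: oR_def v)
  have iRv: "iR (v e) m x = iR u m x - e * (sin (\<theta> - \<alpha> ! m) / si m)" if "m < i" for e m x
    using iR_change[of m "v e" x u] that i v(1)[of e m] by simp
  have iRv': "iR (v e) m x = iR u m x" if "i \<le> m" for e m x using that by (simp add: iR_def v)
  have oLv: "oL (v e) m x = oL u m x" "iL (v e) m x = iL u m x" for e m x
    using v(2)[of e m] by (simp_all add: oL_def iL_def)
  \<comment> \<open>Moving the right wall by \<open>- e * sin (\<theta> - \<alpha>)\<close> in its normal direction is the translation by
    the vector above, seen at the wall.\<close>
  have rot: "sin \<theta> * ct m - sin (\<theta> - \<alpha> ! m) / si m = cos \<theta>" if "m < k" for m
    using si_pos[OF that] by (simp add: sin_diff field_simps)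
  have shR: "oR (v e) m x = oR u m (x + e * sin \<theta>) + e * cos \<theta>" "iR (v e) m x = iR u m (x + e * sin \<theta>) + e * cos \<theta>"
    if "m < i" for e m x
  proof -
    have mk: "m < k" using that i by simp
    have "e * sin \<theta> * ct m - e * (sin (\<theta> - \<alpha> ! m) / si m) = e * cos \<theta>"
      using rot[OF mk] by (metis (no_types) mult.assoc right_diff_distrib)
    then show "oR (v e) m x = oR u m (x + e * sin \<theta>) + e * cos \<theta>" "iR (v e) m x = iR u m (x + e * sin \<theta>) + e * cos \<theta>"
      using oRv[OF that, of e x] iRv[OF that, of e x] oR_shift[OF mk, of u "x + e * sin \<theta>" x]
        iR_shift[OF mk, of u "x + e * sin \<theta>" x] by simp_all
  qed
  obtain A where A: "0 < A" "\<And>m. m \<in> {..<k} \<Longrightarrow> 1 / si m + tn m + ct m \<le> A"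
    by (rule finite_upper_bound[of "{..<k}" "\<lambda>m. 1 / si m + tn m + ct m"]) auto
  have A': "sin (\<theta> - \<alpha> ! m) / si m \<le> A" "tn m \<le> A" "ct m \<le> A" if "m < k" for m
  proof -
    have "sin (\<theta> - \<alpha> ! m) / si m \<le> 1 / si m" using si_pos[OF that] by (intro divide_right_mono) auto
    then show "sin (\<theta> - \<alpha> ! m) / si m \<le> A" "tn m \<le> A" "ct m \<le> A"
      using A(2)[of m, unfolded lessThan_iff, OF that] tn_pos[OF that] ct_pos[OF that] divide_pos_pos[OF zero_less_one si_pos[OF that]] by linarith+
  qed
  define K2 where "K2 = A + 1 + g"
  define C where "C = C1 + K2 / \<gamma>"
  have K2: "0 < K2" using A(1) g by (simp add: K2_def)
  have C: "0 \<le> C" "C1 \<le> C" "K2 \<le> \<gamma> * C" using gm g K2 by (auto simp: C_def field_simps)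
  have dC: "K2 * e \<le> \<gamma> * d" if "0 < e" "C * e \<le> d" for e d
  proof -
    have "K2 * e \<le> \<gamma> * C * e" using that C by (intro mult_right_mono) auto
    also have "\<dots> \<le> \<gamma> * d" using that gm by (simp add: mult.assoc mult_left_mono)
    finally show ?thesis .
  qed
  \<comment> \<open>The translated part fits, with room \<open>t\<close> to spare wherever the moving walls leave that room.\<close>
  have key: "gap u u (x + e * sin \<theta>) + t \<le> gap (v e) (v e) x"
    if e: "0 < e" and x: "x0 + C * e \<le> x" and t: "t \<le> g * e" and sl: "\<And>m. m < i \<Longrightarrow> up u (x + e * sin \<theta>) + t \<le> oR u m (x + e * sin \<theta>)"
    for e x t
  proof -
    define d where "d = x + e * sin \<theta> - x0"
    have xd: "x + e * sin \<theta> = x0 + d" "x = x0 + d - e * sin \<theta>" by (auto simp: d_def)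
    have es: "0 \<le> e * sin \<theta>" using e sth by simp
    have "0 \<le> C * e" using C(1) e by simp
    then have d: "C * e \<le> d" "e * sin \<theta> \<le> d" "0 \<le> d" using x es unfolding d_def by linarith+
    have d1: "C1 * e \<le> d" using d(1) C(2) e by (meson less_imp_le mult_right_mono order_trans)
    have upd: "up u (x0 + d) + K2 * e \<le> up u x0" using fall[OF d(3)] dC[OF e d(1)] by linarith
    have ec: "e * cos \<theta> \<le> e" using e sth by (simp add: mult_left_le)
    have K2e: "K2 * e = A * e + e + g * e" by (simp add: K2_def algebra_simps)
    have Ae: "0 \<le> A * e" using A e by simp
    have "up u (x0 + d) + e * cos \<theta> + t \<le> up (v e) x"
      unfolding up_ge_iff
    proof (intro conjI allI impI)
      show "up u (x0 + d) + e * cos \<theta> + t \<le> 1" using upd up_le(1)[of u x0] ec K2e Ae t by linarith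
      show "up u (x0 + d) + e * cos \<theta> + t \<le> W1 x" using W1c[OF e d1 d(2)] t xd by simp
      fix m assume m: "m < k"
      show "up u (x0 + d) + e * cos \<theta> + t \<le> oR (v e) m x"
      proof (cases "m < i")
        case True
        then show ?thesis using sl[OF True] shR(1)[OF True, of e x] xd(1) by simp
      next
        case False
        then show ?thesis using Rc[OF _ m e d1 d(2)] t xd oRv'[of m e x] by simp
      qed
      have "oL u m (x0 + d) = oL u m x + e * sin \<theta> * tn m" using oL_shift[OF m, of u "x0 + d" x] xd by simp
      moreover have "e * sin \<theta> * tn m \<le> e * A"
      proof -
        have "sin \<theta> * tn m \<le> 1 * A" using A'(2)[OF m] sth tn_pos[OF m] by (intro mult_mono) auto
        then have "e * (sin \<theta> * tn m) \<le> e * A" using e by (intro mult_left_mono) auto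
        then show ?thesis by (simp only: mult.assoc)
      qed
      moreover have "up u x0 \<le> oL u m (x0 + d)"
        using up_le(4)[OF m, of u x0] oL_mono_x[OF m, of x0 "x0 + d" u] d by linarith
      ultimately show "up u (x0 + d) + e * cos \<theta> + t \<le> oL (v e) m x"
        using upd K2e ec t oLv by (simp add: mult.commute)
    qed
    moreover have "lo (v e) x \<le> lo u (x0 + d) + e * cos \<theta>"
      unfolding lo_le_iff
    proof (intro conjI allI impI)
      show "0 \<le> lo u (x0 + d) + e * cos \<theta>" using lo_ge(1)[of u "x0 + d"] e sth by simp
      show "W0 x \<le> lo u (x0 + d) + e * cos \<theta>" using W0c[OF e d(2)] xd by simp
      fix m assume m: "m < k"
      show "min (iR (v e) m x) (iL (v e) m x) \<le> lo u (x0 + d) + e * cos \<theta>"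
      proof (cases "m < i")
        case True
        have "iL u m x \<le> iL u m (x0 + d)" using xd es by (intro iL_mono_x[OF m]) auto
        moreover have "0 \<le> e * cos \<theta>" using e sth by simp
        ultimately show ?thesis
          using lo_ge(3)[OF m, of u "x0 + d"] shR(2)[OF True, of e x] oLv xd(1) by (auto simp: min_le_iff_disj)
      next
        case False
        then show ?thesis using Tc[OF _ m e d(2)] xd iRv'[of m e x] oLv by simp
      qed
    qed
    ultimately show ?thesis using xd(1) by (simp add: gap_def)
  qed
  obtain \<eta> where eta: "0 < \<eta>" "\<And>m. m \<in> {..<i} \<Longrightarrow> \<eta> \<le> oR u m x0 - up u x0"
    by (rule finite_pos_lower_bound[of "{..<i}" "\<lambda>m. oR u m x0 - up u x0"]) (use slack in auto)
  obtain K where K: "0 < K"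
    "\<And>d p q p' q' x x'. near d p p' \<Longrightarrow> near d q q' \<Longrightarrow> \<bar>x - x'\<bar> \<le> d \<Longrightarrow> \<bar>lo p x - lo p' x'\<bar> \<le> K * d"
    using gap_lipschitz by metis
  have feas: "0 \<le> gap u u x" if "x \<in> {a..b}" for x using opt that by (auto simp: optimal_def feasible_def)
  \<comment> \<open>On \<open>[x0, x0 + \<rho>]\<close> the moving walls, which are not at the pinch, stay clear of the upper boundary.\<close>
  define \<rho> where "\<rho> = min (\<eta> / (2 * A)) (b - x0)"
  have rho: "0 < \<rho>" "\<rho> \<le> b - x0" "A * \<rho> \<le> \<eta> / 2"
    using eta A x0 by (auto simp: \<rho>_def min_def field_simps)
  have pos: "0 < x0 - a" "0 < b - x0" "0 < \<rho> / 4" "0 < \<eta> / 2" using x0 rho eta by auto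
  show False
  proof (rule no_linear_gain[OF opt x0 C(1) order.refl less_imp_le[OF sth(1)] g(1), where v = v and ?e1.0 = "x0 + \<rho> / 4" and ?e2.0 = "x0 + \<rho> / 2"])
    show "\<forall>\<^sub>F e in at_right 0. \<forall>x\<in>{a + 0 * e..x0 - C * e}. gap u u (x - 0 * e) \<le> gap (v e) (v e) x"
      using eventually_right_pos
    proof eventually_elim
      case (elim e)
      show ?case
      proof clarsimp
        fix x assume x: "a \<le> x" "x \<le> x0 - C * e"
        define d where "d = x0 - x"
        have ce: "0 \<le> C * e" using C elim by simp
        have d: "x = x0 - d" "C * e \<le> d" using x by (auto simp: d_def)
        have "up u x \<le> up (v e) x"
          unfolding up_ge_iff
        proof (intro conjI allI impI)
          fix m assume m: "m < k"
          show "up u x \<le> oR (v e) m x"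
          proof (cases "m < i")
            case True
            have "sin (\<theta> - \<alpha> ! m) / si m \<le> K2" using A'(1)[OF m] g by (simp add: K2_def)
            then have "e * (sin (\<theta> - \<alpha> ! m) / si m) \<le> e * K2" using elim by (intro mult_left_mono) auto
            then have "e * (sin (\<theta> - \<alpha> ! m) / si m) \<le> \<gamma> * d" using dC[OF elim d(2)] by (simp add: mult.commute)
            moreover have "up u x + \<gamma> * d \<le> oR u m x" using left[OF True, of d] d ce by simp
            ultimately show ?thesis using oRv[OF True, of e x] by simp
          next
            case False then show ?thesis using up_le(3)[OF m, of u x] oRv'[of m e x] by simp
          qed
          show "up u x \<le> oL (v e) m x" using up_le(4)[OF m, of u x] oLv by simp
        qed (use up_le(1,2)[of u x] in auto)
        then show "gap u u x \<le> gap (v e) (v e) x" using lov[OF elim, of x] by (simp add: gap_def)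
      qed
    qed
    show "\<forall>\<^sub>F e in at_right 0. \<forall>x\<in>{x0 + C * e..b - sin \<theta> * e}. gap u u (x + sin \<theta> * e) \<le> gap (v e) (v e) x"
      using eventually_right_pos
    proof eventually_elim
      case (elim e)
      show ?case
        using key[OF elim, of _ 0] up_le(3)[of _ u] i elim g by (auto simp: mult.commute)
    qed
    show "\<forall>\<^sub>F e in at_right 0. \<forall>x\<in>{x0 - C * e..x0 + C * e}. 0 \<le> gap (v e) (v e) x"
      using eventually_right_pos eventually_small[OF eta(1), of "K * C + A * C + K2"]
        eventually_small[OF pos(1), of C] eventually_small[OF pos(2), of C]
    proof eventually_elim
      case (elim e)
      show ?case
      proof
        fix x assume x: "x \<in> {x0 - C * e..x0 + C * e}"
        then have xab: "x \<in> {a..b}" using elim by auto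
        have xe: "\<bar>x - x0\<bar> \<le> C * e" using x by (auto simp: abs_le_iff)
        have lu: "lo u x \<le> up u x" using feas[OF xab] by (simp add: gap_def)
        have lx: "lo u x \<le> up u x0 + K * (C * e)"
          using K(2)[of "C * e" u u u u x x0] xe x0(3) by (simp add: near_refl gap_def abs_le_iff)
        have "lo u x \<le> up (v e) x"
          unfolding up_ge_iff
        proof (intro conjI allI impI)
          fix m assume m: "m < k"
          show "lo u x \<le> oR (v e) m x"
          proof (cases "m < i")
            case True
            have "sin (\<theta> - \<alpha> ! m) / si m \<le> K2" using A'(1)[OF m] g by (simp add: K2_def)
            then have "(sin (\<theta> - \<alpha> ! m) / si m) * e \<le> K2 * e" using elim(1) by (intro mult_right_mono) auto
            then have 1: "e * (sin (\<theta> - \<alpha> ! m) / si m) \<le> K2 * e" by (simp only: mult.commute)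
            have "(x - x0) * ct m \<le> \<bar>x - x0\<bar> * ct m" using ct_pos[OF m] by (intro mult_right_mono) auto
            also have "\<dots> \<le> (C * e) * A" using xe A'(3)[OF m] ct_pos[OF m] A(1) by (intro mult_mono) auto
            finally have 2: "oR u m x0 - (C * e) * A \<le> oR u m x" using oR_shift[OF m, of u x x0] by simp
            have "\<eta> \<le> oR u m x0 - up u x0" using eta(2)[of m] True by simp
            moreover have "(K * C + A * C + K2) * e = K * (C * e) + (C * e) * A + K2 * e" by (simp add: algebra_simps)
            ultimately show ?thesis using 1 2 lx elim oRv[OF True, of e x] by linarith
          next
            case False then show ?thesis using up_le(3)[OF m, of u x] oRv'[of m e x] lu by simp
          qed
          show "lo u x \<le> oL (v e) m x" using up_le(4)[OF m, of u x] oLv lu by simp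
        qed (use up_le(1,2)[of u x] lu in auto)
        then show "0 \<le> gap (v e) (v e) x" using lov[of e x] elim by (simp add: gap_def)
      qed
    qed
    have "\<forall>\<^sub>F e in at_right 0. \<forall>x\<in>{x0 + \<rho> / 4..x0 + \<rho> / 2}. gap u u (x + sin \<theta> * e) + g * e \<le> gap (v e) (v e) x"
      using eventually_right_pos eventually_small[OF pos(3), of C] eventually_small[OF pos(3), of "sin \<theta>"] eventually_small[OF pos(4), of g]
    proof eventually_elim
      case (elim e)
      show ?case
      proof
        fix x assume x: "x \<in> {x0 + \<rho> / 4..x0 + \<rho> / 2}"
        define d where "d = x + e * sin \<theta> - x0"
        have se: "0 \<le> sin \<theta> * e" using elim sth by simp
        have d: "0 \<le> d" "d \<le> \<rho>" using x elim se rho by (auto simp: d_def mult.commute)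
        have sl: "up u (x + e * sin \<theta>) + g * e \<le> oR u m (x + e * sin \<theta>)" if mi: "m < i" for m
        proof -
          have m: "m < k" using mi i by simp
          have "d * ct m \<le> \<rho> * A" using d A'(3)[OF m] ct_pos[OF m] rho by (intro mult_mono) auto
          then have "oR u m x0 - \<eta> / 2 \<le> oR u m (x + e * sin \<theta>)"
            using oR_shift[OF m, of u "x + e * sin \<theta>" x0] rho by (simp add: d_def mult.commute)
          moreover have "up u (x + e * sin \<theta>) \<le> up u x0"
            using fall[OF d(1)] mult_nonneg_nonneg[OF less_imp_le[OF gm] d(1)] by (simp add: d_def)
          moreover have "\<eta> \<le> oR u m x0 - up u x0" using eta(2)[of m] mi by simp
          ultimately show ?thesis using elim by linarith
        qed
        have "x0 + C * e \<le> x" using x elim by auto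
        from key[OF _ this order.refl sl] elim show "gap u u (x + sin \<theta> * e) + g * e \<le> gap (v e) (v e) x"
          by (simp add: mult.commute)
      qed
    qed
    then show "(a < x0 + \<rho> / 4 \<and> x0 + \<rho> / 4 < x0 + \<rho> / 2 \<and> x0 + \<rho> / 2 < x0 \<and>
         (\<forall>\<^sub>F e in at_right 0. \<forall>x\<in>{x0 + \<rho> / 4..x0 + \<rho> / 2}. gap u u (x - 0 * e) + g * e \<le> gap (v e) (v e) x)) \<or>
       (x0 < x0 + \<rho> / 4 \<and> x0 + \<rho> / 4 < x0 + \<rho> / 2 \<and> x0 + \<rho> / 2 < b \<and>
         (\<forall>\<^sub>F e in at_right 0. \<forall>x\<in>{x0 + \<rho> / 4..x0 + \<rho> / 2}. gap u u (x + sin \<theta> * e) + g * e \<le> gap (v e) (v e) x))"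
      using rho by auto
  qed
qed

text \<open>
  Of the right walls through the pinch take the one of smallest angle. Pushing the right part of the
  component up in a direction slightly flatter than the wall keeps it below the wall and makes it drop away
  from it at a rate proportional to \<open>sin (\<theta> - \<alpha> ! i)\<close>; that is the gain.
\<close>
lemma no_pinch_at_outer_right:
  assumes opt: "optimal u a b" and x0: "a < x0" "x0 < b" "gap u u x0 = 0"
    and i0: "i0 < k" "oR u i0 x0 = up u x0"
  shows False
proof -
  \<comment> \<open>Walls of smaller angle are then strictly above the pinch, so that lowering them a little is harmless.\<close>
  define i where "i = (LEAST i. i < k \<and> oR u i x0 = up u x0)"
  have i: "i < k" "oR u i x0 = up u x0"
    using LeastI[of "\<lambda>i. i < k \<and> oR u i x0 = up u x0" i0] i0 by (auto simp: i_def)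
  have slack: "up u x0 < oR u m x0" if "m < i" for m
    using not_less_Least[of m "\<lambda>i. i < k \<and> oR u i x0 = up u x0"] that i(1) up_le(3)[of m u x0]
    by (fastforce simp: i_def)
  obtain \<theta> where th: "\<alpha> ! i < \<theta>" "\<theta> < \<beta>1" "\<And>m. i < m \<Longrightarrow> m < k \<Longrightarrow> \<theta> < \<alpha> ! m"
  proof -
    define B where "B = insert \<beta>1 ((\<lambda>m. \<alpha> ! m) ` {i<..<k})"
    have "\<alpha> ! i < Min B" using angle_mono[of i] angle_less_beta1[OF i(1)] by (subst Min_gr_iff) (auto simp: B_def)
    then obtain \<theta> where t: "\<alpha> ! i < \<theta>" "\<theta> < Min B" using dense by blast
    have "\<forall>b\<in>B. \<theta> < b" using t(2) by (subst (asm) Min_gr_iff) (auto simp: B_def)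
    then show thesis using t by (intro that[of \<theta>]) (auto simp: B_def)
  qed
  have th0: "0 < \<theta>" "\<theta> \<le> pi / 2" "\<theta> < pi / 2" using th angle_pos[OF i(1)] beta_le beta_le_half_pi by auto
  have ltth: "\<alpha> ! m < \<theta>" if "m < i" for m using angle_mono[OF that i(1)] th by simp
  have cth: "0 \<le> cos \<theta>" "cos \<theta> \<le> 1" "0 < sin \<theta>" using th0 by (auto intro!: cos_ge_zero sin_gt_zero)
  obtain \<gamma>1 where g1: "0 < \<gamma>1" "\<And>m. m \<in> {..<i} \<Longrightarrow> \<gamma>1 \<le> ct m - ct i"
    by (rule finite_pos_lower_bound[of "{..<i}" "\<lambda>m. ct m - ct i"]) (use ct_less i in auto)
  obtain \<gamma>2 where g2: "0 < \<gamma>2" "\<And>m. m \<in> {i<..<k} \<Longrightarrow> \<gamma>2 \<le> ct i - ct m"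
    by (rule finite_pos_lower_bound[of "{i<..<k}" "\<lambda>m. ct i - ct m"]) (use ct_less i in auto)
  define \<gamma> where "\<gamma> = min (min \<gamma>1 \<gamma>2) (min (ct i) (ct i - cos \<beta>1 / sin \<beta>1))"
  have gm: "0 < \<gamma>" "\<gamma> \<le> \<gamma>1" "\<gamma> \<le> \<gamma>2" "\<gamma> \<le> ct i" "\<gamma> \<le> ct i - cos \<beta>1 / sin \<beta>1"
    using g1 g2 ct_pos[OF i(1)] cot_beta1_less[OF i(1)] by (auto simp: \<gamma>_def)
  define g where "g = sin (\<theta> - \<alpha> ! i) / si i"
  have "0 < sin (\<theta> - \<alpha> ! i)" using th th0 angle_pos[OF i(1)] by (intro sin_gt_zero) auto
  then have g: "0 < g" using si_pos[OF i(1)] by (simp add: g_def)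
  have rot: "sin \<theta> * ct i - cos \<theta> = g"
    using si_pos[OF i(1)] by (simp add: g_def sin_diff field_simps)
  define C1 where "C1 = (1 + g) / \<gamma>"
  have C1: "0 \<le> C1" using g gm by (simp add: C1_def)
  have C1d: "e * cos \<theta> + g * e \<le> \<gamma> * d" if "0 < e" "C1 * e \<le> d" for e d
  proof -
    have "e * cos \<theta> \<le> e" using that cth by (simp add: mult_left_le)
    moreover have "(1 + g) * e = \<gamma> * (C1 * e)" using gm by (simp add: C1_def)
    moreover have "\<dots> \<le> \<gamma> * d" using that gm by simp
    ultimately show ?thesis by (simp add: algebra_simps)
  qed
  have bar: "up u (x0 + d) \<le> up u x0 - d * ct i" for d
    using up_le(3)[OF i(1), of u "x0 + d"] oR_shift[OF i(1), of u "x0 + d" x0] i(2) by simp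
  have scale: "\<gamma> * d \<le> c * d" if "\<gamma> \<le> c" "0 \<le> d" for c d using that by (intro mult_right_mono)
  show False
  proof (rule right_shift_contradiction[OF opt x0 less_imp_le[OF i(1)] th0(1,2) ltth slack gm(1) _ _ g C1])
    fix d :: real assume d: "0 \<le> d"
    show "up u (x0 + d) \<le> up u x0 - \<gamma> * d" using bar[of d] scale[OF gm(4) d] by (simp add: mult.commute)
    fix m assume mi: "m < i"
    then have m: "m < k" using i by simp
    have "\<gamma> \<le> ct m - ct i" using g1(2)[of m] mi gm by simp
    from scale[OF this d] show "up u (x0 - d) + \<gamma> * d \<le> oR u m (x0 - d)"
      using bar[of "- d"] oR_shift[OF m, of u "x0 - d" x0] slack[OF mi]
      by (simp add: left_diff_distrib right_diff_distrib mult.commute)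
  next
    fix e d :: real assume e: "0 < e" "C1 * e \<le> d" "e * sin \<theta> \<le> d"
    have es: "0 \<le> e * sin \<theta>" using e cth by simp
    then have d: "0 \<le> d" using e by linarith
    have "up u x0 - d * (cos \<beta>1 / sin \<beta>1) \<le> W1 (x0 + d)" using up_le(2)[of u x0] W1_shift(1)[OF d, of x0] by linarith
    also have "\<dots> \<le> W1 (x0 + d - e * sin \<theta>)" using W1_shift(3)[OF es, of "x0 + d - e * sin \<theta>"] by simp
    finally show "up u (x0 + d) + e * cos \<theta> + g * e \<le> W1 (x0 + d - e * sin \<theta>)"
      using bar[of d] scale[OF gm(5) d] C1d[OF e(1,2)] by (simp add: left_diff_distrib right_diff_distrib mult.commute)
    fix m assume m: "i \<le> m" "m < k"
    show "up u (x0 + d) + e * cos \<theta> + g * e \<le> oR u m (x0 + d - e * sin \<theta>)"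
    proof (cases "m = i")
      case True
      have "oR u i (x0 + d - e * sin \<theta>) = oR u i (x0 + d) + e * (sin \<theta> * ct i)"
        using oR_shift[OF i(1), of u "x0 + d - e * sin \<theta>" "x0 + d"] by (simp add: mult.assoc)
      also have "sin \<theta> * ct i = g + cos \<theta>" using rot by simp
      finally show ?thesis using up_le(3)[OF i(1), of u "x0 + d"] True by (simp add: algebra_simps)
    next
      case False
      then have "\<gamma> \<le> ct i - ct m" using g2(2)[of m] m gm by simp
      from scale[OF this d] have "up u (x0 + d) + \<gamma> * d \<le> oR u m (x0 + d)"
        using bar[of d] oR_shift[OF m(2), of u "x0 + d" x0] up_le(3)[OF m(2), of u x0]
        by (simp add: left_diff_distrib right_diff_distrib mult.commute)
      also have "\<dots> \<le> oR u m (x0 + d - e * sin \<theta>)" using es by (intro oR_anti_x[OF m(2)]) simp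
      finally show ?thesis using C1d[OF e(1,2)] by linarith
    qed
  next
    fix m e d assume m: "i \<le> m" "m < k" and e: "0 < e" "e * sin \<theta> \<le> d"
    let ?x = "x0 + d - e * sin \<theta>"
    have ec: "0 \<le> e * cos \<theta>" using e cth by simp
    show "min (iR u m ?x) (iL u m ?x) \<le> lo u (x0 + d) + e * cos \<theta>"
    proof (cases "m = i")
      case True
      have "iR u i ?x \<le> iR u i x0" using e by (intro iR_anti_x[OF i(1)]) simp
      also have "\<dots> = up u x0 - 1 / si i" using iR_oR[OF i(1)] i(2) by simp
      also have "\<dots> \<le> 0" using up_le(1)[of u x0] le_divide_eq_1_pos[of "si i" 1] si_pos[OF i(1)] si_less_1[OF i(1)] by linarith
      finally show ?thesis using True lo_ge(1)[of u "x0 + d"] ec by (auto simp: min_le_iff_disj)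
    next
      case False
      then have "\<theta> < \<alpha> ! m" using th(3)[of m] m by simp
      from cot_less[OF th0(1) this] have "ct m \<le> cos \<theta> / sin \<theta>" using angle_less_half_pi[OF m(2)] by simp
      then have "sin \<theta> * ct m \<le> cos \<theta>" using cth by (simp add: field_simps)
      then have "e * (sin \<theta> * ct m) \<le> e * cos \<theta>" using e by (intro mult_left_mono) auto
      then have "e * sin \<theta> * ct m \<le> e * cos \<theta>" by (simp only: mult.assoc)
      then have "iR u m ?x \<le> iR u m (x0 + d) + e * cos \<theta>" using iR_shift[OF m(2), of u ?x "x0 + d"] by simp
      moreover have "iL u m ?x \<le> iL u m (x0 + d) + e * cos \<theta>"
      proof -
        have "0 \<le> e * sin \<theta>" using e cth by simp
        then have "iL u m ?x \<le> iL u m (x0 + d)" by (intro iL_mono_x[OF m(2)]) simp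
        then show ?thesis using ec by simp
      qed
      ultimately show ?thesis using lo_ge(3)[OF m(2), of u "x0 + d"] by (auto simp: min_le_iff_disj)
    qed
  next
    fix e d :: real assume e: "0 < e" "e * sin \<theta> \<le> d"
    have es: "0 \<le> e * sin \<theta>" using e cth by simp
    have "cos \<beta>1 / sin \<beta>1 \<le> cos \<theta> / sin \<theta>" using cot_less[OF th0(1) th(2)] beta_le beta_le_half_pi by simp
    then have "sin \<theta> * (cos \<beta>1 / sin \<beta>1) \<le> cos \<theta>" using cth by (simp add: pos_le_divide_eq mult.commute)
    then have "e * sin \<theta> * (cos \<beta>1 / sin \<beta>1) \<le> e * cos \<theta>" using e by (simp only: mult.assoc mult_left_mono)
    then show "W0 (x0 + d - e * sin \<theta>) \<le> lo u (x0 + d) + e * cos \<theta>"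
      using W0_shift(1)[OF es, of "x0 + d - e * sin \<theta>"] lo_ge(2)[of "x0 + d" u] by simp
  qed
qed

text \<open>
  The upper edge of the butterfly falls strictly when \<open>\<beta>2 < pi / 2\<close>, so a horizontal push of the right part
  to the left gains area under it. The right walls of all hallways move along.
\<close>
lemma no_pinch_at_butterfly:
  assumes opt: "optimal u a b" and x0: "a < x0" "x0 < b" "gap u u x0 = 0"
    and W: "W1 x0 = up u x0" and b2: "\<beta>2 < pi / 2"
  shows False
proof (cases "\<exists>i<k. oR u i x0 = up u x0")
  case True
  then show ?thesis using no_pinch_at_outer_right[OF opt x0] by blast
next
  case False
  have slack: "up u x0 < oR u m x0" if "m < k" for m
    using False that up_le(3)[OF that, of u x0] by fastforce
  have c2: "0 < cos \<beta>2" using b2 beta1_pos beta_le by (intro cos_gt_zero) auto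
  then have cot2: "0 < cos \<beta>2 / sin \<beta>2" using sin_beta_pos by simp
  have s2: "sin \<beta>2 < 1"
    using sin_monotone_2pi[of \<beta>2 "pi/2"] b2 beta1_pos beta_le by auto
  have x0pos: "0 < x0"
  proof -
    have "(1 - x0 * cos \<beta>2) / sin \<beta>2 \<le> 1" using W up_le(1)[of u x0] by (simp add: W1_def)
    then have "1 - sin \<beta>2 \<le> x0 * cos \<beta>2" using sin_beta_pos by (simp add: field_simps)
    then have "0 < x0 * cos \<beta>2" using s2 by linarith
    then show ?thesis using c2 by (simp add: zero_less_mult_iff)
  qed
  obtain \<gamma>1 where g1: "0 < \<gamma>1" "\<And>m. m \<in> {..<k} \<Longrightarrow> \<gamma>1 \<le> ct m - cos \<beta>1 / sin \<beta>1"
    by (rule finite_pos_lower_bound[of "{..<k}" "\<lambda>m. ct m - cos \<beta>1 / sin \<beta>1"]) (use cot_beta1_less in auto)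
  define \<gamma> where "\<gamma> = min \<gamma>1 (cos \<beta>2 / sin \<beta>2)"
  have gm: "0 < \<gamma>" "\<gamma> \<le> \<gamma>1" "\<gamma> \<le> cos \<beta>2 / sin \<beta>2" using g1 cot2 by (auto simp: \<gamma>_def)
  have scale: "\<gamma> * d \<le> c * d" if "\<gamma> \<le> c" "0 \<le> d" for c d using that by (intro mult_right_mono)
  have ang: "\<alpha> ! m < pi / 2" if "m < k" for m by (rule angle_less_half_pi[OF that])
  show False
  proof (rule right_shift_contradiction[OF opt x0 order.refl _ order.refl ang slack gm(1) _ _ cot2 order.refl])
    show "0 < pi / 2" by simp
    fix d :: real assume d: "0 \<le> d"
    show "up u (x0 + d) \<le> up u x0 - \<gamma> * d"
      using up_le(2)[of u "x0 + d"] W1_shift(2)[OF d, of x0] scale[OF gm(3) d] W by (simp add: mult.commute)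
    fix m assume m: "m < k"
    have "\<gamma> \<le> ct m - cos \<beta>1 / sin \<beta>1" using g1(2)[of m] m gm by simp
    from scale[OF this d] show "up u (x0 - d) + \<gamma> * d \<le> oR u m (x0 - d)"
      using up_le(2)[of u "x0 - d"] W1_shift(1)[OF d, of "x0 - d"] W slack[OF m] oR_shift[OF m, of u "x0 - d" x0]
      by (simp add: left_diff_distrib right_diff_distrib mult.commute)
  next
    fix e d :: real assume e: "0 < e" "0 * e \<le> d" "e * sin (pi / 2) \<le> d"
    then show "up u (x0 + d) + e * cos (pi / 2) + cos \<beta>2 / sin \<beta>2 * e \<le> W1 (x0 + d - e * sin (pi / 2))"
      using W1_shift(2)[of e "x0 + d - e"] up_le(2)[of u "x0 + d"] by (simp add: mult.commute)
  next
    fix e d :: real assume e: "0 < e" "e * sin (pi / 2) \<le> d"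
    have "W0 (x0 + d - e) \<le> 0"
    proof -
      have "0 \<le> x0 + d - e" using x0pos e by simp
      then have "- (x0 + d - e) * cos \<beta>1 \<le> 0" using cos_beta_nonneg by (intro mult_nonpos_nonneg) auto
      then have "- (x0 + d - e) * cos \<beta>1 / sin \<beta>1 \<le> 0" using sin_beta_pos by (intro divide_nonpos_pos) auto
      then show ?thesis by (simp add: W0_def min_le_iff_disj)
    qed
    then show "W0 (x0 + d - e * sin (pi / 2)) \<le> lo u (x0 + d) + e * cos (pi / 2)"
      using lo_ge(1)[of u "x0 + d"] by simp
  qed auto
qed

text \<open>
  The mirror image of the argument for right walls: the left part of the component is translated by
  \<open>e\<close> times \<open>(cos \<theta>, sin \<theta>)\<close>, with \<open>\<theta>\<close> slightly smaller than the angle of the wall, and the left walls of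
  all hallways of larger angle move along. The upper edge of the butterfly falls from left to right,
  so it poses no obstacle near the pinch.
\<close>
lemma no_pinch_at_outer_left:
  assumes opt: "optimal u a b" and x0: "a < x0" "x0 < b" "gap u u x0 = 0"
    and i0: "i0 < k" "oL u i0 x0 = up u x0"
  shows False
proof -
  define S where "S = {i. i < k \<and> oL u i x0 = up u x0}"
  define i where "i = Max S"
  have S: "finite S" "i0 \<in> S" using i0 by (auto simp: S_def)
  have "i \<in> S" unfolding i_def using S by (intro Max_in) auto
  then have i: "i < k" "oL u i x0 = up u x0" by (auto simp: S_def)
  have slack: "up u x0 < oL u m x0" if "i < m" "m < k" for m
  proof -
    have "m \<notin> S" using Max_ge[OF S(1), of m] that by (auto simp: i_def)
    then show ?thesis using that up_le(4)[of m u x0] by (fastforce simp: S_def)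
  qed
  obtain \<theta> where th: "0 < \<theta>" "\<theta> < \<alpha> ! i" "\<And>m. m < i \<Longrightarrow> \<alpha> ! m < \<theta>"
  proof -
    define B where "B = insert 0 ((\<lambda>m. \<alpha> ! m) ` {..<i})"
    have "Max B < \<alpha> ! i" using angle_mono[of _ i] angle_pos[OF i(1)] i by (subst Max_less_iff) (auto simp: B_def)
    then obtain \<theta> where t: "Max B < \<theta>" "\<theta> < \<alpha> ! i" using dense by blast
    have "\<forall>b\<in>B. b < \<theta>" using t(1) by (subst (asm) Max_less_iff) (auto simp: B_def)
    then show thesis using t by (intro that[of \<theta>]) (auto simp: B_def)
  qed
  have th0: "0 < \<theta>" "\<theta> < pi / 2" using th angle_less_half_pi[OF i(1)] by auto
  have cth: "0 < cos \<theta>" "cos \<theta> \<le> 1" "0 < sin \<theta>" "sin \<theta> \<le> 1"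
    using th0 by (auto intro!: cos_gt_zero sin_gt_zero)
  define v where "v e n = (if odd n \<and> i < n div 2 \<and> n < 2 * k then u n - e * sin (\<alpha> ! (n div 2) - \<theta>) else u n)" for e n
  have v: "v e (2 * m + 1) = (if i < m then u (2 * m + 1) - e * sin (\<alpha> ! m - \<theta>) else u (2 * m + 1))"
      "v e (2 * m) = u (2 * m)" if "m < k" for e m
    using that by (auto simp: v_def)
  have ang: "\<theta> < \<alpha> ! m" if "i \<le> m" "m < k" for m
    using angle_mono[of i m] that th(2) by (cases "m = i") auto
  have sdiff: "0 < sin (\<alpha> ! m - \<theta>)" if "i \<le> m" "m < k" for m
    using ang[OF that] th0 angle_less_half_pi[OF that(2)] by (intro sin_gt_zero) auto
  have vle: "v e n \<le> u n" if "0 < e" for e n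
    using that sdiff[of "n div 2"] by (auto simp: v_def less_mult_imp_div_less)
  have lov: "lo (v e) x \<le> lo u x" if "0 < e" for e x using vle[OF that] by (intro lo_mono)
  have oLv: "oL (v e) m x = oL u m x - e * (sin (\<alpha> ! m - \<theta>) / co m)" "iL (v e) m x = iL u m x - e * (sin (\<alpha> ! m - \<theta>) / co m)"
    if "i < m" "m < k" for e m x
    using oL_change[of m "v e" x u] iL_change[of m "v e" x u] that v(1)[of m e] by simp_all
  have oLv': "oL (v e) m x = oL u m x" "iL (v e) m x = iL u m x" if "m \<le> i" "m < k" for e m x
    using that v(1)[of m e] by (simp_all add: oL_def iL_def)
  have oRv: "oR (v e) m x = oR u m x" "iR (v e) m x = iR u m x" if "m < k" for e m x
    using v(2)[OF that, of e] by (simp_all add: oR_def iR_def)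
  have rot: "cos \<theta> * tn m - sin (\<alpha> ! m - \<theta>) / co m = sin \<theta>" if "m < k" for m
    using co_pos[OF that] by (simp add: sin_diff field_simps)
  have shL: "oL (v e) m x = oL u m (x - e * cos \<theta>) + e * sin \<theta>" "iL (v e) m x = iL u m (x - e * cos \<theta>) + e * sin \<theta>"
    if "i < m" "m < k" for e m x
  proof -
    have "e * cos \<theta> * tn m - e * (sin (\<alpha> ! m - \<theta>) / co m) = e * sin \<theta>"
      using rot[OF that(2)] by (metis (no_types) mult.assoc right_diff_distrib)
    then show "oL (v e) m x = oL u m (x - e * cos \<theta>) + e * sin \<theta>" "iL (v e) m x = iL u m (x - e * cos \<theta>) + e * sin \<theta>"
      using oLv[OF that, of e x] oL_shift[OF that(2), of u "x - e * cos \<theta>" x]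
        iL_shift[OF that(2), of u "x - e * cos \<theta>" x] by simp_all
  qed
  obtain \<gamma>1 where g1: "0 < \<gamma>1" "\<And>m. m \<in> {i<..<k} \<Longrightarrow> \<gamma>1 \<le> tn m - tn i"
    by (rule finite_pos_lower_bound[of "{i<..<k}" "\<lambda>m. tn m - tn i"]) (use tn_less i in auto)
  obtain \<gamma>2 where g2: "0 < \<gamma>2" "\<And>m. m \<in> {..<i} \<Longrightarrow> \<gamma>2 \<le> tn i - tn m"
    by (rule finite_pos_lower_bound[of "{..<i}" "\<lambda>m. tn i - tn m"]) (use tn_less i in auto)
  define \<gamma> where "\<gamma> = min (min \<gamma>1 \<gamma>2) (tn i)"
  have gm: "0 < \<gamma>" "\<gamma> \<le> \<gamma>1" "\<gamma> \<le> \<gamma>2" "\<gamma> \<le> tn i"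
    using g1 g2 tn_pos[OF i(1)] by (auto simp: \<gamma>_def)
  have scale: "\<gamma> * d \<le> c * d" if "\<gamma> \<le> c" "0 \<le> d" for c d using that by (intro mult_right_mono)
  have bar: "up u (x0 + d) \<le> up u x0 + d * tn i" for d
    using up_le(4)[OF i(1), of u "x0 + d"] oL_shift[OF i(1), of u "x0 + d" x0] i(2) by simp
  have fall: "up u (x0 - d) \<le> up u x0 - \<gamma> * d" if "0 \<le> d" for d
    using bar[of "- d"] scale[OF gm(4) that] by (simp add: mult.commute)
  define g where "g = sin (\<alpha> ! i - \<theta>) / co i"
  have g: "0 < g" using sdiff[OF order.refl i(1)] co_pos[OF i(1)] by (simp add: g_def)
  have gi: "cos \<theta> * tn i = g + sin \<theta>" using rot[OF i(1)] by (simp add: g_def)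
  obtain A where A: "0 < A" "\<And>m. m \<in> {..<k} \<Longrightarrow> 1 / co m + tn m + ct m \<le> A"
    by (rule finite_upper_bound[of "{..<k}" "\<lambda>m. 1 / co m + tn m + ct m"]) auto
  have A': "sin (\<alpha> ! m - \<theta>) / co m \<le> A" "tn m \<le> A" "ct m \<le> A" if "m < k" for m
  proof -
    have "sin (\<alpha> ! m - \<theta>) / co m \<le> 1 / co m" using co_pos[OF that] by (intro divide_right_mono) auto
    then show "sin (\<alpha> ! m - \<theta>) / co m \<le> A" "tn m \<le> A" "ct m \<le> A"
      using A(2)[of m, unfolded lessThan_iff, OF that] tn_pos[OF that] ct_pos[OF that] divide_pos_pos[OF zero_less_one co_pos[OF that]]
      by linarith+
  qed
  define K2 where "K2 = A + 1 + g"
  define C where "C = K2 / \<gamma>"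
  have K2: "0 < K2" using A(1) g by (simp add: K2_def)
  have C: "0 \<le> C" "K2 = \<gamma> * C" using gm K2 by (auto simp: C_def)
  have dC: "K2 * e \<le> \<gamma> * d" if "C * e \<le> d" for e d
    using that gm C by (simp add: mult.assoc)
  have key: "gap u u (x - e * cos \<theta>) + t \<le> gap (v e) (v e) x"
    if e: "0 < e" and x: "x \<le> x0 - C * e" and t: "t \<le> g * e"
      and sl: "\<And>m. i < m \<Longrightarrow> m < k \<Longrightarrow> up u (x - e * cos \<theta>) + t \<le> oL u m (x - e * cos \<theta>)"
    for e x t
  proof -
    define d where "d = x0 - (x - e * cos \<theta>)"
    have xd: "x - e * cos \<theta> = x0 - d" "x = x0 - d + e * cos \<theta>" by (auto simp: d_def)
    have ec: "0 \<le> e * cos \<theta>" using e cth by simp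
    have "0 \<le> C * e" using C e by simp
    then have d: "C * e \<le> d" "0 \<le> d" and xx0: "x \<le> x0" using x ec unfolding d_def by linarith+
    have upd: "up u (x0 - d) + K2 * e \<le> up u x0" using fall[OF d(2)] dC[OF d(1)] by linarith
    have es: "e * sin \<theta> \<le> e" "0 \<le> e * sin \<theta>" using e cth by (auto simp: mult_left_le)
    have K2e: "K2 * e = A * e + e + g * e" by (simp add: K2_def algebra_simps)
    have Ae: "0 \<le> A * e" using A e by simp
    have "up u (x0 - d) + e * sin \<theta> + t \<le> up (v e) x"
      unfolding up_ge_iff
    proof (intro conjI allI impI)
      show "up u (x0 - d) + e * sin \<theta> + t \<le> 1" using upd up_le(1)[of u x0] es K2e Ae t by linarith
      have "up u x0 \<le> W1 x" using up_le(2)[of u x0] W1_shift(3)[of "x0 - x" x] xx0 by simp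
      then show "up u (x0 - d) + e * sin \<theta> + t \<le> W1 x" using upd es K2e Ae t by linarith
      fix m assume m: "m < k"
      have "oR u m (x0 - d) = oR u m x + e * cos \<theta> * ct m" using oR_shift[OF m, of u "x0 - d" x] xd by simp
      moreover have "e * cos \<theta> * ct m \<le> e * A"
      proof -
        have "cos \<theta> * ct m \<le> 1 * A" using A'(3)[OF m] cth ct_pos[OF m] by (intro mult_mono) auto
        then have "e * (cos \<theta> * ct m) \<le> e * A" using e by (intro mult_left_mono) auto
        then show ?thesis by (simp only: mult.assoc)
      qed
      moreover have "up u x0 \<le> oR u m (x0 - d)"
        using up_le(3)[OF m, of u x0] oR_anti_x[OF m, of "x0 - d" x0 u] d by linarith
      ultimately show "up u (x0 - d) + e * sin \<theta> + t \<le> oR (v e) m x"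
        using upd K2e es t oRv[OF m] by (simp add: mult.commute)
      consider "m < i" | "m = i" | "i < m" by linarith
      then show "up u (x0 - d) + e * sin \<theta> + t \<le> oL (v e) m x"
      proof cases
        case 1
        then have "\<gamma> \<le> tn i - tn m" using g2(2)[of m] gm by simp
        from scale[OF this d(2)] have "up u (x0 - d) + \<gamma> * d \<le> oL u m (x0 - d)"
          using bar[of "- d"] oL_shift[OF m, of u "x0 - d" x0] up_le(4)[OF m, of u x0]
          by (simp add: left_diff_distrib right_diff_distrib mult.commute)
        also have "\<dots> \<le> oL u m x" using xd ec by (intro oL_mono_x[OF m]) simp
        finally show ?thesis using dC[OF d(1)] K2e es Ae t oLv'(1)[of m e x] 1 m by simp
      next
        case 2
        have "oL u i x = oL u i (x0 - d) + e * (cos \<theta> * tn i)"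
          using oL_shift[OF i(1), of u x "x0 - d"] xd by (simp add: mult.assoc)
        also have "e * (cos \<theta> * tn i) = g * e + e * sin \<theta>" unfolding gi by (simp add: algebra_simps)
        finally show ?thesis using 2 t up_le(4)[OF i(1), of u "x0 - d"] oLv'(1)[of i e x] i by simp
      next
        case 3
        then show ?thesis using sl[OF 3 m] shL(1)[OF 3 m, of e x] xd(1) by simp
      qed
    qed
    moreover have "lo (v e) x \<le> lo u (x0 - d) + e * sin \<theta>"
      unfolding lo_le_iff
    proof (intro conjI allI impI)
      show "0 \<le> lo u (x0 - d) + e * sin \<theta>" using lo_ge(1)[of u "x0 - d"] es by simp
      show "W0 x \<le> lo u (x0 - d) + e * sin \<theta>"
        using W0_shift(2)[OF ec, of "x0 - d"] lo_ge(2)[of "x0 - d" u] xd es by simp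
      fix m assume m: "m < k"
      have R: "iR u m x \<le> iR u m (x0 - d)" using xd ec by (intro iR_anti_x[OF m]) auto
      consider "m < i" | "m = i" | "i < m" by linarith
      then show "min (iR (v e) m x) (iL (v e) m x) \<le> lo u (x0 - d) + e * sin \<theta>"
      proof cases
        case 1
        have "tn m \<le> tan \<theta>"
        proof -
          have "tan (\<alpha> ! m) < tan \<theta>" using th(3)[OF 1] angle_pos[OF m] th0 by (intro tan_monotone) auto
          then show ?thesis by (simp add: tan_def)
        qed
        then have "cos \<theta> * tn m \<le> sin \<theta>" using cth by (simp add: tan_def pos_le_divide_eq mult.commute)
        then have "e * (cos \<theta> * tn m) \<le> e * sin \<theta>" using e by (intro mult_left_mono) auto
        then have "iL u m x \<le> iL u m (x0 - d) + e * sin \<theta>"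
          using iL_shift[OF m, of u x "x0 - d"] xd by (simp add: mult.assoc)
        then show ?thesis using R es lo_ge(3)[OF m, of u "x0 - d"] 1 m oLv'(2)[of m e x] oRv(2)[OF m, of e x]
          by (auto simp: min_le_iff_disj)
      next
        case 2
        have "iL u i x \<le> iL u i x0" using xx0 by (intro iL_mono_x[OF i(1)]) simp
        also have "\<dots> = up u x0 - 1 / co i" using iL_oL[OF i(1)] i(2) by simp
        also have "\<dots> \<le> 0" using up_le(1)[of u x0] le_divide_eq_1_pos[of "co i" 1] co_pos[OF i(1)] co_less_1[OF i(1)] by linarith
        finally show ?thesis using 2 lo_ge(1)[of u "x0 - d"] es oLv'(2)[of i e x] i by (auto simp: min_le_iff_disj)
      next
        case 3
        then show ?thesis using R es lo_ge(3)[OF m, of u "x0 - d"] shL(2)[OF 3 m, of e x] oRv(2)[OF m, of e x] xd(1)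
          by (auto simp: min_le_iff_disj)
      qed
    qed
    ultimately show ?thesis using xd(1) by (simp add: gap_def)
  qed
  obtain \<eta> where eta: "0 < \<eta>" "\<And>m. m \<in> {i<..<k} \<Longrightarrow> \<eta> \<le> oL u m x0 - up u x0"
    by (rule finite_pos_lower_bound[of "{i<..<k}" "\<lambda>m. oL u m x0 - up u x0"]) (use slack in auto)
  obtain K where K: "0 < K"
    "\<And>d p q p' q' x x'. near d p p' \<Longrightarrow> near d q q' \<Longrightarrow> \<bar>x - x'\<bar> \<le> d \<Longrightarrow> \<bar>lo p x - lo p' x'\<bar> \<le> K * d"
    using gap_lipschitz by metis
  have feas: "0 \<le> gap u u x" if "x \<in> {a..b}" for x using opt that by (auto simp: optimal_def feasible_def)
  define \<rho> where "\<rho> = min (\<eta> / (2 * A)) (x0 - a)"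
  have rho: "0 < \<rho>" "\<rho> \<le> x0 - a" "A * \<rho> \<le> \<eta> / 2"
    using eta A x0 by (auto simp: \<rho>_def min_def field_simps)
  have pos: "0 < x0 - a" "0 < b - x0" "0 < \<rho> / 4" "0 < \<eta> / 2" using x0 rho eta by auto
  show False
  proof (rule no_linear_gain[OF opt x0 C(1) less_imp_le[OF cth(1)] order.refl g, where v = v and ?e1.0 = "x0 - \<rho> / 2" and ?e2.0 = "x0 - \<rho> / 4"])
    show "\<forall>\<^sub>F e in at_right 0. \<forall>x\<in>{x0 + C * e..b - 0 * e}. gap u u (x + 0 * e) \<le> gap (v e) (v e) x"
      using eventually_right_pos
    proof eventually_elim
      case (elim e)
      show ?case
      proof clarsimp
        fix x assume x: "x0 + C * e \<le> x" "x \<le> b"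
        define d where "d = x - x0"
        have ce: "0 \<le> C * e" using C elim by simp
        have d: "x = x0 + d" "C * e \<le> d" "0 \<le> d" using x ce by (auto simp: d_def)
        have "up u x \<le> up (v e) x"
          unfolding up_ge_iff
        proof (intro conjI allI impI)
          fix m assume m: "m < k"
          show "up u x \<le> oL (v e) m x"
          proof (cases "i < m")
            case True
            have "sin (\<alpha> ! m - \<theta>) / co m \<le> K2" using A'(1)[OF m] g by (simp add: K2_def)
            then have "e * (sin (\<alpha> ! m - \<theta>) / co m) \<le> e * K2" using elim by (intro mult_left_mono) auto
            then have "e * (sin (\<alpha> ! m - \<theta>) / co m) \<le> \<gamma> * d" using dC[OF d(2)] by (simp add: mult.commute)
            moreover have "\<gamma> \<le> tn m - tn i" using g1(2)[of m] True m gm by simp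
            from scale[OF this d(3)] have "up u x + \<gamma> * d \<le> oL u m x"
              using bar[of d] oL_shift[OF m, of u "x0 + d" x0] up_le(4)[OF m, of u x0] d(1)
              by (simp add: left_diff_distrib right_diff_distrib mult.commute)
            ultimately show ?thesis using oLv(1)[OF True m, of e x] by simp
          next
            case False then show ?thesis using up_le(4)[OF m, of u x] oLv'(1)[of m e x] m by simp
          qed
          show "up u x \<le> oR (v e) m x" using up_le(3)[OF m, of u x] oRv(1)[OF m] by simp
        qed (use up_le(1,2)[of u x] in auto)
        then show "gap u u x \<le> gap (v e) (v e) x" using lov[OF elim, of x] by (simp add: gap_def)
      qed
    qed
    show "\<forall>\<^sub>F e in at_right 0. \<forall>x\<in>{a + cos \<theta> * e..x0 - C * e}. gap u u (x - cos \<theta> * e) \<le> gap (v e) (v e) x"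
      using eventually_right_pos
    proof eventually_elim
      case (elim e)
      show ?case
        using key[OF elim, of _ 0] up_le(4)[of _ u] elim g by (auto simp: mult.commute)
    qed
    show "\<forall>\<^sub>F e in at_right 0. \<forall>x\<in>{x0 - C * e..x0 + C * e}. 0 \<le> gap (v e) (v e) x"
      using eventually_right_pos eventually_small[OF eta(1), of "K * C + A * C + K2"]
        eventually_small[OF pos(1), of C] eventually_small[OF pos(2), of C]
    proof eventually_elim
      case (elim e)
      show ?case
      proof
        fix x assume x: "x \<in> {x0 - C * e..x0 + C * e}"
        then have xab: "x \<in> {a..b}" using elim by auto
        have xe: "\<bar>x0 - x\<bar> \<le> C * e" using x by (auto simp: abs_le_iff)
        have lu: "lo u x \<le> up u x" using feas[OF xab] by (simp add: gap_def)
        have lx: "lo u x \<le> up u x0 + K * (C * e)"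
          using K(2)[of "C * e" u u u u x x0] xe x0(3) by (simp add: near_refl gap_def abs_le_iff)
        have "lo u x \<le> up (v e) x"
          unfolding up_ge_iff
        proof (intro conjI allI impI)
          fix m assume m: "m < k"
          show "lo u x \<le> oL (v e) m x"
          proof (cases "i < m")
            case True
            have "sin (\<alpha> ! m - \<theta>) / co m \<le> K2" using A'(1)[OF m] g by (simp add: K2_def)
            then have "(sin (\<alpha> ! m - \<theta>) / co m) * e \<le> K2 * e" using elim(1) by (intro mult_right_mono) auto
            then have 1: "e * (sin (\<alpha> ! m - \<theta>) / co m) \<le> K2 * e" by (simp only: mult.commute)
            have "(x0 - x) * tn m \<le> \<bar>x0 - x\<bar> * tn m" using tn_pos[OF m] by (intro mult_right_mono) auto
            also have "\<dots> \<le> (C * e) * A" using xe A'(2)[OF m] tn_pos[OF m] A(1) by (intro mult_mono) auto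
            finally have 2: "oL u m x0 - (C * e) * A \<le> oL u m x" using oL_shift[OF m, of u x0 x] by simp
            have "\<eta> \<le> oL u m x0 - up u x0" using eta(2)[of m] True m by simp
            moreover have "(K * C + A * C + K2) * e = K * (C * e) + (C * e) * A + K2 * e" by (simp add: algebra_simps)
            ultimately show ?thesis using 1 2 lx elim oLv(1)[OF True m, of e x] by linarith
          next
            case False then show ?thesis using up_le(4)[OF m, of u x] oLv'(1)[of m e x] lu m by simp
          qed
          show "lo u x \<le> oR (v e) m x" using up_le(3)[OF m, of u x] oRv(1)[OF m] lu by simp
        qed (use up_le(1,2)[of u x] lu in auto)
        then show "0 \<le> gap (v e) (v e) x" using lov[of e x] elim by (simp add: gap_def)
      qed
    qed
    have "\<forall>\<^sub>F e in at_right 0. \<forall>x\<in>{x0 - \<rho> / 2..x0 - \<rho> / 4}. gap u u (x - cos \<theta> * e) + g * e \<le> gap (v e) (v e) x"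
      using eventually_right_pos eventually_small[OF pos(3), of C] eventually_small[OF pos(3), of "cos \<theta>"] eventually_small[OF pos(4), of g]
    proof eventually_elim
      case (elim e)
      show ?case
      proof
        fix x assume x: "x \<in> {x0 - \<rho> / 2..x0 - \<rho> / 4}"
        define d where "d = x0 - (x - e * cos \<theta>)"
        have se: "0 \<le> cos \<theta> * e" using elim cth by simp
        have d: "0 \<le> d" "d \<le> \<rho>" using x elim se rho by (auto simp: d_def mult.commute)
        have sl: "up u (x - e * cos \<theta>) + g * e \<le> oL u m (x - e * cos \<theta>)" if mi: "i < m" "m < k" for m
        proof -
          have m: "m < k" using mi by simp
          have "d * tn m \<le> \<rho> * A" using d A'(2)[OF m] tn_pos[OF m] rho by (intro mult_mono) auto
          then have "oL u m x0 - \<eta> / 2 \<le> oL u m (x - e * cos \<theta>)"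
            using oL_shift[OF m, of u x0 "x - e * cos \<theta>"] rho by (simp add: d_def mult.commute)
          moreover have "up u (x - e * cos \<theta>) \<le> up u x0"
            using fall[OF d(1)] mult_nonneg_nonneg[OF less_imp_le[OF gm(1)] d(1)] by (simp add: d_def)
          moreover have "\<eta> \<le> oL u m x0 - up u x0" using eta(2)[of m] mi by simp
          ultimately show ?thesis using elim by linarith
        qed
        have "x \<le> x0 - C * e" using x elim by auto
        from key[OF _ this order.refl sl] elim show "gap u u (x - cos \<theta> * e) + g * e \<le> gap (v e) (v e) x"
          by (simp add: mult.commute)
      qed
    qed
    then show "(a < x0 - \<rho> / 2 \<and> x0 - \<rho> / 2 < x0 - \<rho> / 4 \<and> x0 - \<rho> / 4 < x0 \<and>
         (\<forall>\<^sub>F e in at_right 0. \<forall>x\<in>{x0 - \<rho> / 2..x0 - \<rho> / 4}. gap u u (x - cos \<theta> * e) + g * e \<le> gap (v e) (v e) x)) \<or>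
       (x0 < x0 - \<rho> / 2 \<and> x0 - \<rho> / 2 < x0 - \<rho> / 4 \<and> x0 - \<rho> / 4 < b \<and>
         (\<forall>\<^sub>F e in at_right 0. \<forall>x\<in>{x0 - \<rho> / 2..x0 - \<rho> / 4}. gap u u (x + 0 * e) + g * e \<le> gap (v e) (v e) x))"
      using rho by auto
  qed
qed

end

context sofa
begin

section \<open>A pinch on the upper edge of the strip\<close>

lemma beta2_right: "\<beta>2 = pi / 2 \<Longrightarrow> cos \<beta>2 = 0 \<and> sin \<beta>2 = 1" by (metis cos_pi_half sin_pi_half)
lemma W1_ge_1: "\<beta>2 = pi / 2 \<Longrightarrow> 1 \<le> W1 x" by (drule beta2_right) (simp add: W1_def)
lemma W0_le_0: "\<beta>2 = pi / 2 \<Longrightarrow> W0 x \<le> 0" by (drule beta2_right) (simp add: W0_def)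

lemma W0_less_1:
  assumes "feasible u u a b" "a < x0" "x0 \<le> b" shows "W0 x0 < 1"
proof (cases "\<beta>2 = pi / 2")
  case True then show ?thesis using W0_le_0[OF True, of x0] by simp
next
  case False
  then have "0 < cos \<beta>2" using beta1_pos beta_le beta_le_half_pi by (intro cos_gt_zero) auto
  then have c: "0 < cos \<beta>2 / sin \<beta>2" using sin_beta_pos by simp
  have e: "- a * cos \<beta> / sin \<beta> = - x0 * cos \<beta> / sin \<beta> + (x0 - a) * (cos \<beta> / sin \<beta>)" for \<beta>
    by (simp add: left_diff_distrib diff_divide_distrib)
  have "(x0 - a) * (cos \<beta>2 / sin \<beta>2) \<le> (x0 - a) * (cos \<beta>1 / sin \<beta>1)"
    using assms(2) cot_beta_le by (intro mult_left_mono) auto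
  moreover have "0 < (x0 - a) * (cos \<beta>2 / sin \<beta>2)" using c assms(2) by (intro mult_pos_pos) auto
  ultimately have "W0 x0 < W0 a" unfolding W0_def e[of \<beta>1] e[of \<beta>2] by (auto simp: min_def)
  moreover have "0 \<le> gap u u a" using assms by (auto simp: feasible_def)
  ultimately show ?thesis using lo_ge(2)[of a u] up_le(1)[of u a] by (simp add: gap_def)
qed

text \<open>
  The upper boundary at a pinch is none of the walls, so it is the line \<open>y = 1\<close>, and every wall has
  slack there.
\<close>
lemma pinch_top:
  assumes opt: "optimal u a b" and x0: "a < x0" "x0 < b" "gap u u x0 = 0"
  shows "up u x0 = 1" "lo u x0 = 1" "\<And>m. m < k \<Longrightarrow> 1 < oR u m x0" "\<And>m. m < k \<Longrightarrow> 1 < oL u m x0"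
    "1 < W1 x0 \<or> \<beta>2 = pi / 2"
proof -
  have R: "up u x0 < oR u m x0" if "m < k" for m
    using no_pinch_at_outer_right[OF opt x0 that] up_le(3)[OF that, of u x0] by fastforce
  have L: "up u x0 < oL u m x0" if "m < k" for m
    using no_pinch_at_outer_left[OF opt x0 that] up_le(4)[OF that, of u x0] by fastforce
  have W: "up u x0 < W1 x0 \<or> \<beta>2 = pi / 2"
    using no_pinch_at_butterfly[OF opt x0] up_le(2)[of u x0] beta_le_half_pi by fastforce
  show up1: "up u x0 = 1"
  proof (rule up_cases[of u x0])
    assume "up u x0 = W1 x0"
    then show ?thesis using W W1_ge_1[of x0] up_le(1)[of u x0] by auto
  qed (use R L in fastforce)+
  then show "lo u x0 = 1" using x0(3) by (simp add: gap_def)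
  show "\<And>m. m < k \<Longrightarrow> 1 < oR u m x0" "\<And>m. m < k \<Longrightarrow> 1 < oL u m x0" "1 < W1 x0 \<or> \<beta>2 = pi / 2"
    using R L W up1 by auto
qed

definition touching :: "(nat \<Rightarrow> real) \<Rightarrow> real \<Rightarrow> nat set" where
  "touching u x0 = {m. m < k \<and> min (iR u m x0) (iL u m x0) = 1}"

lemma touching_finite: "finite (touching u x0)" by (simp add: touching_def)

text \<open>
  It is the apex of the inner corner that touches the line \<open>y = 1\<close>: if only one of the two inner walls had
  height 1 at \<open>x0\<close>, the corner would rise above 1 on one side of \<open>x0\<close>. The last equation says that the
  apex has height 1, in a form independent of \<open>x0\<close>.
\<close>
lemma touching_apex:
  assumes opt: "optimal u a b" and x0: "a < x0" "x0 < b" and m: "m \<in> touching u x0"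
  shows "m < k" "iR u m x0 = 1" "iL u m x0 = 1" "\<And>x. iR u m x = 1 - (x - x0) * ct m" "\<And>x. iL u m x = 1 + (x - x0) * tn m"
    "u (2 * m) * si m + u (2 * m + 1) * co m = 1"
proof -
  show mk: "m < k" using m by (simp add: touching_def)
  have tent: "min (iR u m x) (iL u m x) \<le> 1" if "x \<in> {a..b}" for x
  proof -
    have "0 \<le> gap u u x" using opt that by (auto simp: optimal_def feasible_def)
    then show ?thesis using lo_ge(3)[OF mk, of u x] up_le(1)[of u x] by (simp add: gap_def)
  qed
  have mn: "min (iR u m x0) (iL u m x0) = 1" using m by (simp add: touching_def)
  show R: "iR u m x0 = 1"
  proof (rule ccontr)
    assume "iR u m x0 \<noteq> 1"
    then have r: "1 < iR u m x0" "iL u m x0 = 1" using mn by (auto simp: min_def split: if_splits)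
    define d where "d = min (b - x0) ((iR u m x0 - 1) / (2 * ct m))"
    have "0 < (iR u m x0 - 1) / (2 * ct m)" using r ct_pos[OF mk] by (intro divide_pos_pos) auto
    then have d: "0 < d" "d \<le> b - x0" using x0 unfolding d_def by linarith+
    have "d \<le> (iR u m x0 - 1) / (2 * ct m)" by (simp add: d_def)
    then have "d * (2 * ct m) \<le> iR u m x0 - 1" using ct_pos[OF mk] by (subst (asm) pos_le_divide_eq) auto
    then have "1 < iR u m (x0 + d)" using iR_shift[OF mk, of u "x0 + d" x0] r by simp
    moreover have "1 < iL u m (x0 + d)" using iL_shift[OF mk, of u "x0 + d" x0] r d tn_pos[OF mk] mult_pos_pos[of d "tn m"] by simp
    ultimately show False using tent[of "x0 + d"] d x0 by auto
  qed
  show L: "iL u m x0 = 1"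
  proof (rule ccontr)
    assume "iL u m x0 \<noteq> 1"
    then have r: "1 < iL u m x0" "iR u m x0 = 1" using mn R by (auto simp: min_def split: if_splits)
    define d where "d = min (x0 - a) ((iL u m x0 - 1) / (2 * tn m))"
    have "0 < (iL u m x0 - 1) / (2 * tn m)" using r tn_pos[OF mk] by (intro divide_pos_pos) auto
    then have d: "0 < d" "d \<le> x0 - a" using x0 unfolding d_def by linarith+
    have "d \<le> (iL u m x0 - 1) / (2 * tn m)" by (simp add: d_def)
    then have "d * (2 * tn m) \<le> iL u m x0 - 1" using tn_pos[OF mk] by (subst (asm) pos_le_divide_eq) auto
    then have "1 < iL u m (x0 - d)" using iL_shift[OF mk, of u "x0 - d" x0] r by simp
    moreover have "1 < iR u m (x0 - d)" using iR_shift[OF mk, of u "x0 - d" x0] r d ct_pos[OF mk] mult_pos_pos[of d "ct m"] by simp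
    ultimately show False using tent[of "x0 - d"] d x0 by auto
  qed
  show "iR u m x = 1 - (x - x0) * ct m" "iL u m x = 1 + (x - x0) * tn m" for x
    using iR_shift[OF mk, of u x x0] iL_shift[OF mk, of u x x0] R L by auto
  have e: "u (2 * m) = si m + x0 * co m" "u (2 * m + 1) = co m - x0 * si m"
    using R L si_pos[OF mk] co_pos[OF mk] by (auto simp: iR_def iL_def field_simps)
  have "u (2 * m) * si m + u (2 * m + 1) * co m = (si m)\<^sup>2 + (co m)\<^sup>2"
    unfolding e by (simp add: algebra_simps power2_eq_square)
  then show "u (2 * m) * si m + u (2 * m + 1) * co m = 1" by simp
qed

lemma touching_nonempty:
  assumes opt: "optimal u a b" and x0: "a < x0" "x0 < b" "gap u u x0 = 0"
  shows "touching u x0 \<noteq> {}"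
proof -
  have l1: "lo u x0 = 1" by (rule pinch_top(2)[OF opt x0])
  have "W0 x0 < 1" using W0_less_1 opt x0 by (auto simp: optimal_def)
  then show ?thesis using l1 by (cases rule: lo_cases[of u x0]) (auto simp: touching_def)
qed

text \<open>
  All inequalities that are strict at the pinch persist for nearby positions and abscissas; only the
  touching corners can come near the line \<open>y = 1\<close>.
\<close>
lemma pinch_neighbourhood:
  assumes opt: "optimal u a b" and x0: "a < x0" "x0 < b" "gap u u x0 = 0"
  obtains r \<eta> where "0 < r" "0 < \<eta>" "a < x0 - r" "x0 + r < b"
    "\<And>z x. near r z u \<Longrightarrow> \<bar>x - x0\<bar> \<le> r \<Longrightarrow> up z x = 1"
    "\<And>z x m. near r z u \<Longrightarrow> \<bar>x - x0\<bar> \<le> r \<Longrightarrow> m < k \<Longrightarrow> 1 + \<eta> \<le> oR z m x \<and> 1 + \<eta> \<le> oL z m x"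
    "\<And>z x m. near r z u \<Longrightarrow> \<bar>x - x0\<bar> \<le> r \<Longrightarrow> m < k \<Longrightarrow> m \<notin> touching u x0 \<Longrightarrow> min (iR z m x) (iL z m x) \<le> 1 - \<eta>"
    "\<And>x. \<bar>x - x0\<bar> \<le> r \<Longrightarrow> W0 x \<le> 1 - \<eta>" "\<And>x. \<bar>x - x0\<bar> \<le> r \<Longrightarrow> 1 \<le> W1 x" "\<eta> < 1"
proof -
  note T = pinch_top[OF opt x0]
  have W0: "W0 x0 < 1" using W0_less_1 opt x0 by (auto simp: optimal_def)
  have tl: "min (iR u m x0) (iL u m x0) < 1" if "m < k" "m \<notin> touching u x0" for m
    using lo_ge(3)[OF that(1), of u x0] T(2) that by (fastforce simp: touching_def)
  obtain K where K: "0 < K"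
    "\<And>d p q x x' m. near d p q \<Longrightarrow> \<bar>x - x'\<bar> \<le> d \<Longrightarrow> m < k \<Longrightarrow> \<bar>oR p m x - oR q m x'\<bar> \<le> K * d"
    "\<And>d p q x x' m. near d p q \<Longrightarrow> \<bar>x - x'\<bar> \<le> d \<Longrightarrow> m < k \<Longrightarrow> \<bar>oL p m x - oL q m x'\<bar> \<le> K * d"
    "\<And>d p q x x' m. near d p q \<Longrightarrow> \<bar>x - x'\<bar> \<le> d \<Longrightarrow> m < k \<Longrightarrow> \<bar>iR p m x - iR q m x'\<bar> \<le> K * d"
    "\<And>d p q x x' m. near d p q \<Longrightarrow> \<bar>x - x'\<bar> \<le> d \<Longrightarrow> m < k \<Longrightarrow> \<bar>iL p m x - iL q m x'\<bar> \<le> K * d"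
    by (rule pieces_lipschitz, rule that) assumption+
  define Kb where "Kb = cos \<beta>1 / sin \<beta>1"
  have Kb: "0 \<le> Kb" using cos_beta_nonneg sin_beta_pos by (simp add: Kb_def)
  obtain e1 where e1: "0 < e1" "\<And>m. m \<in> {..<k} \<Longrightarrow> e1 \<le> min (oR u m x0 - 1) (oL u m x0 - 1)"
    by (rule finite_pos_lower_bound[of "{..<k}" "\<lambda>m. min (oR u m x0 - 1) (oL u m x0 - 1)"]) (use T in auto)
  obtain e2 where e2: "0 < e2" "\<And>m. m \<in> {..<k} - touching u x0 \<Longrightarrow> e2 \<le> 1 - min (iR u m x0) (iL u m x0)"
  proof (rule finite_pos_lower_bound[of "{..<k} - touching u x0" "\<lambda>m. 1 - min (iR u m x0) (iL u m x0)"])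
    show "0 < 1 - min (iR u m x0) (iL u m x0)" if "m \<in> {..<k} - touching u x0" for m
      using tl[of m] that by auto
  qed auto
  define e3 where "e3 = 1 - W0 x0"
  define e4 where "e4 = (if \<beta>2 = pi / 2 then 1 else W1 x0 - 1)"
  have e34: "0 < e3" "0 < e4" using W0 T(5) by (auto simp: e3_def e4_def)
  define \<eta> where "\<eta> = min (min e1 e2) (min (min e3 e4) 1) / 2"
  have eta: "0 < \<eta>" "2 * \<eta> \<le> e1" "2 * \<eta> \<le> e2" "2 * \<eta> \<le> e3" "2 * \<eta> \<le> e4" "\<eta> < 1" using e1 e2 e34 by (auto simp: \<eta>_def)
  define r where "r = min (\<eta> / (K + Kb)) (min ((x0 - a) / 2) ((b - x0) / 2))"
  have KK: "0 < K + Kb" using K(1) Kb by simp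
  have r: "0 < r" "r \<le> (x0 - a) / 2" "r \<le> (b - x0) / 2" using eta(1) KK x0(1,2) unfolding r_def by (simp, meson min.cobounded1 min.cobounded2 order.trans, meson min.cobounded1 min.cobounded2 order.trans)
  have "r \<le> \<eta> / (K + Kb)" by (simp add: r_def)
  then have "(K + Kb) * r \<le> \<eta>" using KK by (simp add: field_simps)
  moreover have "0 \<le> K * r" "0 \<le> Kb * r" using K(1) Kb r by auto
  ultimately have Kr: "K * r \<le> \<eta>" "Kb * r \<le> \<eta>" by (auto simp: algebra_simps)
  have RL: "1 + \<eta> \<le> oR z m x \<and> 1 + \<eta> \<le> oL z m x" if "near r z u" "\<bar>x - x0\<bar> \<le> r" "m < k" for z x m
    using K(2)[OF that] K(3)[OF that] e1(2)[of m] that(3) Kr eta by (auto simp: abs_le_iff)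
  have W1: "1 \<le> W1 x" if x: "\<bar>x - x0\<bar> \<le> r" for x
  proof (cases "\<beta>2 = pi / 2")
    case False
    show ?thesis
    proof (cases "x \<le> x0")
      case True
      then show ?thesis using W1_shift(3)[of "x0 - x" x] e34(2) False by (simp add: e4_def)
    next
      case F: False
      have "(x - x0) * Kb \<le> r * Kb" using x Kb by (intro mult_right_mono) auto
      then show ?thesis using W1_shift(1)[of "x - x0" x0] F False Kr eta by (simp add: e4_def Kb_def mult.commute)
    qed
  qed (rule W1_ge_1)
  have W0': "W0 x \<le> 1 - \<eta>" if x: "\<bar>x - x0\<bar> \<le> r" for x
  proof (cases "x0 \<le> x")
    case True
    then show ?thesis using W0_shift(2)[of "x - x0" x0] eta by (simp add: e3_def)
  next
    case F: False
    have "(x0 - x) * Kb \<le> r * Kb" using x Kb by (intro mult_right_mono) auto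
    then show ?thesis using W0_shift(1)[of "x0 - x" x] F Kr eta by (simp add: e3_def Kb_def mult.commute)
  qed
  have tent: "min (iR z m x) (iL z m x) \<le> 1 - \<eta>" if "near r z u" "\<bar>x - x0\<bar> \<le> r" "m < k" "m \<notin> touching u x0" for z x m
    using K(4)[OF that(1-3)] K(5)[OF that(1-3)] e2(2)[of m] that(3,4) Kr eta by (auto simp: abs_le_iff min_le_iff_disj min_def split: if_splits)
  have up1: "up z x = 1" if "near r z u" "\<bar>x - x0\<bar> \<le> r" for z x
  proof -
    have "1 \<le> up z x" unfolding up_ge_iff using RL[OF that] W1[OF that(2)] eta by fastforce
    then show ?thesis using up_le(1)[of z x] by simp
  qed
  show thesis
    using r x0 by (intro that[of r \<eta>] up1 RL tent W0' W1 eta) auto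
qed

text \<open>
  The left walls of all hallways are moved to the right by \<open>e\<close> and the right walls stay, so every apex
  moves to the right and down, along the right inner wall.
\<close>
definition slide :: "real \<Rightarrow> (nat \<Rightarrow> real) \<Rightarrow> nat \<Rightarrow> real" where
  "slide e u n = (if odd n \<and> n < 2 * k then u n - e * si (n div 2) else u n)"

lemma slide_even: "slide e u (2 * m) = u (2 * m)"
  and slide_odd: "m < k \<Longrightarrow> slide e u (2 * m + 1) = u (2 * m + 1) - e * si m"
  by (auto simp: slide_def)

lemma slide_pieces:
  "oR (slide e u) m x = oR u m x" "iR (slide e u) m x = iR u m x"
  "m < k \<Longrightarrow> oL (slide e u) m x = oL u m (x - e)" "m < k \<Longrightarrow> iL (slide e u) m x = iL u m (x - e)"
  unfolding oR_def iR_def oL_def iL_def slide_even by (simp_all only: slide_odd) (simp_all add: algebra_simps)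

lemma slide_le: "0 \<le> e \<Longrightarrow> slide e u n \<le> u n"
  using si_pos[of "n div 2"] by (auto simp: slide_def less_mult_imp_div_less intro!: mult_nonneg_nonneg)

lemma slide_near:
  assumes "0 \<le> e" shows "near e (slide e u) u"
proof -
  have "\<bar>slide e u i - u i\<bar> \<le> e" for i
  proof (cases "odd i \<and> i < 2 * k")
    case True
    then have "i div 2 < k" by (simp add: less_mult_imp_div_less)
    then have "0 < si (i div 2)" "si (i div 2) < 1" using si_pos si_less_1 by blast+
    then have "e * si (i div 2) \<le> e * 1" "0 \<le> e * si (i div 2)"
      using assms by (intro mult_left_mono mult_nonneg_nonneg; simp)+
    then show ?thesis using True by (simp add: slide_def)
  qed (use assms in \<open>auto simp: slide_def\<close>)
  then show ?thesis by (simp add: near_def)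
qed

text \<open>
  To the left of the pinch the component can follow the sliding left walls: the right walls and the
  butterfly have slack at the pinch, hence also further left.
\<close>
lemma slide_left:
  assumes opt: "optimal u a b" and x0: "a < x0" "x0 < b" "gap u u x0 = 0" and e: "0 \<le> e" and x: "x \<le> x0"
  shows "gap u u (x - e) \<le> gap (slide e u) (slide e u) x" "lo (slide e u) x \<le> lo u (x - e)"
proof -
  note T = pinch_top[OF opt x0]
  have w: "1 \<le> W1 x0" using T(5) W1_ge_1 by auto
  have "up u (x - e) \<le> up (slide e u) x"
    unfolding up_ge_iff
  proof (intro conjI allI impI)
    show u1: "up u (x - e) \<le> 1" by (rule up_le)
    show "up u (x - e) \<le> W1 x" using u1 w W1_shift(3)[of "x0 - x" x] x by simp
    fix m assume m: "m < k"
    show "up u (x - e) \<le> oR (slide e u) m x"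
      using u1 T(3)[OF m] oR_anti_x[OF m x, of u] slide_pieces(1) by simp
    show "up u (x - e) \<le> oL (slide e u) m x" using up_le(4)[OF m] slide_pieces(3)[OF m] by simp
  qed
  moreover show "lo (slide e u) x \<le> lo u (x - e)"
    unfolding lo_le_iff
  proof (intro conjI allI impI)
    show "0 \<le> lo u (x - e)" by (rule lo_ge)
    show "W0 x \<le> lo u (x - e)" using lo_ge(2)[of "x - e" u] W0_shift(2)[OF e, of "x - e"] by simp
    fix m assume m: "m < k"
    show "min (iR (slide e u) m x) (iL (slide e u) m x) \<le> lo u (x - e)"
      using lo_ge(3)[OF m, of u "x - e"] iR_anti_x[OF m, of "x - e" x u] e slide_pieces(2,4) m by (auto simp: min_le_iff_disj)
  qed
  ultimately show "gap u u (x - e) \<le> gap (slide e u) (slide e u) x" by (simp add: gap_def)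
qed

text \<open>
  To the right of the pinch the component can stay where it is: the left outer walls are above 1 at the
  pinch, and rise.
\<close>
lemma slide_right:
  assumes opt: "optimal u a b" and x0: "a < x0" "x0 < b" "gap u u x0 = 0" and e: "0 \<le> e" and x: "x0 + e \<le> x"
  shows "up u x \<le> up (slide e u) x" "gap u u x \<le> gap (slide e u) (slide e u) x"
proof -
  note T = pinch_top[OF opt x0]
  show u: "up u x \<le> up (slide e u) x"
    unfolding up_ge_iff
  proof (intro conjI allI impI)
    show u1: "up u x \<le> 1" by (rule up_le)
    show "up u x \<le> W1 x" by (rule up_le)
    fix m assume m: "m < k"
    show "up u x \<le> oR (slide e u) m x" using up_le(3)[OF m] slide_pieces(1) by simp
    have "1 < oL u m (x - e)" using T(4)[OF m] oL_mono_x[OF m, of x0 "x - e" u] x by simp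
    then show "up u x \<le> oL (slide e u) m x" using u1 slide_pieces(3)[OF m] by simp
  qed
  have "lo (slide e u) x \<le> lo u x" using slide_le[OF e] by (intro lo_mono)
  with u show "gap u u x \<le> gap (slide e u) (slide e u) x" by (simp add: gap_def)
qed

lemma feasible_nonneg: "optimal u a b \<Longrightarrow> x \<in> {a..b} \<Longrightarrow> 0 \<le> gap u u x"
  by (auto simp: optimal_def feasible_def)

text \<open>
  Immediately to the left of the pinch the lower boundary consists of left inner walls of touching
  corners, and sliding lowers these at a positive rate.
\<close>
lemma slide_lowers:
  assumes opt: "optimal u a b" and x0: "a < x0" "x0 < b" "gap u u x0 = 0"
    and low: "y1 < x0"
  obtains e1 e2 g where "y1 < e1" "e1 < e2" "e2 < x0" "0 < g"
    "\<forall>\<^sub>F e in at_right 0. \<forall>x\<in>{e1..e2}. lo (slide e u) x + g * e \<le> lo u x"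
proof -
  obtain r \<eta> where n: "0 < r" "0 < \<eta>" "a < x0 - r" "x0 + r < b"
    "\<And>z x. near r z u \<Longrightarrow> \<bar>x - x0\<bar> \<le> r \<Longrightarrow> up z x = 1"
    "\<And>z x m. near r z u \<Longrightarrow> \<bar>x - x0\<bar> \<le> r \<Longrightarrow> m < k \<Longrightarrow> 1 + \<eta> \<le> oR z m x \<and> 1 + \<eta> \<le> oL z m x"
    "\<And>z x m. near r z u \<Longrightarrow> \<bar>x - x0\<bar> \<le> r \<Longrightarrow> m < k \<Longrightarrow> m \<notin> touching u x0 \<Longrightarrow> min (iR z m x) (iL z m x) \<le> 1 - \<eta>"
    "\<And>x. \<bar>x - x0\<bar> \<le> r \<Longrightarrow> W0 x \<le> 1 - \<eta>" "\<And>x. \<bar>x - x0\<bar> \<le> r \<Longrightarrow> 1 \<le> W1 x" "\<eta> < 1"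
    by (rule pinch_neighbourhood[OF opt x0], rule that) assumption+
  obtain K where K: "0 < K"
    "\<And>d p q p' q' x x'. near d p p' \<Longrightarrow> near d q q' \<Longrightarrow> \<bar>x - x'\<bar> \<le> d \<Longrightarrow> \<bar>lo p x - lo p' x'\<bar> \<le> K * d"
    using gap_lipschitz by metis
  obtain g where g: "0 < g" "\<And>m. m \<in> {..<k} \<Longrightarrow> g \<le> tn m"
    by (rule finite_pos_lower_bound[of "{..<k}" tn]) (use tn_pos in auto)
  define \<rho> where "\<rho> = min (min r ((x0 - y1) / 2)) (\<eta> / (2 * K))"
  have rho: "0 < \<rho>" "\<rho> \<le> r" "\<rho> \<le> (x0 - y1) / 2" using n(1,2) K(1) low unfolding \<rho>_def by (simp, meson min.cobounded1 min.cobounded2 order.trans, meson min.cobounded1 min.cobounded2 order.trans)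
  have "\<rho> \<le> \<eta> / (2 * K)" by (simp add: \<rho>_def)
  then have Krho: "K * \<rho> \<le> \<eta> / 2" using K(1) by (simp add: field_simps)
  have lo1: "1 - \<eta> / 2 \<le> lo u x" if "\<bar>x - x0\<bar> \<le> \<rho>" for x
    using K(2)[of \<rho> u u u u x x0] that pinch_top(2)[OF opt x0] Krho by (simp add: near_refl abs_le_iff)
  have ep: "0 < \<eta> / 2" using n(2) by simp
  have "\<forall>\<^sub>F e in at_right 0. \<forall>x\<in>{x0 - \<rho>..x0 - \<rho> / 2}. lo (slide e u) x + g * e \<le> lo u x"
    using eventually_right_pos eventually_small[OF n(1), of 1] eventually_small[OF ep, of g]
  proof eventually_elim
    case (elim e)
    have e: "0 \<le> e" and nr: "near r (slide e u) u"
      using slide_near[of e u] elim by (auto simp: near_def intro: order_trans)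
    show ?case
    proof
      fix x assume x: "x \<in> {x0 - \<rho>..x0 - \<rho> / 2}"
      have xr: "\<bar>x - x0\<bar> \<le> \<rho>" "\<bar>x - x0\<bar> \<le> r" "x \<le> x0" using x rho by auto
      have "lo (slide e u) x \<le> lo u x - g * e"
        unfolding lo_le_iff
      proof (intro conjI allI impI)
        show "0 \<le> lo u x - g * e" using lo1[OF xr(1)] elim n by simp
        show "W0 x \<le> lo u x - g * e" using lo1[OF xr(1)] elim n(8)[OF xr(2)] by simp
        fix m assume m: "m < k"
        show "min (iR (slide e u) m x) (iL (slide e u) m x) \<le> lo u x - g * e"
        proof (cases "m \<in> touching u x0")
          case False
          then show ?thesis using n(7)[OF nr xr(2) m] lo1[OF xr(1)] elim by linarith
        next
          case True
          note ap = touching_apex[OF opt x0(1,2) True]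
          have "iL u m x \<le> iR u m x"
            using ap(4,5)[of x] mult_nonpos_nonneg[of "x - x0" "tn m"] mult_nonpos_nonneg[of "x - x0" "ct m"] xr(3) tn_pos[OF m] ct_pos[OF m]
            by simp
          then have "iL u m x \<le> lo u x" using lo_ge(3)[OF m, of u x] by linarith
          moreover have "iL (slide e u) m x = iL u m x - e * tn m"
            using slide_pieces(4)[OF m, of e u x] iL_shift[OF m, of u "x - e" x] by simp
          moreover have "e * g \<le> e * tn m" using g(2)[of m] m e by (intro mult_left_mono) auto
          then have "g * e \<le> e * tn m" by (simp only: mult.commute)
          ultimately show ?thesis by linarith
        qed
      qed
      then show "lo (slide e u) x + g * e \<le> lo u x" by simp
    qed
  qed
  then show thesis using rho g low by (intro that[of "x0 - \<rho>" "x0 - \<rho> / 2" g]) auto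
qed

text \<open>
  The upper boundary stays at 1 near the pinch and the lower one only decreases, so sliding does not cut
  the component.
\<close>
lemma slide_middle:
  assumes opt: "optimal u a b" and x0: "a < x0" "x0 < b" "gap u u x0 = 0"
  shows "\<forall>\<^sub>F e in at_right 0. \<forall>x\<in>{x0 - e..x0 + e}. 0 \<le> gap (slide e u) (slide e u) x"
proof -
  obtain r where n: "0 < r" "a < x0 - r" "x0 + r < b"
    "\<And>z x. near r z u \<Longrightarrow> \<bar>x - x0\<bar> \<le> r \<Longrightarrow> up z x = 1"
    by (rule pinch_neighbourhood[OF opt x0], rule that) assumption+
  show ?thesis
    using eventually_right_pos eventually_small[OF n(1), of 1]
  proof eventually_elim
    case (elim e)
    have e: "0 \<le> e" and nr: "near r (slide e u) u"
      using slide_near[of e u] elim by (auto simp: near_def intro: order_trans)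
    show ?case
    proof
      fix x assume x: "x \<in> {x0 - e..x0 + e}"
      then have xr: "\<bar>x - x0\<bar> \<le> r" "x \<in> {a..b}" using elim n by (auto simp: abs_le_iff)
      have "lo (slide e u) x \<le> lo u x" using slide_le[OF e] by (intro lo_mono)
      then show "0 \<le> gap (slide e u) (slide e u) x"
        using feasible_nonneg[OF opt xr(2)] n(4)[OF nr xr(1)] up_le(1)[of u x] by (simp add: gap_def)
    qed
  qed
qed

text \<open>
  Given a second pinch further right, sliding lowers the boundary immediately to the left of it. There,
  between the two pinches, the rest of the component can stay in place, so this is a gain of first order.
\<close>
lemma pinch_unique:
  assumes opt: "optimal u a b" and x0: "a < x0" "x0 < b" "gap u u x0 = 0" and x1: "a < x1" "x1 < b" "gap u u x1 = 0"
  shows "x0 = x1"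
proof -
  have False if "x0 < x1" and x0: "a < x0" "x0 < b" "gap u u x0 = 0" and x1: "a < x1" "x1 < b" "gap u u x1 = 0" for x0 x1
  proof -
    obtain e1 e2 g where e: "x0 < e1" "e1 < e2" "e2 < x1" "0 < g"
      "\<forall>\<^sub>F e in at_right 0. \<forall>x\<in>{e1..e2}. lo (slide e u) x + g * e \<le> lo u x"
      by (rule slide_lowers[OF opt x1 \<open>x0 < x1\<close>])
    have ed: "0 < e1 - x0" using e by simp
    have gn: "\<forall>\<^sub>F e in at_right 0. \<forall>x\<in>{e1..e2}. gap u u (x + 0 * e) + g * e \<le> gap (slide e u) (slide e u) x"
      using e(5) eventually_right_pos eventually_small[OF ed, of 1]
    proof eventually_elim
      case (elim t)
      show ?case
      proof
        fix x assume x: "x \<in> {e1..e2}"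
        have "up u x \<le> up (slide t u) x" using x elim by (intro slide_right(1)[OF opt x0]) auto
        then show "gap u u (x + 0 * t) + g * t \<le> gap (slide t u) (slide t u) x"
          using bspec[OF elim(1) x] by (simp add: gap_def)
      qed
    qed
    show False
    proof (rule no_linear_gain[OF opt x0 zero_le_one zero_le_one order.refl e(4), where v = "\<lambda>e. slide e u" and ?e1.0 = e1 and ?e2.0 = e2])
      show "\<forall>\<^sub>F e in at_right 0. \<forall>x\<in>{a + 1 * e..x0 - 1 * e}. gap u u (x - 1 * e) \<le> gap (slide e u) (slide e u) x"
        using eventually_right_pos by eventually_elim (auto intro!: slide_left[OF opt x0])
      show "\<forall>\<^sub>F e in at_right 0. \<forall>x\<in>{x0 + 1 * e..b - 0 * e}. gap u u (x + 0 * e) \<le> gap (slide e u) (slide e u) x"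
        using eventually_right_pos by eventually_elim (auto intro!: slide_right[OF opt x0])
      show "\<forall>\<^sub>F e in at_right 0. \<forall>x\<in>{x0 - 1 * e..x0 + 1 * e}. 0 \<le> gap (slide e u) (slide e u) x"
        using slide_middle[OF opt x0] by simp
    qed (use e gn x1 in auto)
  qed
  from this[of x0 x1] this[of x1 x0] show ?thesis using x0 x1 by (cases x0 x1 rule: linorder_cases) auto
qed

end

section \<open>Both outer walls of a touching hallway are visible\<close>

text \<open>
  A triangle of height \<open>t\<close> with sides of slope \<open>s\<close>, bounded by its enclosing rectangle.
\<close>
lemma integral_hat_le:
  fixes t s y :: real
  assumes "0 \<le> t" "0 < s"
  shows "integral {A..B} (\<lambda>x. max 0 (t - s * \<bar>x - y\<bar>)) \<le> 2 * t\<^sup>2 / s"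
proof -
  let ?I = "{y - t / s..y + t / s}"
  have lm: "?I \<inter> {A..B} \<in> lmeasurable" by (intro lmeasurable_compact compact_Int) auto
  have ii: "(indicat_real ?I) integrable_on {A..B}"
    using lm by (simp add: integrable_on_indicator)
  have "integral {A..B} (\<lambda>x. max 0 (t - s * \<bar>x - y\<bar>)) \<le> integral {A..B} (\<lambda>x. t * indicat_real ?I x)"
  proof (rule integral_le)
    show "(\<lambda>x. max 0 (t - s * \<bar>x - y\<bar>)) integrable_on {A..B}"
      by (intro integrable_continuous_real continuous_intros)
    show "(\<lambda>x. t * indicat_real ?I x) integrable_on {A..B}" by (intro integrable_on_mult_right ii)
    fix x assume "x \<in> {A..B}"
    show "max 0 (t - s * \<bar>x - y\<bar>) \<le> t * indicat_real ?I x"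
    proof (cases "x \<in> ?I")
      case False
      then have "t / s < \<bar>x - y\<bar>" by (auto simp: abs_if)
      then have "t < s * \<bar>x - y\<bar>" using assms by (simp add: field_simps)
      then show ?thesis using False by simp
    qed (use assms in auto)
  qed
  also have "\<dots> = t * measure lebesgue (?I \<inter> {A..B})"
    using Equivalence_Lebesgue_Henstock_Integration.integral_indicator[OF lm] by simp
  also have "\<dots> \<le> t * measure lebesgue ?I"
    using assms lm by (intro mult_left_mono measure_mono_fmeasurable) auto
  also have "measure lebesgue ?I = 2 * t / s" using assms by simp
  finally show ?thesis by (simp add: power2_eq_square mult.left_commute)
qed

text \<open>
  The function \<open>h e\<close> arises from \<open>f\<close> by lowering a line at distance \<open>D\<close> above the upper boundary by \<open>c * e\<close>.
  If \<open>D\<close> vanishes at most at isolated points, from which it grows linearly, then the loss is a sum of small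
  triangles and so quadratic in \<open>e\<close>. The loss could make \<open>h e\<close> negative near the ends \<open>a\<close> and \<open>b\<close>; since
  \<open>f\<close> grows at least linearly there, it suffices to trim the interval by a multiple of \<open>e\<close>, again at
  quadratic cost. Near the pinch \<open>x0\<close>, where \<open>f\<close> vanishes as well, there must be no loss at all. So a
  first-order gain on some interval outweighs everything.
\<close>
lemma small_loss:
  fixes f D :: "real \<Rightarrow> real" and h :: "real \<Rightarrow> real \<Rightarrow> real"
  assumes cf: "continuous_on UNIV f" and ch: "\<And>e. continuous_on UNIV (h e)"
    and ab: "a < b" and pos: "0 < c0" "0 < c" "0 < g" "0 \<le> K"
    and grow: "\<And>x. x \<in> {a..b} \<Longrightarrow> r \<le> \<bar>x - x0\<bar> \<Longrightarrow> c0 * min (x - a) (b - x) \<le> f x"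
    and f0: "\<And>x. x \<in> {a..b} \<Longrightarrow> 0 \<le> f x" "\<And>x. f x \<le> K * \<bar>x - a\<bar>" "\<And>x. f x \<le> K * \<bar>x - b\<bar>"
    and loss: "\<forall>\<^sub>F e in at_right 0. \<forall>x\<in>{a..b}. f x - max 0 (c * e - D x) \<le> h e x"
    and near: "\<forall>\<^sub>F e in at_right 0. \<forall>x\<in>{a..b}. \<bar>x - x0\<bar> \<le> r \<longrightarrow> f x \<le> h e x"
    and lines: "finite S" "\<And>x. a < x \<Longrightarrow> x < b \<Longrightarrow> \<exists>(s, y)\<in>S. D x = s * \<bar>x - y\<bar>" "\<And>s y. (s, y) \<in> S \<Longrightarrow> 0 < s"
    and gain: "a < e1" "e1 < e2" "e2 < b" "\<forall>\<^sub>F e in at_right 0. \<forall>x\<in>{e1..e2}. f x + g * e \<le> h e x"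
  shows "\<forall>\<^sub>F e in at_right 0. \<exists>A B. A \<le> B \<and> (\<forall>x\<in>{A..B}. 0 \<le> h e x) \<and> integral {a..b} f < integral {A..B} (h e)"
proof -
  define C where "C = c / c0"
  define L where "L e x = (\<Sum>(s, y)\<in>S. max 0 (c * e - s * \<bar>x - y\<bar>))" for e x
  define M where "M = (\<Sum>(s, y)\<in>S. 2 * c\<^sup>2 / s)"
  have C: "0 < C" using pos by (simp add: C_def)
  have i: "f integrable_on {p..q}" for p q
    using cf by (auto intro!: integrable_continuous_real elim!: continuous_on_subset)
  have e12: "0 < g * (e2 - e1)" "0 < e1 - a" "0 < b - e2" using gain pos by auto
  show ?thesis
    using loss near gain(4) eventually_right_pos eventually_small[OF e12(1), of "M + 2 * K * C\<^sup>2"]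
      eventually_small[OF e12(2), of C] eventually_small[OF e12(3), of C]
  proof eventually_elim
    case (elim e)
    have e: "0 < e" "0 \<le> C * e" "0 \<le> c * e" using elim C pos by auto
    define A where "A = a + C * e"
    define B where "B = b - C * e"
    have AB: "a \<le> A" "A \<le> e1" "e2 \<le> B" "B \<le> b" "A \<le> B" "a < A" "B < b" using elim e gain mult_pos_pos[OF C e(1)] by (auto simp: A_def B_def)
    have h0: "0 \<le> h e x" if x: "x \<in> {A..B}" for x
    proof (cases "\<bar>x - x0\<bar> \<le> r")
      case True
      then show ?thesis using elim(2) f0(1)[of x] x AB by force
    next
      case False
      have "C * e \<le> min (x - a) (b - x)" using x by (auto simp: A_def B_def)
      then have "c0 * (C * e) \<le> c0 * min (x - a) (b - x)" using pos by simp
      also have "\<dots> \<le> f x" using False x AB by (intro grow) auto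
      finally have "c * e \<le> f x" using pos by (simp add: C_def)
      moreover have "0 \<le> D x"
      proof -
        obtain s y where "(s, y) \<in> S" "D x = s * \<bar>x - y\<bar>" using lines(2)[of x] x AB by force
        then show ?thesis using lines(3)[of s y] by simp
      qed
      moreover have "f x - max 0 (c * e - D x) \<le> h e x" using elim(1) x AB by auto
      ultimately show ?thesis using e f0(1)[of x] x AB by auto
    qed
    have L0: "max 0 (c * e - D x) \<le> L e x" if x: "x \<in> {A..B}" for x
    proof -
      obtain s y where "(s, y) \<in> S" "D x = s * \<bar>x - y\<bar>" using lines(2)[of x] x AB by force
      then show ?thesis unfolding L_def
        using member_le_sum[of "(s, y)" S "\<lambda>(s, y). max 0 (c * e - s * \<bar>x - y\<bar>)"] lines(1) by (simp add: case_prod_unfold)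
    qed
    have cL: "continuous_on T (L e)" for T
      unfolding L_def case_prod_unfold by (intro continuous_intros)
    have iL: "integral {A..B} (L e) \<le> M * e\<^sup>2"
    proof -
      have "integral {A..B} (L e) = (\<Sum>z\<in>S. integral {A..B} (\<lambda>x. max 0 (c * e - fst z * \<bar>x - snd z\<bar>)))"
        unfolding L_def case_prod_unfold
        by (intro integral_sum lines(1) integrable_continuous_real continuous_intros)
      also have "\<dots> \<le> (\<Sum>z\<in>S. 2 * (c * e)\<^sup>2 / fst z)"
        using lines(3) e by (intro sum_mono integral_hat_le) (auto simp: prod.collapse)
      also have "\<dots> = M * e\<^sup>2"
        unfolding M_def case_prod_unfold sum_distrib_right by (simp add: power_mult_distrib mult.assoc)
      finally show ?thesis .
    qed
    have "integral {A..B} (\<lambda>x. f x - L e x) + g * e * (e2 - e1) \<le> integral {A..B} (h e)"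
    proof (rule integral_gain)
      show "continuous_on {A..B} (\<lambda>x. f x - L e x)"
        by (intro continuous_intros cL continuous_on_subset[OF cf subset_UNIV])
      show "continuous_on {A..B} (h e)" by (rule continuous_on_subset[OF ch subset_UNIV])
      show "f x - L e x \<le> h e x" if "x \<in> {A..B}" for x
      proof -
        have "x \<in> {a..b}" using that AB by auto
        then have "f x - max 0 (c * e - D x) \<le> h e x" using elim(1) by blast
        then show ?thesis using L0[OF that] by linarith
      qed
      show "f x - L e x + g * e \<le> h e x" if "x \<in> {e1..e2}" for x
      proof -
        have "x \<in> {A..B}" using that AB by auto
        then have "0 \<le> L e x" using L0[of x] by (simp add: max_def split: if_splits)
        moreover have "f x + g * e \<le> h e x" using elim(3) that by blast
        ultimately show ?thesis by linarith
      qed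
    qed (use AB gain in auto)
    moreover have "integral {A..B} (\<lambda>x. f x - L e x) = integral {A..B} f - integral {A..B} (L e)"
      by (intro Henstock_Kurzweil_Integration.integral_diff i integrable_continuous_real cL)
    moreover have "integral {a..b} f \<le> integral {A..B} f + 2 * K * (C * e)\<^sup>2"
    proof -
      have s: "integral {a..b} f = integral {a..A} f + integral {A..B} f + integral {B..b} f"
        using Henstock_Kurzweil_Integration.integral_combine[of a A b f] Henstock_Kurzweil_Integration.integral_combine[of A B b f]
          AB i by simp
      have "integral {a..A} f \<le> integral {a..A} (\<lambda>x. K * (C * e))"
      proof (intro integral_le i integrable_continuous_real continuous_intros)
        fix x assume "x \<in> {a..A}"
        then have "K * \<bar>x - a\<bar> \<le> K * (C * e)" using pos by (intro mult_left_mono) (auto simp: A_def)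
        then show "f x \<le> K * (C * e)" using f0(2)[of x] by linarith
      qed
      moreover have "integral {B..b} f \<le> integral {B..b} (\<lambda>x. K * (C * e))"
      proof (intro integral_le i integrable_continuous_real continuous_intros)
        fix x assume "x \<in> {B..b}"
        then have "K * \<bar>x - b\<bar> \<le> K * (C * e)" using pos by (intro mult_left_mono) (auto simp: B_def)
        then show "f x \<le> K * (C * e)" using f0(3)[of x] by linarith
      qed
      moreover have "integral {a..A} (\<lambda>x. K * (C * e)) = K * (C * e)\<^sup>2" "integral {B..b} (\<lambda>x. K * (C * e)) = K * (C * e)\<^sup>2"
        using AB by (simp_all add: A_def B_def power2_eq_square)
      ultimately show ?thesis using s by linarith
    qed
    moreover have "M * e\<^sup>2 + 2 * K * (C * e)\<^sup>2 < g * e * (e2 - e1)"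
    proof -
      have "M * e\<^sup>2 + 2 * K * (C * e)\<^sup>2 = ((M + 2 * K * C\<^sup>2) * e) * e" by (simp add: power2_eq_square algebra_simps)
      also have "\<dots> < (g * (e2 - e1)) * e" using elim(5) e by (intro mult_strict_right_mono) auto
      finally show ?thesis by (simp add: algebra_simps)
    qed
    ultimately have "integral {a..b} f < integral {A..B} (h e)" using iL by linarith
    then show ?case using AB(5) h0 by blast
  qed
qed

text \<open>
  Near \<open>a\<close> the only affine pieces that can represent \<open>f\<close> are those vanishing at \<open>a\<close>, as the others are
  bounded away from 0 there, and positivity forces their slopes to be positive.
\<close>
lemma affine_growth:
  fixes f :: "real \<Rightarrow> real" and A :: "(real \<times> real) set"
  assumes fin: "finite A" and ab: "a < b" and aff: "\<And>x. \<exists>(p, q)\<in>A. f x = p + q * x"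
    and f: "f a = 0" "\<And>x. a < x \<Longrightarrow> x < b \<Longrightarrow> 0 < f x" "0 \<le> K" "\<And>x. f x \<le> K * \<bar>x - a\<bar>"
  obtains c \<rho> where "0 < c" "0 < \<rho>" "a + \<rho> < b" "\<And>x. x \<in> {a..a + \<rho>} \<Longrightarrow> c * (x - a) \<le> f x"
proof -
  obtain c where c: "0 < c" "\<And>z. z \<in> {z \<in> A. 0 < snd z} \<Longrightarrow> c \<le> snd z"
    by (rule finite_pos_lower_bound[of "{z \<in> A. 0 < snd z}" snd]) (use fin in auto)
  obtain \<eta> where eta: "0 < \<eta>" "\<And>z. z \<in> {z \<in> A. fst z + snd z * a \<noteq> 0} \<Longrightarrow> \<eta> \<le> \<bar>fst z + snd z * a\<bar>"
    by (rule finite_pos_lower_bound[of "{z \<in> A. fst z + snd z * a \<noteq> 0}" "\<lambda>z. \<bar>fst z + snd z * a\<bar>"]) (use fin in auto)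
  obtain Q where Q: "0 < Q" "\<And>z. z \<in> A \<Longrightarrow> \<bar>snd z\<bar> \<le> Q"
    by (rule finite_upper_bound[of A "\<lambda>z. \<bar>snd z\<bar>"]) (use fin in auto)
  define \<rho> where "\<rho> = min ((b - a) / 2) (\<eta> / (2 * (Q + K)))"
  have QK: "0 < Q + K" using Q f(3) by simp
  have r: "0 < \<rho>" using ab eta QK by (simp add: \<rho>_def)
  have "\<rho> \<le> (b - a) / 2" unfolding \<rho>_def by (rule min.cobounded1)
  then have rb: "a + \<rho> < b" using ab by (simp add: field_simps)
  have "\<rho> \<le> \<eta> / (2 * (Q + K))" unfolding \<rho>_def by (rule min.cobounded2)
  then have "(Q + K) * \<rho> \<le> \<eta> / 2" using QK by (simp add: field_simps)
  then have r2: "(Q + K) * \<rho> < \<eta>" using eta by linarith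
  have "c * (x - a) \<le> f x" if x: "x \<in> {a..a + \<rho>}" for x
  proof (cases "x = a")
    case False
    then have xa: "0 < x - a" "x < b" "0 < f x" using x rb f(2)[of x] by auto
    obtain z where z: "z \<in> A" "f x = fst z + snd z * x" using aff[of x] by auto
    have fx: "f x = (fst z + snd z * a) + snd z * (x - a)" using z by (simp add: algebra_simps)
    have za: "fst z + snd z * a = 0"
    proof (rule ccontr)
      assume "fst z + snd z * a \<noteq> 0"
      then have "\<eta> \<le> \<bar>fst z + snd z * a\<bar>" using eta(2)[of z] z(1) by simp
      moreover have "\<bar>snd z * (x - a)\<bar> \<le> Q * (x - a)" using Q(2)[OF z(1)] xa by (simp add: abs_mult mult_right_mono)
      moreover have "f x \<le> K * (x - a)" using f(4)[of x] xa by simp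
      ultimately have "\<eta> \<le> (Q + K) * (x - a)" using fx xa by (simp add: algebra_simps abs_le_iff abs_if split: if_splits)
      also have "\<dots> \<le> (Q + K) * \<rho>" using x QK by (intro mult_left_mono) auto
      finally show False using r2 by simp
    qed
    then have "0 < snd z" using fx xa by (simp add: zero_less_mult_iff)
    then have "c \<le> snd z" using c(2)[of z] z(1) by simp
    then show ?thesis using fx za xa by (simp add: mult_right_mono)
  qed (use f in simp)
  then show thesis using that[OF c(1) r rb] by blast
qed

context sofa
begin

definition upper_lines :: "(nat \<Rightarrow> real) \<Rightarrow> (real \<times> real) set" where
  "upper_lines u = {(1, 0), (1 / sin \<beta>1, - (cos \<beta>1 / sin \<beta>1)), (1 / sin \<beta>2, - (cos \<beta>2 / sin \<beta>2))}
     \<union> (\<lambda>m. (oR u m 0, - ct m)) ` {..<k} \<union> (\<lambda>m. (oL u m 0, tn m)) ` {..<k}"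
definition lower_lines :: "(nat \<Rightarrow> real) \<Rightarrow> (real \<times> real) set" where
  "lower_lines u = {(0, 0), (0, - (cos \<beta>1 / sin \<beta>1)), (0, - (cos \<beta>2 / sin \<beta>2))}
     \<union> (\<lambda>m. (iR u m 0, - ct m)) ` {..<k} \<union> (\<lambda>m. (iL u m 0, tn m)) ` {..<k}"

lemma W1_line: "W1 x = 1 / sin \<beta>1 + - (cos \<beta>1 / sin \<beta>1) * x \<or> W1 x = 1 / sin \<beta>2 + - (cos \<beta>2 / sin \<beta>2) * x"
  by (auto simp: W1_def max_def diff_divide_distrib mult.commute)
lemma W0_line: "W0 x = - (cos \<beta>1 / sin \<beta>1) * x \<or> W0 x = - (cos \<beta>2 / sin \<beta>2) * x"
  by (auto simp: W0_def min_def mult.commute)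
lemma oR_line: "m < k \<Longrightarrow> oR u m x = oR u m 0 + - ct m * x" and iR_line: "m < k \<Longrightarrow> iR u m x = iR u m 0 + - ct m * x"
  using oR_shift[of m u x 0] iR_shift[of m u x 0] by (auto simp: mult.commute)
lemma oL_line: "m < k \<Longrightarrow> oL u m x = oL u m 0 + tn m * x" and iL_line: "m < k \<Longrightarrow> iL u m x = iL u m 0 + tn m * x"
  using oL_shift[of m u x 0] iL_shift[of m u x 0] by (auto simp: mult.commute)

lemma up_line: "\<exists>(p, q)\<in>upper_lines u. up u x = p + q * x"
proof (cases rule: up_cases[of u x])
  case 1 then show ?thesis by (auto simp: upper_lines_def)
next
  case 2 then show ?thesis using W1_line[of x] by (auto simp: upper_lines_def)
next
  case (3 m) then show ?thesis using oR_line[OF 3(1), of u x]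
    by (intro bexI[of _ "(oR u m 0, - ct m)"]) (auto simp: upper_lines_def)
next
  case (4 m) then show ?thesis using oL_line[OF 4(1), of u x]
    by (intro bexI[of _ "(oL u m 0, tn m)"]) (auto simp: upper_lines_def)
qed

lemma lo_line: "\<exists>(p, q)\<in>lower_lines u. lo u x = p + q * x"
proof (cases rule: lo_cases[of u x])
  case 1 then show ?thesis by (auto simp: lower_lines_def)
next
  case 2 then show ?thesis using W0_line[of x] by (auto simp: lower_lines_def)
next
  case (3 m)
  then consider "lo u x = iR u m x" | "lo u x = iL u m x" by (auto simp: min_def split: if_splits)
  then show ?thesis
  proof cases
    case 1 then show ?thesis using iR_line[OF 3(1), of u x] 3(1)
      by (intro bexI[of _ "(iR u m 0, - ct m)"]) (auto simp: lower_lines_def)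
  next
    case 2 then show ?thesis using iL_line[OF 3(1), of u x] 3(1)
      by (intro bexI[of _ "(iL u m 0, tn m)"]) (auto simp: lower_lines_def)
  qed
qed

lemma gap_line:
  obtains A where "finite A" "\<And>x. \<exists>(p, q)\<in>A. gap u u x = p + q * x"
proof (rule that[of "(\<lambda>((p, q), (p', q')). (p - p', q - q')) ` (upper_lines u \<times> lower_lines u)"])
  show "finite ((\<lambda>((p, q), (p', q')). (p - p', q - q')) ` (upper_lines u \<times> lower_lines u))"
    by (auto simp: upper_lines_def lower_lines_def)
  fix x
  obtain p q p' q' where "(p, q) \<in> upper_lines u" "(p', q') \<in> lower_lines u" "up u x = p + q * x" "lo u x = p' + q' * x"
    using up_line[of u x] lo_line[of u x] by auto
  then show "\<exists>(p, q)\<in>(\<lambda>((p, q), (p', q')). (p - p', q - q')) ` (upper_lines u \<times> lower_lines u). gap u u x = p + q * x"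
    by (intro bexI[of _ "(p - p', q - q')"]) (auto simp: gap_def algebra_simps intro!: image_eqI[of _ _ "((p, q), (p', q'))"])
qed

text \<open>
  Where the gap is positive at an end, the interval can be enlarged.
\<close>
lemma optimal_ends:
  assumes opt: "optimal u a b" shows "a < b" "gap u u a = 0" "gap u u b = 0"
proof -
  have f: "feasible u u a b" and ap: "0 < area u u a b" and mx: "\<And>v c d. feasible v v c d \<Longrightarrow> area v v c d \<le> area u u a b"
    using opt by (auto simp: optimal_def)
  have "a \<noteq> b" using ap by (auto simp: area_def)
  then show ab: "a < b" using f by (auto simp: feasible_def)
  obtain K where K: "0 < K"
    "\<And>d p q p' q' x x'. near d p p' \<Longrightarrow> near d q q' \<Longrightarrow> \<bar>x - x'\<bar> \<le> d \<Longrightarrow> \<bar>gap p q x - gap p' q' x'\<bar> \<le> K * d"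
    using gap_lipschitz by metis
  have lip: "gap u u y - K * \<bar>x - y\<bar> \<le> gap u u x" for x y
    using K(2)[of "\<bar>x - y\<bar>" u u u u x y] by (auto simp: near_refl abs_le_iff)
  have lower: "gap u u y / 2 \<le> gap u u x" if y: "0 < gap u u y" and x: "\<bar>x - y\<bar> \<le> gap u u y / (2 * K)" for x y
  proof -
    have "K * \<bar>x - y\<bar> \<le> gap u u y / 2" using x K(1) by (simp add: field_simps)
    then show ?thesis using lip[of y x] by linarith
  qed
  have posint: "0 < integral {s..t} (gap u u)" if "s < t" "0 < m" "\<And>x. x \<in> {s..t} \<Longrightarrow> m \<le> gap u u x" for s t m
  proof -
    have "(t - s) * m = integral {s..t} (\<lambda>x. m)" using that by simp
    also have "\<dots> \<le> integral {s..t} (gap u u)" using that by (intro integral_le gap_integrable) auto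
    finally have "(t - s) * m \<le> integral {s..t} (gap u u)" .
    moreover have "0 < (t - s) * m" using that by simp
    ultimately show ?thesis by linarith
  qed
  show "gap u u b = 0"
  proof (rule ccontr)
    assume "gap u u b \<noteq> 0"
    moreover have "0 \<le> gap u u b" using ab by (intro feasible_nonneg[OF opt]) simp
    ultimately have g: "0 < gap u u b" by simp
    define t where "t = b + gap u u b / (2 * K)"
    have t: "b < t" using g K by (simp add: t_def)
    have m: "gap u u b / 2 \<le> gap u u x" if "x \<in> {b..t}" for x using that by (intro lower g) (auto simp: t_def)
    have "feasible u u a t"
      unfolding feasible_def
    proof (intro conjI ballI)
      fix x assume "x \<in> {a..t}"
      then show "0 \<le> gap u u x" using f m[of x] g by (cases "x \<le> b") (auto simp: feasible_def)
    qed (use ab t in auto)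
    then have "area u u a t \<le> area u u a b" by (rule mx)
    moreover have "area u u a t = area u u a b + integral {b..t} (gap u u)"
      unfolding area_def using ab t by (intro Henstock_Kurzweil_Integration.integral_combine[symmetric] gap_integrable) auto
    ultimately show False using posint[OF t _ m] g by simp
  qed
  show "gap u u a = 0"
  proof (rule ccontr)
    assume "gap u u a \<noteq> 0"
    moreover have "0 \<le> gap u u a" using ab by (intro feasible_nonneg[OF opt]) simp
    ultimately have g: "0 < gap u u a" by simp
    define t where "t = a - gap u u a / (2 * K)"
    have t: "t < a" using g K by (simp add: t_def)
    have m: "gap u u a / 2 \<le> gap u u x" if "x \<in> {t..a}" for x using that by (intro lower g) (auto simp: t_def)
    have "feasible u u t b"
      unfolding feasible_def
    proof (intro conjI ballI)
      fix x assume "x \<in> {t..b}"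
      then show "0 \<le> gap u u x" using f m[of x] g by (cases "a \<le> x") (auto simp: feasible_def)
    qed (use ab t in auto)
    then have "area u u t b \<le> area u u a b" by (rule mx)
    moreover have "area u u t b = integral {t..a} (gap u u) + area u u a b"
      unfolding area_def using ab t by (intro Henstock_Kurzweil_Integration.integral_combine[symmetric] gap_integrable) auto
    ultimately show False using posint[OF t _ m] g by simp
  qed
qed

text \<open>
  Linear growth at the two ends is a matter of piecewise linearity; in between, away from the only zero
  \<open>x0\<close>, the gap has a positive minimum.
\<close>
lemma optimal_growth:
  assumes opt: "optimal u a b" and pos: "\<And>x. a < x \<Longrightarrow> x < b \<Longrightarrow> x \<noteq> x0 \<Longrightarrow> 0 < gap u u x" and x0: "a < x0" "x0 < b" and r: "0 < r"
  obtains c where "0 < c" "\<And>x. x \<in> {a..b} \<Longrightarrow> r \<le> \<bar>x - x0\<bar> \<Longrightarrow> c * min (x - a) (b - x) \<le> gap u u x"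
proof -
  note ends = optimal_ends[OF opt]
  obtain K where K: "0 < K" "\<And>u x0 x. gap u u x0 = 0 \<Longrightarrow> gap u u x \<le> K * \<bar>x - x0\<bar>"
    using gap_bound_at_zero by metis
  obtain A where A: "finite A" "\<And>x. \<exists>(p, q)\<in>A. gap u u x = p + q * x" using gap_line by metis
  obtain c1 \<rho>1 where 1: "0 < c1" "0 < \<rho>1" "a + \<rho>1 < x0" "\<And>x. x \<in> {a..a + \<rho>1} \<Longrightarrow> c1 * (x - a) \<le> gap u u x"
  proof (rule affine_growth[OF A(1) x0(1) A(2) ends(2) _ less_imp_le[OF K(1)] K(2)[OF ends(2)]])
    show "0 < gap u u x" if "a < x" "x < x0" for x using that x0 by (intro pos) auto
  qed (rule that)
  have A': "finite ((\<lambda>(p, q). (p, - q)) ` A)" "\<exists>(p, q)\<in>(\<lambda>(p, q). (p, - q)) ` A. gap u u (- x) = p + q * x" for x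
    using A(1) A(2)[of "- x"] by force+
  obtain c2 \<rho>2 where 2: "0 < c2" "0 < \<rho>2" "- b + \<rho>2 < - x0" "\<And>x. x \<in> {- b..- b + \<rho>2} \<Longrightarrow> c2 * (x - - b) \<le> gap u u (- x)"
  proof (rule affine_growth[OF A'(1) _ A'(2), of "- b" "- x0" K])
    show "0 < gap u u (- x)" if "- b < x" "x < - x0" for x using that x0 by (intro pos) auto
    show "gap u u (- x) \<le> K * \<bar>x - - b\<bar>" for x using K(2)[OF ends(3), of "- x"] by (simp add: abs_minus_commute add.commute)
  qed (use ends K x0 in auto)
  define S where "S = {x \<in> {a + \<rho>1..b - \<rho>2}. r \<le> \<bar>x - x0\<bar>}"
  have "S = {a + \<rho>1..b - \<rho>2} \<inter> {x. r \<le> \<bar>x - x0\<bar>}" by (auto simp: S_def)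
  moreover have "closed {x. r \<le> \<bar>x - x0\<bar>}" by (intro closed_Collect_le continuous_intros)
  ultimately have S: "compact S" by (simp add: compact_Int_closed)
  obtain m where m: "0 < m" "\<And>x. x \<in> S \<Longrightarrow> m \<le> gap u u x"
  proof (cases "S = {}")
    case False
    then obtain y where y: "y \<in> S" "\<And>x. x \<in> S \<Longrightarrow> gap u u y \<le> gap u u x"
      using continuous_attains_inf[OF S _ continuous_gap] by blast
    have "0 < gap u u y" using y(1) 1 2 r by (intro pos) (auto simp: S_def)
    then show thesis using y that by blast
  qed (use that[of 1] in auto)
  define c where "c = min (min c1 c2) (m / (b - a))"
  have c: "0 < c" using 1 2 m ends by (simp add: c_def)
  have cc: "c \<le> c1" "c \<le> c2" "c \<le> m / (b - a)" unfolding c_def by auto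
  show thesis
  proof (rule that[OF c])
    fix x assume x: "x \<in> {a..b}" "r \<le> \<bar>x - x0\<bar>"
    have mm: "0 \<le> min (x - a) (b - x)" "min (x - a) (b - x) \<le> x - a" "min (x - a) (b - x) \<le> b - x" "min (x - a) (b - x) \<le> b - a" using x by auto
    consider "x \<le> a + \<rho>1" | "b - \<rho>2 \<le> x" | "x \<in> S" using x by (fastforce simp: S_def)
    then show "c * min (x - a) (b - x) \<le> gap u u x"
    proof cases
      case 1
      then have "c1 * (x - a) \<le> gap u u x" using x \<open>\<And>x. x \<in> {a..a + \<rho>1} \<Longrightarrow> _\<close> by auto
      moreover have "c * min (x - a) (b - x) \<le> c1 * (x - a)" using cc mm c by (intro mult_mono) auto
      ultimately show ?thesis by linarith
    next
      case 2
      then have "c2 * (b - x) \<le> gap u u x" using x \<open>\<And>x. x \<in> {- b..- b + \<rho>2} \<Longrightarrow> _\<close>[of "- x"] by auto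
      moreover have "c * min (x - a) (b - x) \<le> c2 * (b - x)" using cc mm c by (intro mult_mono) auto
      ultimately show ?thesis by linarith
    next
      case 3
      have "c * min (x - a) (b - x) \<le> (m / (b - a)) * (b - a)" using cc mm c by (intro mult_mono) auto
      also have "\<dots> = m" using ends by simp
      finally show ?thesis using m(2)[OF 3] by linarith
    qed
  qed
qed

end

lemma strictly_below_nbhd:
  fixes f :: "real \<Rightarrow> real" and F :: "(real \<Rightarrow> real) set"
  assumes fin: "finite F" and cf: "continuous_on UNIV f" and cF: "\<And>h. h \<in> F \<Longrightarrow> continuous_on UNIV h"
    and x: "a < x" "x < b" "\<And>h. h \<in> F \<Longrightarrow> f x < h x"
  obtains e1 e2 t where "a < e1" "e1 < e2" "e2 < b" "0 < t" "\<And>y h. y \<in> {e1..e2} \<Longrightarrow> h \<in> F \<Longrightarrow> f y + t \<le> h y"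
proof -
  obtain t where t: "0 < t" "\<And>h. h \<in> F \<Longrightarrow> t \<le> h x - f x"
    by (rule finite_pos_lower_bound[OF fin, of "\<lambda>h. h x - f x"]) (use x in auto)
  define U where "U = {a<..<b} \<inter> (\<Inter>h\<in>F. {y. f y + t / 2 < h y})"
  have "open U"
    unfolding U_def using fin
    by (intro open_Int open_INT ballI open_Collect_less continuous_intros cf cF open_greaterThanLessThan) auto
  moreover have "x \<in> U" using t x by (force simp: U_def)
  ultimately obtain d where d: "0 < d" "cball x d \<subseteq> U" by (meson open_contains_cball)
  have U: "y \<in> U" if "y \<in> {x - d..x + d}" for y using d that by (auto simp: dist_real_def abs_le_iff)
  have "a < x - d" "x + d < b" using U[of "x - d"] U[of "x + d"] d by (auto simp: U_def)
  moreover have "f y + t / 2 \<le> h y" if "y \<in> {x - d..x + d}" "h \<in> F" for y h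
    using U[OF that(1)] that(2) by (auto simp: U_def less_imp_le)
  ultimately show thesis using that[of "x - d" "x + d" "t / 2"] d t by auto
qed

context sofa
begin

text \<open>
  The outer right wall of hallway \<open>j\<close> lies, by a margin \<open>t\<close>, below everything else that bounds the region
  from above; \<open>visible_L\<close> is the same for the left wall.
\<close>
definition visible_R :: "(nat \<Rightarrow> real) \<Rightarrow> nat \<Rightarrow> real \<Rightarrow> real \<Rightarrow> bool" where
  "visible_R u j t x \<longleftrightarrow> oR u j x + t \<le> 1 \<and> oR u j x + t \<le> W1 x \<and>
     (\<forall>m<k. m \<noteq> j \<longrightarrow> oR u j x + t \<le> oR u m x) \<and> (\<forall>m<k. oR u j x + t \<le> oL u m x)"
definition visible_L :: "(nat \<Rightarrow> real) \<Rightarrow> nat \<Rightarrow> real \<Rightarrow> real \<Rightarrow> bool" where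
  "visible_L u j t x \<longleftrightarrow> oL u j x + t \<le> 1 \<and> oL u j x + t \<le> W1 x \<and>
     (\<forall>m<k. oL u j x + t \<le> oR u m x) \<and> (\<forall>m<k. m \<noteq> j \<longrightarrow> oL u j x + t \<le> oL u m x)"

lemma continuous_pieces:
  "m < k \<Longrightarrow> continuous_on UNIV (oR u m)" "m < k \<Longrightarrow> continuous_on UNIV (oL u m)" "continuous_on UNIV W1"
  using si_pos[of m] co_pos[of m] sin_beta_pos
  unfolding oR_def[abs_def] oL_def[abs_def] W1_def[abs_def] by (auto intro!: continuous_intros)

lemma visible_R_nbhd:
  assumes "j < k" "a < x" "x < b" "oR u j x < 1" "oR u j x < W1 x" "\<And>m. m < k \<Longrightarrow> m \<noteq> j \<Longrightarrow> oR u j x < oR u m x"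
    "\<And>m. m < k \<Longrightarrow> oR u j x < oL u m x"
  obtains e1 e2 t where "a < e1" "e1 < e2" "e2 < b" "0 < t" "\<And>y. y \<in> {e1..e2} \<Longrightarrow> visible_R u j t y"
proof -
  let ?F = "{\<lambda>_. 1, W1} \<union> oR u ` ({..<k} - {j}) \<union> oL u ` ({..<k})"
  have fin: "finite ?F" by simp
  have cont: "continuous_on UNIV h" if "h \<in> ?F" for h using that by (auto intro: continuous_pieces)
  have less: "oR u j x < h x" if "h \<in> ?F" for h using that assms(4-) by auto
  obtain e1 e2 t where e: "a < e1" "e1 < e2" "e2 < b" "0 < t" and F: "\<And>y h. y \<in> {e1..e2} \<Longrightarrow> h \<in> ?F \<Longrightarrow> oR u j y + t \<le> h y"
  proof (rule strictly_below_nbhd[of ?F "oR u j" a x b])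
    show "continuous_on UNIV h" if "h \<in> ?F" for h by (rule cont[OF that])
    show "oR u j x < h x" if "h \<in> ?F" for h by (rule less[OF that])
  qed (assumption | rule fin assms(2,3) continuous_pieces(1)[OF assms(1)] that)+
  have "visible_R u j t y" if "y \<in> {e1..e2}" for y
    unfolding visible_R_def using F[OF that] by fastforce
  then show thesis using that e by blast
qed

lemma visible_L_nbhd:
  assumes "j < k" "a < x" "x < b" "oL u j x < 1" "oL u j x < W1 x" "\<And>m. m < k \<Longrightarrow> oL u j x < oR u m x"
    "\<And>m. m < k \<Longrightarrow> m \<noteq> j \<Longrightarrow> oL u j x < oL u m x"
  obtains e1 e2 t where "a < e1" "e1 < e2" "e2 < b" "0 < t" "\<And>y. y \<in> {e1..e2} \<Longrightarrow> visible_L u j t y"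
proof -
  let ?F = "{\<lambda>_. 1, W1} \<union> oR u ` ({..<k}) \<union> oL u ` ({..<k} - {j})"
  have fin: "finite ?F" by simp
  have cont: "continuous_on UNIV h" if "h \<in> ?F" for h using that by (auto intro: continuous_pieces)
  have less: "oL u j x < h x" if "h \<in> ?F" for h using that assms(4-) by auto
  obtain e1 e2 t where e: "a < e1" "e1 < e2" "e2 < b" "0 < t" and F: "\<And>y h. y \<in> {e1..e2} \<Longrightarrow> h \<in> ?F \<Longrightarrow> oL u j y + t \<le> h y"
  proof (rule strictly_below_nbhd[of ?F "oL u j" a x b])
    show "continuous_on UNIV h" if "h \<in> ?F" for h by (rule cont[OF that])
    show "oL u j x < h x" if "h \<in> ?F" for h by (rule less[OF that])
  qed (assumption | rule fin assms(2,3) continuous_pieces(2)[OF assms(1)] that)+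
  have "visible_L u j t y" if "y \<in> {e1..e2}" for y
    unfolding visible_L_def using F[OF that] by fastforce
  then show thesis using that e by blast
qed

text \<open>
  If every value of the upper boundary is attained by a line of slope other than that of \<open>l\<close>, then the
  distance of the boundary to \<open>l\<close> is at each point one of finitely many functions \<open>s * \<bar>x - y\<bar>\<close>,
  where \<open>y\<close> is the abscissa of the intersection of the two lines.
\<close>
lemma other_line_distance:
  assumes A: "finite A" and l: "l = (\<lambda>x. l0 + sl * x)"
    and ex: "\<And>x. a < x \<Longrightarrow> x < b \<Longrightarrow> \<exists>(p, q)\<in>A. up u x = p + q * x \<and> q \<noteq> sl"
    and le: "\<And>x. up u x \<le> l x"
  shows "\<exists>S. finite S \<and> (\<forall>x. a < x \<longrightarrow> x < b \<longrightarrow> (\<exists>(s, y)\<in>S. l x - up u x = s * \<bar>x - y\<bar>)) \<and> (\<forall>(s, y)\<in>S. (0::real) < s)"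
proof -
  define S where "S = (\<lambda>(p, q). (\<bar>sl - q\<bar>, (p - l0) / (sl - q))) ` {(p, q) \<in> A. q \<noteq> sl}"
  have "finite {(p, q) \<in> A. q \<noteq> sl}" by (rule finite_subset[OF _ A]) auto
  then have "finite S" by (simp add: S_def)
  moreover have "\<exists>(s, y)\<in>S. l x - up u x = s * \<bar>x - y\<bar>" if x: "a < x" "x < b" for x
  proof -
    obtain p q where pq: "(p, q) \<in> A" "up u x = p + q * x" "q \<noteq> sl" using ex[OF x] by auto
    have "l x - up u x = (l0 - p) + (sl - q) * x" using pq l by (simp add: algebra_simps)
    also have "\<dots> = (sl - q) * (x - (p - l0) / (sl - q))" using pq(3) by (simp add: field_simps)
    finally have e: "l x - up u x = (sl - q) * (x - (p - l0) / (sl - q))" .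
    have "l x - up u x = \<bar>l x - up u x\<bar>" using le[of x] by simp
    also have "\<dots> = \<bar>sl - q\<bar> * \<bar>x - (p - l0) / (sl - q)\<bar>" unfolding e abs_mult ..
    finally have "l x - up u x = \<bar>sl - q\<bar> * \<bar>x - (p - l0) / (sl - q)\<bar>" .
    moreover have "(\<bar>sl - q\<bar>, (p - l0) / (sl - q)) \<in> S" using pq by (auto simp: S_def intro!: image_eqI[of _ _ "(p, q)"])
    ultimately show ?thesis by blast
  qed
  moreover have "\<forall>(s, y)\<in>S. 0 < s" by (auto simp: S_def)
  ultimately show ?thesis by blast
qed

text \<open>
  Otherwise lowering the right arm of hallway \<open>j\<close> by \<open>e\<close> costs only area of order \<open>e\<^sup>2\<close>, because the
  outer wall meets the upper boundary at isolated points only. The inner wall sinks along with it, and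
  it is the lower boundary immediately to the right of the pinch: among the touching corners, that of
  largest angle has the flattest right wall. This is a gain of first order.
\<close>
lemma outer_right_visible:
  assumes opt: "optimal u a b" and x0: "a < x0" "x0 < b" "gap u u x0 = 0"
    and j: "j \<in> touching u x0" "\<And>m. m \<in> touching u x0 \<Longrightarrow> m \<le> j"
  obtains e1 e2 t where "a < e1" "e1 < e2" "e2 < b" "0 < t" "\<And>y. y \<in> {e1..e2} \<Longrightarrow> visible_R u j t y"
proof (rule ccontr)
  assume no: "\<not> thesis"
  note found = that
  note ends = optimal_ends[OF opt]
  note ap = touching_apex[OF opt x0(1,2) j(1)]
  have jk: "j < k" by (rule ap(1))
  have covered: "\<exists>(p, q)\<in>upper_lines u. up u x = p + q * x \<and> q \<noteq> - ct j" if x: "a < x" "x < b" for x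
  proof -
    have "\<not> (oR u j x < 1 \<and> oR u j x < W1 x \<and> (\<forall>m<k. m \<noteq> j \<longrightarrow> oR u j x < oR u m x) \<and> (\<forall>m<k. oR u j x < oL u m x))"
    proof
      assume low: "oR u j x < 1 \<and> oR u j x < W1 x \<and> (\<forall>m<k. m \<noteq> j \<longrightarrow> oR u j x < oR u m x) \<and> (\<forall>m<k. oR u j x < oL u m x)"
      obtain e1 e2 t where "a < e1" "e1 < e2" "e2 < b" "0 < t" "\<And>y. y \<in> {e1..e2} \<Longrightarrow> visible_R u j t y"
        by (rule visible_R_nbhd[OF jk x, of u]) (use low in auto)
      then have thesis by (rule found)
      with no show False ..
    qed
    then consider "1 \<le> oR u j x" | "W1 x \<le> oR u j x" | m where "m < k" "m \<noteq> j" "oR u m x \<le> oR u j x" | m where "m < k" "oL u m x \<le> oR u j x"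
      by (meson not_le)
    note cov = this
    have q1: "(1, 0) \<in> upper_lines u" "0 \<noteq> - ct j" using ct_pos[OF jk] by (auto simp: upper_lines_def)
    have b1: "cos \<beta>1 / sin \<beta>1 < ct j" "cos \<beta>2 / sin \<beta>2 < ct j" using cot_beta1_less[OF jk] cot_beta_le by auto
    have qW: "\<exists>(p, q)\<in>upper_lines u. W1 x = p + q * x \<and> q \<noteq> - ct j"
      using W1_line[of x] b1 by (fastforce simp: upper_lines_def)
    have qR: "\<exists>(p, q)\<in>upper_lines u. oR u m x = p + q * x \<and> q \<noteq> - ct j" if "m < k" "m \<noteq> j" for m
    proof -
      have "ct m \<noteq> ct j" using ct_less[of m j] ct_less[of j m] that jk by (cases m j rule: linorder_cases) auto
      then show ?thesis using oR_line[OF that(1), of u x] that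
        by (intro bexI[of _ "(oR u m 0, - ct m)"]) (auto simp: upper_lines_def)
    qed
    have qL: "\<exists>(p, q)\<in>upper_lines u. oL u m x = p + q * x \<and> q \<noteq> - ct j" if "m < k" for m
      using oL_line[OF that, of u x] that tn_pos[OF that] ct_pos[OF jk]
      by (intro bexI[of _ "(oL u m 0, tn m)"]) (auto simp: upper_lines_def)
    show ?thesis
    proof (cases rule: up_cases[of u x])
      case 1 then show ?thesis using q1 by (intro bexI[of _ "(1, 0)"]) auto
    next
      case 2 then show ?thesis using qW by simp
    next
      case (3 m)
      show ?thesis
      proof (cases "m = j")
        case False then show ?thesis using 3 qR[of m] by simp
      next
        case True
        from cov show ?thesis
        proof cases
          case c: 1
          then have "up u x = 1" using 3 True up_le(1)[of u x] by simp
          then show ?thesis using q1 by (intro bexI[of _ "(1, 0)"]) auto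
        next
          case c: 2
          then have "up u x = W1 x" using 3 True up_le(2)[of u x] by simp
          then show ?thesis using qW by simp
        next
          case c: (3 n)
          then have "up u x = oR u n x" using 3 True up_le(3)[of n u x] by simp
          then show ?thesis using qR[of n] c by simp
        next
          case c: (4 n)
          then have "up u x = oL u n x" using 3 True up_le(4)[of n u x] by simp
          then show ?thesis using qL[of n] c by simp
        qed
      qed
    next
      case (4 m) then show ?thesis using qL[of m] by simp
    qed
  qed
  define v where "v e = u(2 * j := u (2 * j) - e)" for e
  have "2 * m + 1 \<noteq> 2 * j" for m by presburger
  then have v: "v e (2 * m) = (if m = j then u (2 * j) - e else u (2 * m))" "v e (2 * m + 1) = u (2 * m + 1)" for e m
    by (auto simp: v_def)
  have vo: "oR (v e) m x = (if m = j then oR u j x - e / si j else oR u m x)" "oL (v e) m x = oL u m x"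
    "iR (v e) m x = (if m = j then iR u j x - e / si j else iR u m x)" "iL (v e) m x = iL u m x" if "m < k" for e m x
    using oR_change[OF that, of "v e" x u] iR_change[OF that, of "v e" x u] v[of e m] by (auto simp: oL_def iL_def)
  have lov: "lo (v e) x \<le> lo u x" if "0 \<le> e" for e x
    using that by (intro lo_mono) (auto simp: v_def)
  have vnear: "near e (v e) u" if "0 \<le> e" for e using that by (simp add: near_def v_def)
  obtain r \<eta> where n: "0 < r" "0 < \<eta>" "a < x0 - r" "x0 + r < b"
    "\<And>z x. near r z u \<Longrightarrow> \<bar>x - x0\<bar> \<le> r \<Longrightarrow> up z x = 1"
    "\<And>z x m. near r z u \<Longrightarrow> \<bar>x - x0\<bar> \<le> r \<Longrightarrow> m < k \<Longrightarrow> 1 + \<eta> \<le> oR z m x \<and> 1 + \<eta> \<le> oL z m x"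
    "\<And>z x m. near r z u \<Longrightarrow> \<bar>x - x0\<bar> \<le> r \<Longrightarrow> m < k \<Longrightarrow> m \<notin> touching u x0 \<Longrightarrow> min (iR z m x) (iL z m x) \<le> 1 - \<eta>"
    "\<And>x. \<bar>x - x0\<bar> \<le> r \<Longrightarrow> W0 x \<le> 1 - \<eta>" "\<And>x. \<bar>x - x0\<bar> \<le> r \<Longrightarrow> 1 \<le> W1 x" "\<eta> < 1"
    by (rule pinch_neighbourhood[OF opt x0], rule that) assumption+
  have pos: "0 < gap u u x" if "a < x" "x < b" "x \<noteq> x0" for x
  proof -
    have "0 \<le> gap u u x" using that by (intro feasible_nonneg[OF opt]) auto
    moreover have "gap u u x \<noteq> 0" using pinch_unique[OF opt x0 that(1,2)] that(3) by auto
    ultimately show ?thesis by simp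
  qed
  obtain c0 where c0: "0 < c0" "\<And>x. x \<in> {a..b} \<Longrightarrow> r \<le> \<bar>x - x0\<bar> \<Longrightarrow> c0 * min (x - a) (b - x) \<le> gap u u x"
    by (rule optimal_growth[OF opt pos x0(1,2) n(1)]) (assumption | rule that)+
  obtain K where K: "0 < K" "\<And>u x0 x. gap u u x0 = 0 \<Longrightarrow> gap u u x \<le> K * \<bar>x - x0\<bar>"
    using gap_bound_at_zero by metis
  obtain K2 where K2: "0 < K2"
    "\<And>d p q p' q' x x'. near d p p' \<Longrightarrow> near d q q' \<Longrightarrow> \<bar>x - x'\<bar> \<le> d \<Longrightarrow> \<bar>lo p x - lo p' x'\<bar> \<le> K2 * d"
    using gap_lipschitz by metis
  have fl: "finite (upper_lines u)" by (auto simp: upper_lines_def)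
  have lin: "oR u j = (\<lambda>x. oR u j 0 + - ct j * x)" by (rule ext) (rule oR_line[OF jk])
  have "\<exists>S. finite S \<and> (\<forall>x. a < x \<longrightarrow> x < b \<longrightarrow> (\<exists>(s, y)\<in>S. oR u j x - up u x = s * \<bar>x - y\<bar>)) \<and> (\<forall>(s, y)\<in>S. 0 < s)"
    by (rule other_line_distance[OF fl lin covered up_le(3)[OF jk]])
  then obtain S where S: "finite S" "\<And>x. a < x \<Longrightarrow> x < b \<Longrightarrow> \<exists>(s, y)\<in>S. oR u j x - up u x = s * \<bar>x - y\<bar>" "\<And>s y. (s, y) \<in> S \<Longrightarrow> 0 < s"
    by blast+
  have c: "0 < 1 / si j" using si_pos[OF jk] by simp
  obtain \<gamma> where gm: "0 < \<gamma>" "\<And>m. m \<in> {..<j} \<Longrightarrow> \<gamma> \<le> ct m - ct j"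
    by (rule finite_pos_lower_bound[of "{..<j}" "\<lambda>m. ct m - ct j"]) (use ct_less jk in auto)
  define \<rho> where "\<rho> = min r (\<eta> / (2 * K2))"
  have rho: "0 < \<rho>" "\<rho> \<le> r" using n K2(1) by (auto simp: \<rho>_def)
  have "\<rho> \<le> \<eta> / (2 * K2)" unfolding \<rho>_def by (rule min.cobounded2)
  then have Krho: "K2 * \<rho> \<le> \<eta> / 2" using K2(1) by (simp add: field_simps)
  have lo1: "1 - \<eta> / 2 \<le> lo u x" if "\<bar>x - x0\<bar> \<le> \<rho>" for x
    using K2(2)[of \<rho> u u u u x x0] that pinch_top(2)[OF opt x0] Krho by (simp add: near_refl abs_le_iff)
  have ps: "0 < \<eta> / 2" "0 < \<gamma> * (\<rho> / 2)" using n(2) gm(1) rho(1) by auto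
  have "\<forall>\<^sub>F e in at_right 0. \<exists>A B. A \<le> B \<and> (\<forall>x\<in>{A..B}. 0 \<le> gap (v e) (v e) x) \<and> integral {a..b} (gap u u) < integral {A..B} (gap (v e) (v e))"
  proof (rule small_loss[OF continuous_gap _ ends(1) c0(1) c c less_imp_le[OF K(1)] c0(2) _ K(2)[OF ends(2)] K(2)[OF ends(3)] _ _ S, where h = "\<lambda>e. gap (v e) (v e)" and ?e1.0 = "x0 + \<rho> / 2" and ?e2.0 = "x0 + \<rho>"])
    show "\<forall>\<^sub>F e in at_right 0. \<forall>x\<in>{a..b}. gap u u x - max 0 (1 / si j * e - (oR u j x - up u x)) \<le> gap (v e) (v e) x"
      using eventually_right_pos
    proof eventually_elim
      case (elim e)
      have "up u x - max 0 (1 / si j * e - (oR u j x - up u x)) \<le> up (v e) x" for x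
        unfolding up_ge_iff
      proof (intro conjI allI impI)
        fix m assume m: "m < k"
        show "up u x - max 0 (1 / si j * e - (oR u j x - up u x)) \<le> oR (v e) m x"
          using up_le(3)[OF m, of u x] vo(1)[OF m, of e x] by auto
        show "up u x - max 0 (1 / si j * e - (oR u j x - up u x)) \<le> oL (v e) m x"
          using up_le(4)[OF m, of u x] vo(2)[OF m, of e x] by auto
      qed (use up_le(1,2)[of u x] in auto)
      then show ?case using lov[of e] elim unfolding gap_def by (smt (verit))
    qed
    show "\<forall>\<^sub>F e in at_right 0. \<forall>x\<in>{a..b}. \<bar>x - x0\<bar> \<le> r \<longrightarrow> gap u u x \<le> gap (v e) (v e) x"
      using eventually_right_pos eventually_small[OF n(1), of 1]
    proof eventually_elim
      case (elim e)
      have "near r (v e) u" using vnear[of e] elim by (auto simp: near_def intro: order_trans)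
      then show ?case using n(5)[of "v e"] up_le(1)[of u] lov[of e] elim unfolding gap_def by (auto intro!: diff_mono)
    qed
    show "\<forall>\<^sub>F e in at_right 0. \<forall>x\<in>{x0 + \<rho> / 2..x0 + \<rho>}. gap u u x + 1 / si j * e \<le> gap (v e) (v e) x"
      using eventually_right_pos eventually_small[OF n(1), of 1] eventually_small[OF ps(1), of "1 / si j"] eventually_small[OF ps(2), of "1 / si j"]
    proof eventually_elim
      case (elim e)
      have nr: "near r (v e) u" using vnear[of e] elim by (auto simp: near_def intro: order_trans)
      show ?case
      proof
        fix x assume x: "x \<in> {x0 + \<rho> / 2..x0 + \<rho>}"
        have xr: "\<bar>x - x0\<bar> \<le> \<rho>" "\<bar>x - x0\<bar> \<le> r" "\<rho> / 2 \<le> x - x0" using x rho by auto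
        have iRlo: "iR u j x \<le> lo u x"
        proof -
          have "iR u j x \<le> iL u j x" using ap(4,5)[of x] xr(3) rho(1) tn_pos[OF jk] ct_pos[OF jk]
              mult_nonneg_nonneg[of "x - x0" "tn j"] mult_nonneg_nonneg[of "x - x0" "ct j"] by linarith
          then show ?thesis using lo_ge(3)[OF jk, of u x] by linarith
        qed
        have "lo (v e) x \<le> lo u x - 1 / si j * e"
          unfolding lo_le_iff
        proof (intro conjI allI impI)
          show "0 \<le> lo u x - 1 / si j * e" using lo1[OF xr(1)] elim n by linarith
          show "W0 x \<le> lo u x - 1 / si j * e" using lo1[OF xr(1)] elim n(8)[OF xr(2)] by linarith
          fix m assume m: "m < k"
          show "min (iR (v e) m x) (iL (v e) m x) \<le> lo u x - 1 / si j * e"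
          proof (cases "m \<in> touching u x0")
            case False
            then show ?thesis using n(7)[OF nr xr(2) m] lo1[OF xr(1)] elim by linarith
          next
            case True
            show ?thesis
            proof (cases "m = j")
              case True
              then show ?thesis using iRlo vo(3)[OF m, of e x] by auto
            next
              case False
              then have mj: "m < j" using j(2)[OF True] by simp
              have "\<gamma> * (\<rho> / 2) \<le> (ct m - ct j) * (x - x0)" using gm(1) gm(2)[of m] mj xr(3) rho(1) by (intro mult_mono) auto
              moreover have "iR u m x = iR u j x - (ct m - ct j) * (x - x0)"
                using touching_apex(4)[OF opt x0(1,2) True, of x] ap(4)[of x] by (simp add: algebra_simps)
              ultimately have "iR u m x \<le> iR u j x - \<gamma> * (\<rho> / 2)" by linarith
              then have "iR u m x \<le> lo u x - 1 / si j * e" using iRlo elim(4) by linarith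
              moreover have "iR (v e) m x = iR u m x" using vo(3)[OF m, of e x] False by simp
              ultimately show ?thesis by (simp only: min_le_iff_disj simp_thms)
            qed
          qed
        qed
        moreover have "up u x \<le> up (v e) x" using n(5)[OF nr xr(2)] up_le(1)[of u x] by simp
        ultimately show "gap u u x + 1 / si j * e \<le> gap (v e) (v e) x" by (simp add: gap_def)
      qed
    qed
    show "0 \<le> gap u u x" if "x \<in> {a..b}" for x using that by (rule feasible_nonneg[OF opt])
    show "continuous_on UNIV (gap (v e) (v e))" for e by (rule continuous_gap)
  qed (use rho n x0 in auto)
  then have "\<forall>\<^sub>F e in at_right (0::real). False"
  proof eventually_elim
    case (elim e)
    then obtain A B where "feasible (v e) (v e) A B" "area u u a b < area (v e) (v e) A B"
      by (auto simp: feasible_def area_def)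
    then show False using opt by (auto simp: optimal_def not_less[symmetric])
  qed
  then show False by (simp add: trivial_limit_at_right_real)
qed

text \<open>
  As for right walls. The lower boundary immediately to the left of the pinch is the left inner wall of
  the touching corner of smallest angle.
\<close>
lemma outer_left_visible:
  assumes opt: "optimal u a b" and x0: "a < x0" "x0 < b" "gap u u x0 = 0"
    and j: "j \<in> touching u x0" "\<And>m. m \<in> touching u x0 \<Longrightarrow> j \<le> m"
  obtains e1 e2 t where "a < e1" "e1 < e2" "e2 < b" "0 < t" "\<And>y. y \<in> {e1..e2} \<Longrightarrow> visible_L u j t y"
proof (rule ccontr)
  assume no: "\<not> thesis"
  note found = that
  note ends = optimal_ends[OF opt]
  note ap = touching_apex[OF opt x0(1,2) j(1)]
  have jk: "j < k" by (rule ap(1))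
  have covered: "\<exists>(p, q)\<in>upper_lines u. up u x = p + q * x \<and> q \<noteq> tn j" if x: "a < x" "x < b" for x
  proof -
    have "\<not> (oL u j x < 1 \<and> oL u j x < W1 x \<and> (\<forall>m<k. oL u j x < oR u m x) \<and> (\<forall>m<k. m \<noteq> j \<longrightarrow> oL u j x < oL u m x))"
    proof
      assume low: "oL u j x < 1 \<and> oL u j x < W1 x \<and> (\<forall>m<k. oL u j x < oR u m x) \<and> (\<forall>m<k. m \<noteq> j \<longrightarrow> oL u j x < oL u m x)"
      obtain e1 e2 t where "a < e1" "e1 < e2" "e2 < b" "0 < t" "\<And>y. y \<in> {e1..e2} \<Longrightarrow> visible_L u j t y"
        by (rule visible_L_nbhd[OF jk x, of u]) (use low in auto)
      then have thesis by (rule found)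
      with no show False ..
    qed
    then consider "1 \<le> oL u j x" | "W1 x \<le> oL u j x" | m where "m < k" "oR u m x \<le> oL u j x" | m where "m < k" "m \<noteq> j" "oL u m x \<le> oL u j x"
      by (meson not_le)
    note cov = this
    have q1: "(1, 0) \<in> upper_lines u" "0 \<noteq> tn j" using tn_pos[OF jk] by (auto simp: upper_lines_def)
    have b1: "- (cos \<beta>1 / sin \<beta>1) \<noteq> tn j" "- (cos \<beta>2 / sin \<beta>2) \<noteq> tn j"
      using cos_beta_nonneg sin_beta_pos tn_pos[OF jk] divide_nonneg_pos[OF cos_beta_nonneg(1) sin_beta_pos(1)]
        divide_nonneg_pos[OF cos_beta_nonneg(2) sin_beta_pos(2)] by linarith+
    have qW: "\<exists>(p, q)\<in>upper_lines u. W1 x = p + q * x \<and> q \<noteq> tn j"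
      using W1_line[of x] b1 by (fastforce simp: upper_lines_def)
    have qR: "\<exists>(p, q)\<in>upper_lines u. oR u m x = p + q * x \<and> q \<noteq> tn j" if "m < k" for m
    proof -
      have "- ct m \<noteq> tn j" using ct_pos[OF that] tn_pos[OF jk] by linarith
      then show ?thesis using oR_line[OF that, of u x] that
        by (intro bexI[of _ "(oR u m 0, - ct m)"]) (auto simp: upper_lines_def)
    qed
    have qL: "\<exists>(p, q)\<in>upper_lines u. oL u m x = p + q * x \<and> q \<noteq> tn j" if "m < k" "m \<noteq> j" for m
    proof -
      have "tn m \<noteq> tn j" using tn_less[of m j] tn_less[of j m] that jk by (cases m j rule: linorder_cases) auto
      then show ?thesis using oL_line[OF that(1), of u x] that
        by (intro bexI[of _ "(oL u m 0, tn m)"]) (auto simp: upper_lines_def)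
    qed
    show ?thesis
    proof (cases rule: up_cases[of u x])
      case 1 then show ?thesis using q1 by (intro bexI[of _ "(1, 0)"]) auto
    next
      case 2 then show ?thesis using qW by simp
    next
      case (4 m)
      show ?thesis
      proof (cases "m = j")
        case False then show ?thesis using 4 qL[of m] by simp
      next
        case True
        from cov show ?thesis
        proof cases
          case c: 1
          then have "up u x = 1" using 4 True up_le(1)[of u x] by simp
          then show ?thesis using q1 by (intro bexI[of _ "(1, 0)"]) auto
        next
          case c: 2
          then have "up u x = W1 x" using 4 True up_le(2)[of u x] by simp
          then show ?thesis using qW by simp
        next
          case c: (3 n)
          then have "up u x = oR u n x" using 4 True up_le(3)[of n u x] by simp
          then show ?thesis using qR[of n] c by simp
        next
          case c: (4 n)
          then have "up u x = oL u n x" using 4 True up_le(4)[of n u x] by simp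
          then show ?thesis using qL[of n] c by simp
        qed
      qed
    next
      case (3 m) then show ?thesis using qR[of m] by simp
    qed
  qed
  define v where "v e = u(2 * j + 1 := u (2 * j + 1) - e)" for e
  have "2 * m \<noteq> 2 * j + 1" for m by presburger
  then have v: "v e (2 * m + 1) = (if m = j then u (2 * j + 1) - e else u (2 * m + 1))" "v e (2 * m) = u (2 * m)" for e m
    by (auto simp: v_def)
  have vo: "oL (v e) m x = (if m = j then oL u j x - e / co j else oL u m x)" "oR (v e) m x = oR u m x"
    "iL (v e) m x = (if m = j then iL u j x - e / co j else iL u m x)" "iR (v e) m x = iR u m x" if "m < k" for e m x
    using oL_change[OF that, of "v e" x u] iL_change[OF that, of "v e" x u] v[of e m] by (auto simp: oR_def iR_def)
  have lov: "lo (v e) x \<le> lo u x" if "0 \<le> e" for e x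
    using that by (intro lo_mono) (auto simp: v_def)
  have vnear: "near e (v e) u" if "0 \<le> e" for e using that by (simp add: near_def v_def)
  obtain r \<eta> where n: "0 < r" "0 < \<eta>" "a < x0 - r" "x0 + r < b"
    "\<And>z x. near r z u \<Longrightarrow> \<bar>x - x0\<bar> \<le> r \<Longrightarrow> up z x = 1"
    "\<And>z x m. near r z u \<Longrightarrow> \<bar>x - x0\<bar> \<le> r \<Longrightarrow> m < k \<Longrightarrow> 1 + \<eta> \<le> oR z m x \<and> 1 + \<eta> \<le> oL z m x"
    "\<And>z x m. near r z u \<Longrightarrow> \<bar>x - x0\<bar> \<le> r \<Longrightarrow> m < k \<Longrightarrow> m \<notin> touching u x0 \<Longrightarrow> min (iR z m x) (iL z m x) \<le> 1 - \<eta>"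
    "\<And>x. \<bar>x - x0\<bar> \<le> r \<Longrightarrow> W0 x \<le> 1 - \<eta>" "\<And>x. \<bar>x - x0\<bar> \<le> r \<Longrightarrow> 1 \<le> W1 x" "\<eta> < 1"
    by (rule pinch_neighbourhood[OF opt x0], rule that) assumption+
  have pos: "0 < gap u u x" if "a < x" "x < b" "x \<noteq> x0" for x
  proof -
    have "0 \<le> gap u u x" using that by (intro feasible_nonneg[OF opt]) auto
    moreover have "gap u u x \<noteq> 0" using pinch_unique[OF opt x0 that(1,2)] that(3) by auto
    ultimately show ?thesis by simp
  qed
  obtain c0 where c0: "0 < c0" "\<And>x. x \<in> {a..b} \<Longrightarrow> r \<le> \<bar>x - x0\<bar> \<Longrightarrow> c0 * min (x - a) (b - x) \<le> gap u u x"
    by (rule optimal_growth[OF opt pos x0(1,2) n(1)]) (assumption | rule that)+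
  obtain K where K: "0 < K" "\<And>u x0 x. gap u u x0 = 0 \<Longrightarrow> gap u u x \<le> K * \<bar>x - x0\<bar>"
    using gap_bound_at_zero by metis
  obtain K2 where K2: "0 < K2"
    "\<And>d p q p' q' x x'. near d p p' \<Longrightarrow> near d q q' \<Longrightarrow> \<bar>x - x'\<bar> \<le> d \<Longrightarrow> \<bar>lo p x - lo p' x'\<bar> \<le> K2 * d"
    using gap_lipschitz by metis
  have fl: "finite (upper_lines u)" by (auto simp: upper_lines_def)
  have lin: "oL u j = (\<lambda>x. oL u j 0 + tn j * x)" by (rule ext) (rule oL_line[OF jk])
  have "\<exists>S. finite S \<and> (\<forall>x. a < x \<longrightarrow> x < b \<longrightarrow> (\<exists>(s, y)\<in>S. oL u j x - up u x = s * \<bar>x - y\<bar>)) \<and> (\<forall>(s, y)\<in>S. 0 < s)"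
    by (rule other_line_distance[OF fl lin covered up_le(4)[OF jk]])
  then obtain S where S: "finite S" "\<And>x. a < x \<Longrightarrow> x < b \<Longrightarrow> \<exists>(s, y)\<in>S. oL u j x - up u x = s * \<bar>x - y\<bar>" "\<And>s y. (s, y) \<in> S \<Longrightarrow> 0 < s"
    by blast+
  have c: "0 < 1 / co j" using co_pos[OF jk] by simp
  obtain \<gamma> where gm: "0 < \<gamma>" "\<And>m. m \<in> {j<..<k} \<Longrightarrow> \<gamma> \<le> tn m - tn j"
    by (rule finite_pos_lower_bound[of "{j<..<k}" "\<lambda>m. tn m - tn j"]) (use tn_less jk in auto)
  define \<rho> where "\<rho> = min r (\<eta> / (2 * K2))"
  have rho: "0 < \<rho>" "\<rho> \<le> r" using n K2(1) by (auto simp: \<rho>_def)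
  have "\<rho> \<le> \<eta> / (2 * K2)" unfolding \<rho>_def by (rule min.cobounded2)
  then have Krho: "K2 * \<rho> \<le> \<eta> / 2" using K2(1) by (simp add: field_simps)
  have lo1: "1 - \<eta> / 2 \<le> lo u x" if "\<bar>x - x0\<bar> \<le> \<rho>" for x
    using K2(2)[of \<rho> u u u u x x0] that pinch_top(2)[OF opt x0] Krho by (simp add: near_refl abs_le_iff)
  have ps: "0 < \<eta> / 2" "0 < \<gamma> * (\<rho> / 2)" using n(2) gm(1) rho(1) by auto
  have "\<forall>\<^sub>F e in at_right 0. \<exists>A B. A \<le> B \<and> (\<forall>x\<in>{A..B}. 0 \<le> gap (v e) (v e) x) \<and> integral {a..b} (gap u u) < integral {A..B} (gap (v e) (v e))"
  proof (rule small_loss[OF continuous_gap _ ends(1) c0(1) c c less_imp_le[OF K(1)] c0(2) _ K(2)[OF ends(2)] K(2)[OF ends(3)] _ _ S, where h = "\<lambda>e. gap (v e) (v e)" and ?e1.0 = "x0 - \<rho>" and ?e2.0 = "x0 - \<rho> / 2"])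
    show "\<forall>\<^sub>F e in at_right 0. \<forall>x\<in>{a..b}. gap u u x - max 0 (1 / co j * e - (oL u j x - up u x)) \<le> gap (v e) (v e) x"
      using eventually_right_pos
    proof eventually_elim
      case (elim e)
      have "up u x - max 0 (1 / co j * e - (oL u j x - up u x)) \<le> up (v e) x" for x
        unfolding up_ge_iff
      proof (intro conjI allI impI)
        fix m assume m: "m < k"
        show "up u x - max 0 (1 / co j * e - (oL u j x - up u x)) \<le> oL (v e) m x"
          using up_le(4)[OF m, of u x] vo(1)[OF m, of e x] by auto
        show "up u x - max 0 (1 / co j * e - (oL u j x - up u x)) \<le> oR (v e) m x"
          using up_le(3)[OF m, of u x] vo(2)[OF m, of e x] by auto
      qed (use up_le(1,2)[of u x] in auto)
      then show ?case using lov[of e] elim unfolding gap_def by (smt (verit))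
    qed
    show "\<forall>\<^sub>F e in at_right 0. \<forall>x\<in>{a..b}. \<bar>x - x0\<bar> \<le> r \<longrightarrow> gap u u x \<le> gap (v e) (v e) x"
      using eventually_right_pos eventually_small[OF n(1), of 1]
    proof eventually_elim
      case (elim e)
      have "near r (v e) u" using vnear[of e] elim by (auto simp: near_def intro: order_trans)
      then show ?case using n(5)[of "v e"] up_le(1)[of u] lov[of e] elim unfolding gap_def by (auto intro!: diff_mono)
    qed
    show "\<forall>\<^sub>F e in at_right 0. \<forall>x\<in>{x0 - \<rho>..x0 - \<rho> / 2}. gap u u x + 1 / co j * e \<le> gap (v e) (v e) x"
      using eventually_right_pos eventually_small[OF n(1), of 1] eventually_small[OF ps(1), of "1 / co j"] eventually_small[OF ps(2), of "1 / co j"]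
    proof eventually_elim
      case (elim e)
      have nr: "near r (v e) u" using vnear[of e] elim by (auto simp: near_def intro: order_trans)
      show ?case
      proof
        fix x assume x: "x \<in> {x0 - \<rho>..x0 - \<rho> / 2}"
        have xr: "\<bar>x - x0\<bar> \<le> \<rho>" "\<bar>x - x0\<bar> \<le> r" "\<rho> / 2 \<le> x0 - x" using x rho by auto
        have iLlo: "iL u j x \<le> lo u x"
        proof -
          have "iL u j x \<le> iR u j x" using ap(4,5)[of x] xr(3) rho(1) tn_pos[OF jk] ct_pos[OF jk]
              mult_nonpos_nonneg[of "x - x0" "tn j"] mult_nonpos_nonneg[of "x - x0" "ct j"] by linarith
          then show ?thesis using lo_ge(3)[OF jk, of u x] by linarith
        qed
        have "lo (v e) x \<le> lo u x - 1 / co j * e"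
          unfolding lo_le_iff
        proof (intro conjI allI impI)
          show "0 \<le> lo u x - 1 / co j * e" using lo1[OF xr(1)] elim n by linarith
          show "W0 x \<le> lo u x - 1 / co j * e" using lo1[OF xr(1)] elim n(8)[OF xr(2)] by linarith
          fix m assume m: "m < k"
          show "min (iR (v e) m x) (iL (v e) m x) \<le> lo u x - 1 / co j * e"
          proof (cases "m \<in> touching u x0")
            case False
            then show ?thesis using n(7)[OF nr xr(2) m] lo1[OF xr(1)] elim by linarith
          next
            case True
            show ?thesis
            proof (cases "m = j")
              case True
              then show ?thesis using iLlo vo(3)[OF m, of e x] by auto
            next
              case False
              then have mj: "j < m" using j(2)[OF True] by simp
              have "\<gamma> * (\<rho> / 2) \<le> (tn m - tn j) * (x0 - x)" using gm(1) gm(2)[of m] mj m xr(3) rho(1) by (intro mult_mono) auto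
              moreover have "iL u m x = iL u j x - (tn m - tn j) * (x0 - x)"
                using touching_apex(5)[OF opt x0(1,2) True, of x] ap(5)[of x] by (simp add: algebra_simps diff_divide_distrib)
              ultimately have "iL u m x \<le> iL u j x - \<gamma> * (\<rho> / 2)" by linarith
              then have "iL u m x \<le> lo u x - 1 / co j * e" using iLlo elim(4) by linarith
              moreover have "iL (v e) m x = iL u m x" using vo(3)[OF m, of e x] False by simp
              ultimately show ?thesis by (simp only: min_le_iff_disj simp_thms)
            qed
          qed
        qed
        moreover have "up u x \<le> up (v e) x" using n(5)[OF nr xr(2)] up_le(1)[of u x] by simp
        ultimately show "gap u u x + 1 / co j * e \<le> gap (v e) (v e) x" by (simp add: gap_def)
      qed
    qed
    show "0 \<le> gap u u x" if "x \<in> {a..b}" for x using that by (rule feasible_nonneg[OF opt])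
    show "continuous_on UNIV (gap (v e) (v e))" for e by (rule continuous_gap)
  qed (use rho n x0 in auto)
  then have "\<forall>\<^sub>F e in at_right (0::real). False"
  proof eventually_elim
    case (elim e)
    then obtain A B where "feasible (v e) (v e) A B" "area u u a b < area (v e) (v e) A B"
      by (auto simp: feasible_def area_def)
    then show False using opt by (auto simp: optimal_def not_less[symmetric])
  qed
  then show False by (simp add: trivial_limit_at_right_real)
qed

end

context sofa
begin

section \<open>Optimal components and nearby positions\<close>

text \<open>
  Of the touching hallways, the one of largest angle has a visible right outer wall. To be visible it must
  have fallen below the line \<open>y = 1\<close>, at a horizontal distance of more than \<open>1 / co j\<close> from the common
  apex; but by then it is above the right outer wall of any touching hallway of smaller angle, which
  falls more steeply.
\<close>
lemma touching_single:
  assumes opt: "optimal u a b" and x0: "a < x0" "x0 < b" "gap u u x0 = 0"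
  obtains j where "touching u x0 = {j}"
proof -
  define j where "j = Max (touching u x0)"
  have ne: "touching u x0 \<noteq> {}" by (rule touching_nonempty[OF opt x0])
  have j: "j \<in> touching u x0" "\<And>m. m \<in> touching u x0 \<Longrightarrow> m \<le> j"
    using ne touching_finite[of u x0] by (auto simp: j_def)
  note ap = touching_apex[OF opt x0(1,2) j(1)]
  obtain e1 e2 t where e: "a < e1" "e1 < e2" "e2 < b" "0 < t" "\<And>y. y \<in> {e1..e2} \<Longrightarrow> visible_R u j t y"
    by (rule outer_right_visible[OF opt x0 j]) (assumption | rule that)+
  have vis: "visible_R u j t e1" using e by simp
  have "m = j" if m: "m \<in> touching u x0" for m
  proof (rule ccontr)
    assume "m \<noteq> j"
    then have mj: "m < j" using j(2)[OF m] by simp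
    note apm = touching_apex[OF opt x0(1,2) m]
    define X where "X = e1 - x0"
    have s: "0 < si j" "0 < co j" "0 < si m" "0 < co m" using si_pos co_pos ap(1) apm(1) by auto
    have jx: "oR u j e1 = 1 / si j + 1 - X * ct j" "oR u m e1 = 1 / si m + 1 - X * ct m"
      using iR_oR[OF ap(1), of u e1] ap(4)[of e1] iR_oR[OF apm(1), of u e1] apm(4)[of e1] by (simp_all add: X_def)
    have "oR u j e1 < 1" "oR u j e1 < oR u m e1"
      using vis e(4) \<open>m \<noteq> j\<close> apm(1) unfolding visible_R_def by force+
    then have "1 / si j < X * ct j" "X * (ct m - ct j) < 1 / si m - 1 / si j" using jx by (auto simp: right_diff_distrib)
    then have X: "1 / co j < X" using s by (simp add: field_simps)
    have "1 / co j * (ct m - ct j) \<le> X * (ct m - ct j)"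
      using X ct_less[OF mj ap(1)] by (intro mult_right_mono) auto
    moreover have "1 / co j * (ct m - ct j) = co m / (co j * si m) - 1 / si j"
      using s by (simp add: field_simps)
    moreover have "1 / si m \<le> co m / (co j * si m)"
    proof -
      have "co j \<le> co m" using angle_mono[OF mj ap(1)] angle_pos[OF apm(1)] angle_less_half_pi[OF ap(1)]
        by (intro cos_monotone_0_pi_le) auto
      then show ?thesis using s by (simp add: field_simps)
    qed
    ultimately show False using \<open>X * (ct m - ct j) < 1 / si m - 1 / si j\<close> by linarith
  qed
  then have "touching u x0 = {j}" using j(1) by blast
  then show thesis by (rule that)
qed

text \<open>
  Away from the ends and from \<open>N\<close> the gap has a positive minimum, so it stays positive at nearby
  positions, and its integral changes little. On \<open>N\<close> nonnegativity is assumed for the positions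
  satisfying \<open>Q\<close>.
\<close>
lemma robust_area:
  assumes opt: "optimal u a b" and c: "c < area u u a b" and N: "open N" and r1: "0 < r1"
    and pos: "\<And>x. a < x \<Longrightarrow> x < b \<Longrightarrow> x \<notin> N \<Longrightarrow> 0 < gap u u x"
    and onN: "\<And>z x. near r1 z u \<Longrightarrow> Q z \<Longrightarrow> x \<in> N \<Longrightarrow> 0 \<le> gap z z x"
  obtains r where "0 < r" "r \<le> r1" "\<And>z. near r z u \<Longrightarrow> Q z \<Longrightarrow> c < maxarea z z"
proof -
  note ends = optimal_ends[OF opt]
  obtain K where K: "0 < K"
    "\<And>d p q p' q' x x'. near d p p' \<Longrightarrow> near d q q' \<Longrightarrow> \<bar>x - x'\<bar> \<le> d \<Longrightarrow> \<bar>gap p q x - gap p' q' x'\<bar> \<le> K * d"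
    using gap_lipschitz by metis
  define D where "D = area u u a b - c"
  have D: "0 < D" using c by (simp add: D_def)
  define h where "h = min (D / 8) ((b - a) / 4)"
  have h: "0 < h" using D ends by (simp add: h_def)
  have h2: "h \<le> D / 8" "h \<le> (b - a) / 4" unfolding h_def by (rule min.cobounded1, rule min.cobounded2)
  have ab: "a + h < b - h" using h2 ends by (simp add: field_simps)
  define S where "S = {a + h..b - h} - N"
  have S: "compact S" unfolding S_def using N by (intro compact_diff) auto
  obtain m where m: "0 < m" "\<And>x. x \<in> S \<Longrightarrow> m \<le> gap u u x"
  proof (cases "S = {}")
    case False
    then obtain y where y: "y \<in> S" "\<And>x. x \<in> S \<Longrightarrow> gap u u y \<le> gap u u x"
      using continuous_attains_inf[OF S _ continuous_gap] by blast
    have "0 < gap u u y" using y(1) h by (intro pos) (auto simp: S_def)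
    then show thesis using y that by blast
  qed (use that[of 1] in auto)
  define r where "r = min r1 (min (m / K) (D / (4 * K * (b - a))))"
  have r: "0 < r" using r1 m K D ends by (simp add: r_def)
  have rr: "r \<le> r1" "r \<le> m / K" "r \<le> D / (4 * K * (b - a))" unfolding r_def by auto
  have Kr: "K * r \<le> m" "K * r * (b - a) \<le> D / 4"
    using rr(2,3) K(1) ends(1) by (auto simp: field_simps)
  show thesis
  proof (rule that[OF r rr(1)])
    fix z assume z: "near r z u" "Q z"
    have zr1: "near r1 z u" using z(1) rr(1) by (auto simp: near_def intro: order_trans)
    have lip: "gap u u x - K * r \<le> gap z z x" for x
      using K(2)[OF z(1) z(1), of x x] r by (auto simp: abs_le_iff)
    have "feasible z z (a + h) (b - h)"
      unfolding feasible_def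
    proof (intro conjI ballI)
      fix x assume x: "x \<in> {a + h..b - h}"
      show "0 \<le> gap z z x"
      proof (cases "x \<in> N")
        case True then show ?thesis by (rule onN[OF zr1 z(2)])
      next
        case False
        then have "m \<le> gap u u x" using x by (intro m) (auto simp: S_def)
        then show ?thesis using lip[of x] Kr by linarith
      qed
    qed (use ab in auto)
    then have "area z z (a + h) (b - h) \<le> maxarea z z" by (rule area_le_maxarea)
    moreover have "integral {a + h..b - h} (gap u u) - K * r * (b - h - (a + h)) \<le> area z z (a + h) (b - h)"
    proof -
      have "integral {a + h..b - h} (\<lambda>x. gap u u x - K * r) \<le> area z z (a + h) (b - h)"
        unfolding area_def by (intro integral_le integrable_diff gap_integrable lip) auto
      then show ?thesis using ab
        by (subst (asm) Henstock_Kurzweil_Integration.integral_diff) (auto intro: gap_integrable simp: mult_ac)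
    qed
    moreover have "K * r * (b - h - (a + h)) \<le> K * r * (b - a)" using K(1) r h by (intro mult_left_mono) auto
    moreover have "area u u a b \<le> integral {a + h..b - h} (gap u u) + 2 * h"
    proof -
      have "area u u a b = integral {a..a + h} (gap u u) + integral {a + h..b - h} (gap u u) + integral {b - h..b} (gap u u)"
        unfolding area_def
        using Henstock_Kurzweil_Integration.integral_combine[of a "a + h" b "gap u u"]
          Henstock_Kurzweil_Integration.integral_combine[of "a + h" "b - h" b "gap u u"] ab h gap_integrable[of u u] by simp
      moreover have "integral {a..a + h} (gap u u) \<le> integral {a..a + h} (\<lambda>x. 1)"
        by (intro integral_le gap_integrable gap_le_1) auto
      moreover have "integral {b - h..b} (gap u u) \<le> integral {b - h..b} (\<lambda>x. 1)"
        by (intro integral_le gap_integrable gap_le_1) auto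
      ultimately show ?thesis using h by simp
    qed
    ultimately have "area u u a b - 2 * h - K * r * (b - a) \<le> maxarea z z" by linarith
    moreover have "2 * h \<le> D / 4" using h2(1) by simp
    ultimately have "area u u a b - D / 4 - D / 4 \<le> maxarea z z" using Kr(2) by linarith
    moreover have "c = area u u a b - D" by (simp add: D_def)
    ultimately show "c < maxarea z z" using D by linarith
  qed
qed

lemma optimal_unpinched:
  assumes opt: "optimal u a b" and c: "c < area u u a b" and no: "\<And>x. a < x \<Longrightarrow> x < b \<Longrightarrow> gap u u x \<noteq> 0"
  obtains r where "0 < r" "\<And>z. near r z u \<Longrightarrow> c < maxarea z z"
proof -
  have pos: "0 < gap u u x" if "a < x" "x < b" "x \<notin> {}" for x
    using feasible_nonneg[OF opt, of x] no[of x] that by (simp add: less_le)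
  obtain r where r: "0 < r" "r \<le> 1" "\<And>z. near r z u \<Longrightarrow> True \<Longrightarrow> c < maxarea z z"
    by (rule robust_area[OF opt c open_empty zero_less_one pos, where Q = "\<lambda>_. True"]) (use that in auto)
  then show thesis using that by blast
qed

text \<open>
  The component at \<open>z\<close> near \<open>u\<close> is cut only if the apex of the corner \<open>j\<close> at the pinch has risen above the
  line \<open>y = 1\<close>, that is, if \<open>Q z\<close> below fails; this gives the third claim, as sliding lowers the
  apex. For the first claim, a box containing \<open>u\<close> and \<open>slide d u\<close> has the upper boundary of \<open>u\<close> at
  least and the lower boundary of \<open>slide d u\<close> at most.

  For the second claim the box contains a \<open>z\<close> for which \<open>Q z\<close> fails, and \<open>slide d u\<close>. The apex of \<open>slide d u\<close>
  is lower than that of \<open>u\<close> by a multiple of \<open>d\<close>. So the largest position \<open>q\<close> of the box exceeds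
  \<open>slide d u\<close> in one of the two coordinates of hallway \<open>j\<close> by a multiple of \<open>d\<close>, and this raises the
  upper boundary where the corresponding outer wall is visible. The left part of the component is
  shifted to the right by \<open>d\<close>, the right part stays, and the gain on the visible interval exceeds the
  quadratic loss at the pinch.
\<close>
lemma optimal_pinched:
  assumes opt: "optimal u a b" and c: "c < area u u a b" and x0: "a < x0" "x0 < b" "gap u u x0 = 0"
  obtains r d0 where "0 < r" "0 < d0"
    "\<And>d p q. 0 < d \<Longrightarrow> d < d0 \<Longrightarrow> (\<And>i. i < 2*k \<Longrightarrow> p i \<le> slide d u i \<and> slide d u i \<le> q i) \<Longrightarrow>
      (\<And>i. i < 2*k \<Longrightarrow> p i \<le> u i \<and> u i \<le> q i) \<Longrightarrow> area u u a b < maxarea p q"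
    "\<And>d p q z. 0 < d \<Longrightarrow> d < d0 \<Longrightarrow> (\<And>i. i < 2*k \<Longrightarrow> p i \<le> slide d u i \<and> slide d u i \<le> q i) \<Longrightarrow>
      (\<And>i. i < 2*k \<Longrightarrow> p i \<le> z i \<and> z i \<le> q i) \<Longrightarrow> near r z u \<Longrightarrow> maxarea z z \<le> c \<Longrightarrow> area u u a b < maxarea p q"
    "\<And>d. 0 < d \<Longrightarrow> d < d0 \<Longrightarrow> \<exists>r'>0. \<forall>z. near r' z (slide d u) \<longrightarrow> c < maxarea z z"
proof -
  obtain j where J: "touching u x0 = {j}" by (rule touching_single[OF opt x0])
  then have j: "j \<in> touching u x0" by simp
  note ap = touching_apex[OF opt x0(1,2) j]
  have jk: "j < k" by (rule ap(1))
  have s: "0 < si j" "0 < co j" "si j < 1" "co j < 1" using si_pos co_pos si_less_1 co_less_1 jk by auto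
  obtain r0 \<eta> where n: "0 < r0" "0 < \<eta>" "a < x0 - r0" "x0 + r0 < b"
    "\<And>z x. near r0 z u \<Longrightarrow> \<bar>x - x0\<bar> \<le> r0 \<Longrightarrow> up z x = 1"
    "\<And>z x m. near r0 z u \<Longrightarrow> \<bar>x - x0\<bar> \<le> r0 \<Longrightarrow> m < k \<Longrightarrow> 1 + \<eta> \<le> oR z m x \<and> 1 + \<eta> \<le> oL z m x"
    "\<And>z x m. near r0 z u \<Longrightarrow> \<bar>x - x0\<bar> \<le> r0 \<Longrightarrow> m < k \<Longrightarrow> m \<notin> touching u x0 \<Longrightarrow> min (iR z m x) (iL z m x) \<le> 1 - \<eta>"
    "\<And>x. \<bar>x - x0\<bar> \<le> r0 \<Longrightarrow> W0 x \<le> 1 - \<eta>" "\<And>x. \<bar>x - x0\<bar> \<le> r0 \<Longrightarrow> 1 \<le> W1 x" "\<eta> < 1"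
    by (rule pinch_neighbourhood[OF opt x0], rule that) assumption+
  define Q where "Q z \<longleftrightarrow> z (2 * j) * si j + z (2 * j + 1) * co j \<le> 1" for z :: "nat \<Rightarrow> real"
  obtain r where r: "0 < r" "r \<le> r0" "\<And>z. near r z u \<Longrightarrow> Q z \<Longrightarrow> c < maxarea z z"
  proof (rule robust_area[OF opt c _ n(1), where N = "{x0 - r0<..<x0 + r0}" and Q = Q])
    show "open {x0 - r0<..<x0 + r0}" by simp
    show "0 < gap u u x" if "a < x" "x < b" "x \<notin> {x0 - r0<..<x0 + r0}" for x
    proof -
      have "x \<noteq> x0" using that(3) n(1) by auto
      then have "gap u u x \<noteq> 0" using pinch_unique[OF opt x0 that(1,2)] by auto
      then show ?thesis using feasible_nonneg[OF opt, of x] that by (simp add: less_le)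
    qed
    fix z x assume z: "near r0 z u" "Q z" and x: "x \<in> {x0 - r0<..<x0 + r0}"
    then have xr: "\<bar>x - x0\<bar> \<le> r0" by auto
    have "lo z x \<le> 1"
      unfolding lo_le_iff
    proof (intro conjI allI impI)
      show "W0 x \<le> 1" using n(8)[OF xr] n(2) by linarith
      fix m assume m: "m < k"
      show "min (iR z m x) (iL z m x) \<le> 1"
      proof (cases "m = j")
        case False then show ?thesis using n(7)[OF z(1) xr m] J n(2) by auto
      next
        case True
        show ?thesis
        proof (rule ccontr)
          assume "\<not> ?thesis"
          then have 1: "1 < iR z j x" "1 < iL z j x" using True by auto
          have "si j < z (2 * j) - x * co j" "co j < z (2 * j + 1) + x * si j"
            using 1 s by (auto simp: iR_def iL_def field_simps)
          then have "si j * si j < (z (2 * j) - x * co j) * si j" "co j * co j < (z (2 * j + 1) + x * si j) * co j"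
            using s by (auto intro!: mult_strict_right_mono)
          moreover have "si j * si j + co j * co j = 1" using sin_cos_squared_add[of "\<alpha> ! j"] by (simp add: power2_eq_square)
          moreover have "(z (2 * j) - x * co j) * si j + (z (2 * j + 1) + x * si j) * co j = z (2 * j) * si j + z (2 * j + 1) * co j"
            by (simp add: left_diff_distrib distrib_right)
          ultimately have "1 < z (2 * j) * si j + z (2 * j + 1) * co j" by linarith
          then show False using z(2) by (simp add: Q_def)
        qed
      qed
    qed simp
    then show "0 \<le> gap z z x" using n(5)[OF z(1) xr] by (simp add: gap_def)
  qed (rule that)
  obtain y1 y2 g where low: "a < y1" "y1 < y2" "y2 < x0" "0 < g"
    "\<forall>\<^sub>F e in at_right 0. \<forall>x\<in>{y1..y2}. lo (slide e u) x + g * e \<le> lo u x"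
    by (rule slide_lowers[OF opt x0 x0(1)]) (assumption | rule that)+
  obtain v1 v2 tR where vR: "a < v1" "v1 < v2" "v2 < b" "0 < tR" "\<And>y. y \<in> {v1..v2} \<Longrightarrow> visible_R u j tR y"
    by (rule outer_right_visible[OF opt x0 j]) (use J in \<open>auto intro: that\<close>)
  obtain w1 w2 tL where vL: "a < w1" "w1 < w2" "w2 < b" "0 < tL" "\<And>y. y \<in> {w1..w2} \<Longrightarrow> visible_L u j tL y"
    by (rule outer_left_visible[OF opt x0 j]) (use J in \<open>auto intro: that\<close>)
  have xv1: "x0 < v1"
  proof (rule ccontr)
    assume "\<not> x0 < v1"
    then have "oR u j x0 \<le> oR u j v1" by (intro oR_anti_x[OF jk]) simp
    then show False using pinch_top(3)[OF opt x0 jk] vR(4) vR(5)[of v1] vR(2) by (simp add: visible_R_def)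
  qed
  have xw2: "w2 < x0"
  proof (rule ccontr)
    assume "\<not> w2 < x0"
    then have "oL u j x0 \<le> oL u j w2" by (intro oL_mono_x[OF jk]) simp
    then show False using pinch_top(4)[OF opt x0 jk] vL(4) vL(5)[of w2] vL(2) by (simp add: visible_L_def)
  qed
  obtain A where A: "0 < A" "\<And>m. m \<in> {..<k} \<Longrightarrow> ct m + tn m \<le> A"
    by (rule finite_upper_bound[of "{..<k}" "\<lambda>m. ct m + tn m"]) auto
  have A': "ct m \<le> A" "tn m \<le> A" if "m < k" for m
    using A(2)[of m] that ct_pos[OF that] tn_pos[OF that] by auto
  define B where "B = A + cos \<beta>1 / sin \<beta>1"
  have cb: "0 \<le> cos \<beta>1 / sin \<beta>1" using cos_beta_nonneg sin_beta_pos by simp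
  have B: "A \<le> B" "cos \<beta>1 / sin \<beta>1 \<le> B" "0 < B" using A(1) cb by (auto simp: B_def)
  define \<kappa> where "\<kappa> = min (ct j / 2) (tn j / 2)"
  have kap: "0 < \<kappa>" "\<kappa> \<le> ct j / 2" "\<kappa> \<le> tn j / 2" using ct_pos[OF jk] tn_pos[OF jk] by (auto simp: \<kappa>_def)
  \<comment> \<open>The left part of the component is shifted by \<open>d\<close>, so only the right half of the interval is used: for small
\<open>d\<close> its points come from points of the whole interval.\<close>
  define wl where "wl = (w1 + w2) / 2"
  have wl: "w1 < wl" "wl < w2" using vL(2) by (auto simp: wl_def)
  obtain K where K: "0 < K" "\<And>u x0 x. gap u u x0 = 0 \<Longrightarrow> gap u u x \<le> K * \<bar>x - x0\<bar>"
    using gap_bound_at_zero by metis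
  define L where "L = min (v2 - v1) (w2 - wl)"
  have L: "0 < L" "L \<le> v2 - v1" "L \<le> w2 - wl" using vR wl by (auto simp: L_def)
  have ps: "0 < (x0 - a) / 2" "0 < r / 2" "0 < tR / 2" "0 < tL / 2" "0 < wl - w1" "0 < \<kappa> * L" "0 < v1 - x0" "0 < x0 - w2" "0 < wl - a" "0 < b - x0"
    using x0 r vR vL wl kap L xv1 xw2 by auto
  have feas: "0 \<le> gap u u x" if "x \<in> {a..b}" for x by (rule feasible_nonneg[OF opt that])
  have "\<forall>\<^sub>F d in at_right 0. 0 < d \<and> 1 * d < (x0 - a) / 2 \<and> 1 * d < r / 2 \<and> (B + \<kappa>) * d < tR / 2 \<and> (B + \<kappa>) * d < tL / 2 \<and>
      1 * d < wl - w1 \<and> 9 * K * d < \<kappa> * L \<and> 1 * d < v1 - x0 \<and> 1 * d < x0 - w2 \<and> 1 * d < wl - a \<and> 1 * d < b - x0 \<and>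
      (\<forall>x\<in>{y1..y2}. lo (slide d u) x + g * d \<le> lo u x) \<and>
      (\<forall>x\<in>{x0 - d..x0 + d}. 0 \<le> gap (slide d u) (slide d u) x)"
    by (intro eventually_conj eventually_small ps low(5) slide_middle[OF opt x0] eventually_right_pos)
  then obtain d0 where d0: "0 < d0" and small: "\<And>d. 0 < d \<Longrightarrow> d < d0 \<Longrightarrow> d < (x0 - a) / 2 \<and> d < r / 2 \<and> (B + \<kappa>) * d < tR / 2 \<and> (B + \<kappa>) * d < tL / 2 \<and>
      d < wl - w1 \<and> 9 * K * d < \<kappa> * L \<and> d < v1 - x0 \<and> d < x0 - w2 \<and> d < wl - a \<and> d < b - x0 \<and>
      (\<forall>x\<in>{y1..y2}. lo (slide d u) x + g * d \<le> lo u x) \<and>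
      (\<forall>x\<in>{x0 - d..x0 + d}. 0 \<le> gap (slide d u) (slide d u) x)"
    by (auto simp: eventually_at_right_field)
  show thesis
  proof (rule that[OF r(1) d0])
    fix d p q
    assume d: "0 < d" "d < d0" and ps: "\<And>i. i < 2*k \<Longrightarrow> p i \<le> slide d u i \<and> slide d u i \<le> q i"
      and pu: "\<And>i. i < 2*k \<Longrightarrow> p i \<le> u i \<and> u i \<le> q i"
    note sm = small[OF d]
    have lop: "lo p x \<le> lo (slide d u) x" "lo p x \<le> lo u x" for x using ps pu by (auto intro!: lo_mono)
    have upq: "up u x \<le> up q x" for x using pu by (intro up_mono) auto
    have ge: "gap u u x \<le> gap p q x" for x using lop(2)[of x] upq[of x] by (simp add: gap_def)
    have "area u u a b + g * d * (y2 - y1) \<le> area p q a b"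
      unfolding area_def
    proof (rule integral_gain[OF continuous_gap continuous_gap ge])
      show "gap u u x + g * d \<le> gap p q x" if "x \<in> {y1..y2}" for x
      proof -
        have "lo (slide d u) x + g * d \<le> lo u x" using sm that by blast
        then show ?thesis using lop(1)[of x] upq[of x] by (simp add: gap_def)
      qed
    qed (use low x0 in auto)
    moreover have "feasible p q a b"
      using optimal_ends(1)[OF opt] order_trans[OF feas ge] by (auto simp: feasible_def)
    moreover have "0 < g * d * (y2 - y1)" using low d by simp
    ultimately show "area u u a b < maxarea p q" using area_le_maxarea[of p q a b] by linarith
  next
    fix d p q z
    assume d: "0 < d" "d < d0" and ps: "\<And>i. i < 2*k \<Longrightarrow> p i \<le> slide d u i \<and> slide d u i \<le> q i"
      and pz: "\<And>i. i < 2*k \<Longrightarrow> p i \<le> z i \<and> z i \<le> q i" and z: "near r z u" "maxarea z z \<le> c"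
    note sm = small[OF d]
    have dn: "0 \<le> d" using d by simp
    have i2: "2 * j < 2 * k" "2 * j + 1 < 2 * k" using jk by auto
    have ge: "gap (slide d u) (slide d u) x \<le> gap p q x" for x using ps by (intro gap_mono) auto
    have lop: "lo p x \<le> lo (slide d u) x" for x using ps by (intro lo_mono) auto
    have oRq: "oR u m x \<le> oR q m x" "oL u m (x - d) \<le> oL q m x" if "m < k" for m x
      using oR_mono[OF that, of "slide d u" q x] oL_mono[OF that, of "slide d u" q x] ps[of "2*m"] ps[of "2*m+1"] that
        slide_pieces(1)[of d u m x] slide_pieces(3)[OF that, of d u x] by auto
    have "\<not> Q z" using r(3)[OF z(1)] z(2) by force
    then have "1 < z (2 * j) * si j + z (2 * j + 1) * co j" by (simp add: Q_def)
    moreover have "z (2 * j) * si j \<le> q (2 * j) * si j" "z (2 * j + 1) * co j \<le> q (2 * j + 1) * co j"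
      using pz[OF i2(1)] pz[OF i2(2)] s by (auto intro!: mult_right_mono)
    ultimately have big: "0 < (q (2 * j) - u (2 * j)) * si j + (q (2 * j + 1) - u (2 * j + 1)) * co j"
      using ap(6) by (simp add: algebra_simps)
    then consider "d * co j / 2 \<le> q (2 * j) - u (2 * j)" | "- (d * si j / 2) \<le> q (2 * j + 1) - u (2 * j + 1)"
    proof (cases "d * co j / 2 \<le> q (2 * j) - u (2 * j)")
      case False
      then have "(q (2 * j) - u (2 * j)) * si j \<le> d * co j / 2 * si j" using s by (intro mult_right_mono) auto
      then have "0 < (d * si j / 2 + (q (2 * j + 1) - u (2 * j + 1))) * co j"
        using big by (simp add: algebra_simps)
      then have "0 < d * si j / 2 + (q (2 * j + 1) - u (2 * j + 1))" using s by (simp add: zero_less_mult_iff)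
      then show ?thesis using that by simp
    qed (use that in auto)
    then have gain: "(\<forall>x\<in>{v1..v2}. gap u u x + \<kappa> * d \<le> gap p q x) \<or> (\<forall>x\<in>{wl..w2}. gap u u (x - d) + \<kappa> * d \<le> gap p q x)"
    proof cases
      case 1
      have "gap u u x + \<kappa> * d \<le> gap p q x" if x: "x \<in> {v1..v2}" for x
      proof -
        note vis = vR(5)[OF x, unfolded visible_R_def]
        have small': "\<kappa> * d + B * d \<le> tR / 2" "0 \<le> B * d" using sm B d by (auto simp: algebra_simps)
        have "oR u j x + \<kappa> * d \<le> up q x"
          unfolding up_ge_iff
        proof (intro conjI allI impI)
          show "oR u j x + \<kappa> * d \<le> 1" "oR u j x + \<kappa> * d \<le> W1 x" using vis small' vR(4) by linarith+
          fix m assume m: "m < k"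
          show "oR u j x + \<kappa> * d \<le> oR q m x"
          proof (cases "m = j")
            case False
            then have "oR u j x + tR \<le> oR u m x" using vis m by blast
            then show ?thesis using oRq(1)[OF m, of x] small' vR(4) by linarith
          next
            case True
            have "d * co j / 2 / si j \<le> (q (2 * j) - u (2 * j)) / si j" using 1 s by (intro divide_right_mono) auto
            moreover have "\<kappa> * d \<le> ct j / 2 * d" using kap d by (intro mult_right_mono) auto
            moreover have "ct j / 2 * d = d * co j / 2 / si j" by (simp add: mult.commute)
            ultimately show ?thesis unfolding True using oR_change[OF jk, of q x u] by linarith
          qed
          have "oR u j x + tR \<le> oL u m x" using vis m by blast
          moreover have "oL u m (x - d) = oL u m x - d * tn m" using oL_shift[OF m, of u "x - d" x] by simp
          moreover have "d * tn m \<le> d * B" using A'(2)[OF m] B d by (intro mult_left_mono) auto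
          ultimately show "oR u j x + \<kappa> * d \<le> oL q m x" using oRq(2)[OF m, of x] small' vR(4) by (simp add: mult.commute)
        qed
        moreover have "lo p x \<le> lo u x" using lop[of x] lo_mono[of "slide d u" u x, OF slide_le[OF dn]] by linarith
        ultimately show ?thesis using up_le(3)[OF jk, of u x] by (simp add: gap_def)
      qed
      then show ?thesis by blast
    next
      case 2
      have "gap u u (x - d) + \<kappa> * d \<le> gap p q x" if x: "x \<in> {wl..w2}" for x
      proof -
        have xd: "x - d \<in> {w1..w2}" using x sm d by auto
        note vis = vL(5)[OF xd, unfolded visible_L_def]
        have small': "\<kappa> * d + B * d \<le> tL / 2" "0 \<le> B * d" using sm B d by (auto simp: algebra_simps)
        have "oL u j (x - d) + \<kappa> * d \<le> up q x"
          unfolding up_ge_iff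
        proof (intro conjI allI impI)
          show "oL u j (x - d) + \<kappa> * d \<le> 1" using vis small' vL(4) by linarith
          have "d * (cos \<beta>1 / sin \<beta>1) \<le> d * B" using B d by (intro mult_left_mono) auto
          then have "W1 (x - d) - B * d \<le> W1 x" using W1_shift(1)[OF dn, of "x - d"] by (simp add: mult.commute)
          then show "oL u j (x - d) + \<kappa> * d \<le> W1 x" using vis small' vL(4) by linarith
          fix m assume m: "m < k"
          have "oL u j (x - d) + tL \<le> oR u m (x - d)" using vis m by blast
          moreover have "oR u m (x - d) = oR u m x + d * ct m" using oR_shift[OF m, of u "x - d" x] by simp
          moreover have "d * ct m \<le> d * B" using A'(1)[OF m] B d by (intro mult_left_mono) auto
          ultimately show "oL u j (x - d) + \<kappa> * d \<le> oR q m x" using oRq(1)[OF m, of x] small' vL(4) by (simp add: mult.commute)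
          show "oL u j (x - d) + \<kappa> * d \<le> oL q m x"
          proof (cases "m = j")
            case False
            then have "oL u j (x - d) + tL \<le> oL u m (x - d)" using vis m by blast
            then show ?thesis using oRq(2)[OF m, of x] small' vL(4) by linarith
          next
            case True
            have "slide d u (2 * j + 1) = u (2 * j + 1) - d * si j" by (rule slide_odd[OF jk])
            then have "d * si j / 2 \<le> q (2 * j + 1) - slide d u (2 * j + 1)" using 2 by simp
            then have "d * si j / 2 / co j \<le> (q (2 * j + 1) - slide d u (2 * j + 1)) / co j" using s by (intro divide_right_mono) auto
            moreover have "\<kappa> * d \<le> tn j / 2 * d" using kap d by (intro mult_right_mono) auto
            moreover have "tn j / 2 * d = d * si j / 2 / co j" by (simp add: mult.commute)
            ultimately show ?thesis unfolding True using oL_change[OF jk, of q x "slide d u"] slide_pieces(3)[OF jk, of d u x] by linarith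
          qed
        qed
        moreover have "lo p x \<le> lo u (x - d)" using lop[of x] slide_left(2)[OF opt x0 dn, of x] x xw2 by simp
        ultimately show ?thesis using up_le(4)[OF jk, of u "x - d"] by (simp add: gap_def)
      qed
      then show ?thesis by blast
    qed
    have left: "gap u u (x - d) \<le> gap p q x" if "x \<in> {a + d..x0 - d}" for x
      using slide_left(1)[OF opt x0 dn, of x] ge[of x] that dn by simp
    have right: "gap u u (x + 0) \<le> gap p q x" if "x \<in> {x0 + d..b - 0}" for x
      using slide_right(2)[OF opt x0 dn, of x] ge[of x] that by simp
    have mid: "0 \<le> gap p q x" if "x \<in> {x0 - d..x0 + d}" for x
      using sm ge[of x] that by (meson order_trans)
    have cc: "a + d \<le> x0 - d" "x0 + d \<le> b - 0" using sm by auto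
    have le: "v1 \<le> v2" "wl \<le> w2" using vR wl by auto
    note sg = surgery[OF continuous_gap continuous_gap dn order.refl dn cc less_imp_le[OF K(1)] K(2)[OF x0(3)] feas left right mid]
    have kd: "0 \<le> \<kappa> * d" using kap d by simp
    have res: "(\<forall>x\<in>{a + d..b - 0}. 0 \<le> gap p q x) \<and> area u u a b + \<kappa> * d * L - K * (2 * d + d + 0)\<^sup>2 \<le> integral {a + d..b - 0} (gap p q)"
      using gain
    proof
      assume "\<forall>x\<in>{v1..v2}. gap u u x + \<kappa> * d \<le> gap p q x"
      then have G: "(a + d \<le> v1 \<and> v2 \<le> x0 - d \<and> (\<forall>x\<in>{v1..v2}. gap u u (x - d) + \<kappa> * d \<le> gap p q x)) \<or>
          (x0 + d \<le> v1 \<and> v2 \<le> b - 0 \<and> (\<forall>x\<in>{v1..v2}. gap u u (x + 0) + \<kappa> * d \<le> gap p q x))"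
        using sm vR by simp
      have "\<kappa> * d * L \<le> \<kappa> * d * (v2 - v1)" using L kd by (intro mult_left_mono) auto
      moreover have "integral {a..b} (gap u u) + \<kappa> * d * (v2 - v1) - K * (2 * d + d + 0)\<^sup>2 \<le> integral {a + d..b - 0} (gap p q)"
        by (rule sg(2)[OF _ _ _ _ G le(1)])
      moreover have "\<forall>x\<in>{a + d..b - 0}. 0 \<le> gap p q x" using sg(1)[OF _ _ _ _ G le(1)] by auto
      ultimately show ?thesis by (simp add: area_def)
    next
      assume "\<forall>x\<in>{wl..w2}. gap u u (x - d) + \<kappa> * d \<le> gap p q x"
      then have G: "(a + d \<le> wl \<and> w2 \<le> x0 - d \<and> (\<forall>x\<in>{wl..w2}. gap u u (x - d) + \<kappa> * d \<le> gap p q x)) \<or>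
          (x0 + d \<le> wl \<and> w2 \<le> b - 0 \<and> (\<forall>x\<in>{wl..w2}. gap u u (x + 0) + \<kappa> * d \<le> gap p q x))"
        using sm wl by simp
      have "\<kappa> * d * L \<le> \<kappa> * d * (w2 - wl)" using L kd by (intro mult_left_mono) auto
      moreover have "integral {a..b} (gap u u) + \<kappa> * d * (w2 - wl) - K * (2 * d + d + 0)\<^sup>2 \<le> integral {a + d..b - 0} (gap p q)"
        by (rule sg(2)[OF _ _ _ _ G le(2)])
      moreover have "\<forall>x\<in>{a + d..b - 0}. 0 \<le> gap p q x" using sg(1)[OF _ _ _ _ G le(2)] by auto
      ultimately show ?thesis by (simp add: area_def)
    qed
    moreover have "K * (2 * d + d + 0)\<^sup>2 < \<kappa> * d * L"
    proof -
      have "K * (2 * d + d + 0)\<^sup>2 = (9 * K * d) * d" by (simp add: power2_eq_square)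
      also have "\<dots> < (\<kappa> * L) * d" using sm d by (intro mult_strict_right_mono) auto
      finally show ?thesis by (simp add: algebra_simps)
    qed
    moreover have "a + d \<le> b - 0" using cc d by linarith
    ultimately show "area u u a b < maxarea p q"
      using area_le_maxarea[of p q "a + d" "b - 0"] by (simp add: feasible_def area_def)
  next
    fix d assume d: "0 < d" "d < d0"
    note sm = small[OF d]
    define r' where "r' = min (r / 2) (d * (si j * co j) / 2)"
    have r': "0 < r'" using r s d by (simp add: r'_def)
    have rr: "r' \<le> r / 2" "r' \<le> d * (si j * co j) / 2" unfolding r'_def by auto
    show "\<exists>r'>0. \<forall>z. near r' z (slide d u) \<longrightarrow> c < maxarea z z"
    proof (intro exI[of _ r'] conjI allI impI r')
      fix z assume z: "near r' z (slide d u)"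
      have "near r z u"
        unfolding near_def
      proof (intro allI impI)
        fix i assume i: "i < 2 * k"
        have "\<bar>z i - slide d u i\<bar> \<le> r'" "\<bar>slide d u i - u i\<bar> \<le> d"
          using z slide_near[of d u] d i by (auto simp: near_def)
        then show "\<bar>z i - u i\<bar> \<le> r" using rr sm by linarith
      qed
      moreover have "Q z"
      proof -
        have "z (2 * j) \<le> slide d u (2 * j) + r'" "z (2 * j + 1) \<le> slide d u (2 * j + 1) + r'"
          using z[unfolded near_def, rule_format, of "2 * j"] z[unfolded near_def, rule_format, of "2 * j + 1"] jk
          unfolding abs_le_iff by linarith+
        then have 1: "z (2 * j) \<le> u (2 * j) + r'" "z (2 * j + 1) \<le> u (2 * j + 1) - d * si j + r'"
          unfolding slide_even slide_odd[OF jk] .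
        have "z (2 * j) * si j \<le> (u (2 * j) + r') * si j" "z (2 * j + 1) * co j \<le> (u (2 * j + 1) - d * si j + r') * co j"
          using 1 s by (auto intro!: mult_right_mono)
        moreover have "r' * si j \<le> r'" "r' * co j \<le> r'" using r' s by (auto simp: mult_left_le)
        ultimately show ?thesis using ap(6) rr(2) by (simp add: Q_def algebra_simps)
      qed
      ultimately show "c < maxarea z z" by (rule r(3))
    qed
  qed
qed

end

section \<open>The region of a box of positions\<close>

text \<open>
  A point above the lowest inner corner and below the highest outer walls lies in one hallway of the family:
  one coordinate of the corner is chosen as large as the point permits and the other one as large as
  possible.
\<close>
lemma hallway_hull_iff:
  assumes "a \<le> b" "c \<le> d"
  shows "(x, y) \<in> hallway_hull \<phi> {a..b} {c..d} \<longleftrightarrow>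
    x * cos \<phi> + y * sin \<phi> \<le> b + 1 \<and> - x * sin \<phi> + y * cos \<phi> \<le> d + 1 \<and>
    (a \<le> x * cos \<phi> + y * sin \<phi> \<or> c \<le> - x * sin \<phi> + y * cos \<phi>)" (is "?L \<longleftrightarrow> ?R")
proof
  assume ?L
  then show ?R by (auto simp: hallway_hull_def hallway_def)
next
  assume R: ?R
  define s t where st: "s = x * cos \<phi> + y * sin \<phi>" "t = - x * sin \<phi> + y * cos \<phi>"
  have R': "s \<le> b + 1" "t \<le> d + 1" "a \<le> s \<or> c \<le> t" using R by (simp_all add: st)
  have mem: "(x, y) \<in> hallway \<phi> u v \<longleftrightarrow> u \<le> s \<and> s \<le> u + 1 \<and> t \<le> v + 1 \<or> s \<le> u + 1 \<and> v \<le> t \<and> t \<le> v + 1" for u v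
    by (simp add: hallway_def st)
  have "\<exists>u\<in>{a..b}. \<exists>v\<in>{c..d}. (x, y) \<in> hallway \<phi> u v"
    using R'(3)
  proof
    assume "a \<le> s"
    then show ?thesis using R' assms by (intro bexI[of _ "min b s"] bexI[of _ d]) (auto simp: mem)
  next
    assume "c \<le> t"
    then show ?thesis using R' assms by (intro bexI[of _ b] bexI[of _ "min d t"]) (auto simp: mem)
  qed
  then show ?L by (auto simp: hallway_hull_def)
qed

lemma hallway_eq_hull: "hallway \<phi> u v = hallway_hull \<phi> {u..u} {v..v}"
  by (simp add: hallway_hull_def)

text \<open>
  The cases in which the same angle satisfies both bounds are covered by the definition: there the other
  angle satisfies the lower or the upper bound, because a negative number is at most 1.
\<close>
lemma butterfly_iff:
  "(x, y) \<in> butterfly \<beta>1 \<beta>2 \<longleftrightarrow>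
    (0 \<le> x * cos \<beta>1 + y * sin \<beta>1 \<or> 0 \<le> x * cos \<beta>2 + y * sin \<beta>2) \<and>
    (x * cos \<beta>1 + y * sin \<beta>1 \<le> 1 \<or> x * cos \<beta>2 + y * sin \<beta>2 \<le> 1)"
  by (auto simp: butterfly_def)

text \<open>
  This reads off the coordinates of the initial box, which is given as a concatenation of pairs.
\<close>
lemma nth_concat_pairs:
  "length (concat (map (\<lambda>i. [f i, g i]) [0..<n])) = 2 * n"
  "m < n \<Longrightarrow> concat (map (\<lambda>i. [f i, g i]) [0..<n]) ! (2 * m) = f m"
  "m < n \<Longrightarrow> concat (map (\<lambda>i. [f i, g i]) [0..<n]) ! (2 * m + 1) = g m"
proof (induction n)
  case (Suc n)
  { case 1 then show ?case using Suc by simp }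
  { case 2 then show ?case using Suc by (cases "m = n") (auto simp: nth_append) }
  { case 3 then show ?case using Suc by (cases "m = n") (auto simp: nth_append) }
qed auto

context sofa
begin

abbreviation box_min :: "ibox \<Rightarrow> nat \<Rightarrow> real" where "box_min E \<equiv> \<lambda>i. fst (E ! i)"
abbreviation box_max :: "ibox \<Rightarrow> nat \<Rightarrow> real" where "box_max E \<equiv> \<lambda>i. snd (E ! i)"

lemma region_between_graphs:
  assumes "\<And>i. i < 2 * k \<Longrightarrow> p i \<le> q i"
  shows "strip \<inter> (\<Inter>m<k. hallway_hull (\<alpha> ! m) {p (2 * m)..q (2 * m)} {p (2 * m + 1)..q (2 * m + 1)}) \<inter> butterfly \<beta>1 \<beta>2
    = between_graphs (lo p) (up q) UNIV"
proof -
  have hull: "(x, y) \<in> hallway_hull (\<alpha> ! m) {p (2 * m)..q (2 * m)} {p (2 * m + 1)..q (2 * m + 1)} \<longleftrightarrow>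
     y \<le> oR q m x \<and> y \<le> oL q m x \<and> min (iR p m x) (iL p m x) \<le> y" if m: "m < k" for m x y
  proof -
    have "p (2 * m) \<le> q (2 * m)" "p (2 * m + 1) \<le> q (2 * m + 1)" using assms m by auto
    then show ?thesis unfolding hallway_hull_iff[OF \<open>p (2 * m) \<le> q (2 * m)\<close> \<open>p (2 * m + 1) \<le> q (2 * m + 1)\<close>]
      using si_pos[OF m] co_pos[OF m]
      by (auto simp: oR_def oL_def iR_def iL_def min_le_iff_disj pos_le_divide_eq pos_divide_le_eq algebra_simps)
  qed
  have line: "0 \<le> x * cos \<beta> + y * sin \<beta> \<longleftrightarrow> - x * cos \<beta> / sin \<beta> \<le> y"
    "x * cos \<beta> + y * sin \<beta> \<le> 1 \<longleftrightarrow> y \<le> (1 - x * cos \<beta>) / sin \<beta>" if "0 < sin \<beta>" for x y \<beta> :: real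
    unfolding pos_divide_le_eq[OF that] pos_le_divide_eq[OF that] by linarith+
  have b: "(x, y) \<in> butterfly \<beta>1 \<beta>2 \<longleftrightarrow> W0 x \<le> y \<and> y \<le> W1 x" for x y
    unfolding butterfly_iff W0_def W1_def line[OF sin_beta_pos(1)] line[OF sin_beta_pos(2)]
    by (simp add: min_le_iff_disj le_max_iff_disj)
  show ?thesis
    by (auto simp: strip_def between_graphs_def hull[simplified] b up_ge_iff lo_le_iff)
qed

lemma sofa_Gamma_maxarea:
  assumes "is_ibox (2 * k) E"
  shows "sofa_Gamma \<alpha> \<beta>1 \<beta>2 E = maxarea (box_min E) (box_max E)"
proof -
  have "box_min E i \<le> box_max E i" if "i < 2 * k" for i
    using assms that nth_mem[of i E] by (fastforce simp: is_ibox_def)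
  from region_between_graphs[of "box_min E" "box_max E", OF this]
  show ?thesis by (simp add: sofa_Gamma_def maxarea_def ival_def)
qed

lemma sofa_g_maxarea: "sofa_g \<alpha> \<beta>1 \<beta>2 u = maxarea ((!) u) ((!) u)"
  using region_between_graphs[of "(!) u" "(!) u"] by (simp add: sofa_g_def maxarea_def hallway_eq_hull)

text \<open>
  Lowering the coordinates of a position helps as long as no outer wall drops below the old upper boundary.
\<close>
lemma dominate:
  assumes "\<And>i. i < 2 * k \<Longrightarrow> v i \<le> u i"
    and "\<And>m. m < k \<Longrightarrow> up u x \<le> oR v m x" "\<And>m. m < k \<Longrightarrow> up u x \<le> oL v m x"
  shows "gap u u x \<le> gap v v x"
proof -
  have "up u x \<le> up v x" unfolding up_ge_iff using assms up_le(1,2)[of u x] by auto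
  moreover have "lo v x \<le> lo u x" using assms by (intro lo_mono) auto
  ultimately show ?thesis by (simp add: gap_def)
qed

lemma gap_nonneg_outer:
  assumes "0 \<le> gap u u x"
  shows "0 \<le> W1 x" "W0 x \<le> 1" "m < k \<Longrightarrow> 0 \<le> oR u m x" "m < k \<Longrightarrow> 0 \<le> oL u m x"
    "m < k \<Longrightarrow> min (iR u m x) (iL u m x) \<le> 1"
  using assms lo_ge(1)[of u x] lo_ge(2)[of x u] lo_ge(3)[of m u x] up_le(1,2)[of u x] up_le(3,4)[of m u x]
  unfolding gap_def by linarith+

lemma feasible_dominate:
  assumes "feasible u u a b" "\<And>x. x \<in> {a..b} \<Longrightarrow> 0 \<le> gap u u x \<Longrightarrow> gap u u x \<le> gap v v x"
  shows "feasible v v a b" "area u u a b \<le> area v v a b"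
proof -
  have le: "gap u u x \<le> gap v v x" if "x \<in> {a..b}" for x using assms that by (auto simp: feasible_def)
  show "feasible v v a b" using assms(1) le unfolding feasible_def by (meson order_trans)
  show "area u u a b \<le> area v v a b" unfolding area_def by (intro integral_le gap_integrable le)
qed

section \<open>The initial box contains maximisers\<close>

text \<open>
  The optimal component lies between these abscissas, for \<open>\<beta>2 = pi / 2\<close> after a suitable translation.
\<close>
definition x_min :: "nat \<Rightarrow> real" where
  "x_min j = (if \<beta>2 < pi / 2 then - tan \<beta>2 else - (1 + 1 / co j) / si j)"
definition x_max :: "nat \<Rightarrow> real" where
  "x_max j = (if \<beta>2 < pi / 2 then 1 / cos \<beta>2 else 1 / co j)"

lemma initial_ibox_nth:
  shows "length (initial_ibox \<alpha> \<beta>2 j) = 2 * k"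
    and "m < k \<Longrightarrow> \<not> (\<beta>2 = pi / 2 \<and> m = j) \<Longrightarrow> initial_ibox \<alpha> \<beta>2 j ! (2 * m) = I_range (\<alpha> ! m) (x_min j) (x_max j)"
    and "m < k \<Longrightarrow> \<not> (\<beta>2 = pi / 2 \<and> m = j) \<Longrightarrow> initial_ibox \<alpha> \<beta>2 j ! (2 * m + 1) = J_range (\<alpha> ! m) (x_min j) (x_max j)"
    and "j < k \<Longrightarrow> \<beta>2 = pi / 2 \<Longrightarrow> initial_ibox \<alpha> \<beta>2 j ! (2 * j) = (0, 0)"
    and "j < k \<Longrightarrow> \<beta>2 = pi / 2 \<Longrightarrow> initial_ibox \<alpha> \<beta>2 j ! (2 * j + 1) = (- tan (\<alpha> ! j) - 1, 1 / co j)"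
proof -
  define f where "f i = (if \<beta>2 = pi / 2 \<and> i = j then (0, 0) else I_range (\<alpha> ! i) (x_min j) (x_max j))" for i
  define g where "g i = (if \<beta>2 = pi / 2 \<and> i = j then (- tan (\<alpha> ! j) - 1, 1 / co j) else J_range (\<alpha> ! i) (x_min j) (x_max j))" for i
  have eq: "initial_ibox \<alpha> \<beta>2 j = concat (map (\<lambda>i. [f i, g i]) [0..<k])"
  proof (cases "\<beta>2 < pi / 2")
    case True then show ?thesis by (simp add: initial_ibox_def f_def g_def x_min_def x_max_def Let_def)
  next
    case False
    then have "\<beta>2 = pi / 2" using beta_le_half_pi by simp
    then show ?thesis unfolding initial_ibox_def f_def g_def x_min_def x_max_def Let_def
      by (auto intro!: arg_cong[where f = concat])
  qed
  show "length (initial_ibox \<alpha> \<beta>2 j) = 2 * k" unfolding eq by (rule nth_concat_pairs)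
  show "m < k \<Longrightarrow> \<not> (\<beta>2 = pi / 2 \<and> m = j) \<Longrightarrow> initial_ibox \<alpha> \<beta>2 j ! (2 * m) = I_range (\<alpha> ! m) (x_min j) (x_max j)"
    unfolding eq by (subst nth_concat_pairs) (auto simp: f_def)
  show "m < k \<Longrightarrow> \<not> (\<beta>2 = pi / 2 \<and> m = j) \<Longrightarrow> initial_ibox \<alpha> \<beta>2 j ! (2 * m + 1) = J_range (\<alpha> ! m) (x_min j) (x_max j)"
    unfolding eq by (subst nth_concat_pairs) (auto simp: g_def)
  show "j < k \<Longrightarrow> \<beta>2 = pi / 2 \<Longrightarrow> initial_ibox \<alpha> \<beta>2 j ! (2 * j) = (0, 0)"
    unfolding eq by (subst nth_concat_pairs) (auto simp: f_def)
  show "j < k \<Longrightarrow> \<beta>2 = pi / 2 \<Longrightarrow> initial_ibox \<alpha> \<beta>2 j ! (2 * j + 1) = (- tan (\<alpha> ! j) - 1, 1 / co j)"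
    unfolding eq by (subst nth_concat_pairs) (auto simp: g_def)
qed

lemma x_min_less_x_max: assumes "j < k" shows "x_min j \<le> x_max j"
proof (cases "\<beta>2 < pi / 2")
  case True
  then have "0 < cos \<beta>2" using beta1_pos beta_le by (intro cos_gt_zero) auto
  then have "- tan \<beta>2 \<le> 0" "0 \<le> 1 / cos \<beta>2" using sin_beta_pos by (auto simp: tan_def)
  then have "- tan \<beta>2 \<le> 1 / cos \<beta>2" by linarith
  then show ?thesis using True by (simp add: x_min_def x_max_def)
next
  case False
  have "0 \<le> 1 / co j" "0 \<le> (1 + 1 / co j) / si j" using si_pos[OF assms] co_pos[OF assms] by auto
  then have "- (1 + 1 / co j) / si j \<le> 1 / co j" unfolding minus_divide_left[symmetric] by linarith
  then show ?thesis using False unfolding x_min_def x_max_def by simp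
qed

lemma initial_ibox_is_ibox: assumes j: "j < k" shows "is_ibox (2 * k) (initial_ibox \<alpha> \<beta>2 j)"
proof -
  have "fst (initial_ibox \<alpha> \<beta>2 j ! i) \<le> snd (initial_ibox \<alpha> \<beta>2 j ! i)" if i: "i < 2 * k" for i
  proof -
    define m where "m = i div 2"
    have m: "m < k" and im: "i = 2 * m \<or> i = 2 * m + 1" using i by (auto simp: m_def)
    note s = si_pos[OF m] co_pos[OF m] x_min_less_x_max[OF j]
    show ?thesis
    proof (cases "\<beta>2 = pi / 2 \<and> m = j")
      case True
      have "0 \<le> tan (\<alpha> ! j)" "0 \<le> 1 / co j" using si_pos[OF j] co_pos[OF j] by (simp_all add: tan_def)
      then have "- tan (\<alpha> ! j) - 1 \<le> 1 / co j" by linarith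
      then show ?thesis using im True initial_ibox_nth(4,5)[OF j] by auto
    next
      case False
      have "x_min j * co m \<le> x_max j * co m" "x_min j * si m \<le> x_max j * si m" using s by (auto intro!: mult_right_mono)
      then have "x_min j * co m - 1 \<le> x_max j * co m + si m" "- x_max j * si m - 1 \<le> - x_min j * si m + co m"
        using s by linarith+
      then show ?thesis using im initial_ibox_nth(2,3)[OF m False] by (auto simp: I_range_def J_range_def)
    qed
  qed
  then show ?thesis using initial_ibox_nth(1)[of j]
    by (auto simp: is_ibox_def in_set_conv_nth) (metis fst_conv snd_conv)
qed

lemma x_range_butterfly:
  assumes b: "\<beta>2 < pi / 2" and g: "0 \<le> gap u u x"
  shows "x_min j \<le> x" "x \<le> x_max j"
proof -
  have c: "0 < cos \<beta>2" using b beta1_pos beta_le by (intro cos_gt_zero) auto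
  have cc: "cos \<beta>2 \<le> cos \<beta>1" "sin \<beta>1 \<le> sin \<beta>2" using beta1_pos beta_le beta_le_half_pi
    by (auto intro!: cos_monotone_0_pi_le sin_monotone_2pi_le)
  note W = gap_nonneg_outer(1,2)[OF g]
  have "x * cos \<beta>1 \<le> 1 \<or> x * cos \<beta>2 \<le> 1"
    using W(1) sin_beta_pos by (auto simp: W1_def le_max_iff_disj zero_le_divide_iff)
  moreover have "x * cos \<beta>2 \<le> x * cos \<beta>1" if "0 \<le> x" using cc that by (intro mult_left_mono) auto
  moreover have "x * cos \<beta>2 \<le> 1" if "x \<le> 0"
  proof -
    have "x * cos \<beta>2 \<le> 0" using that c by (simp add: mult_nonpos_nonneg)
    then show ?thesis by simp
  qed
  ultimately have "x * cos \<beta>2 \<le> 1" by linarith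
  then show "x \<le> x_max j" using b c by (simp add: x_max_def field_simps)
  have "- x * cos \<beta>1 \<le> sin \<beta>1 \<or> - x * cos \<beta>2 \<le> sin \<beta>2"
    using W(2) unfolding W0_def min_le_iff_disj pos_divide_le_eq[OF sin_beta_pos(1)] pos_divide_le_eq[OF sin_beta_pos(2)] by simp
  moreover have "- x * cos \<beta>2 \<le> - x * cos \<beta>1" if "x \<le> 0" using cc that by (intro mult_left_mono) auto
  moreover have "- x * cos \<beta>2 \<le> sin \<beta>2" if "0 \<le> x"
  proof -
    have "0 \<le> x * cos \<beta>2" using that c by simp
    then show ?thesis using sin_beta_pos by simp
  qed
  ultimately have "- x * cos \<beta>2 \<le> sin \<beta>2" using cc by linarith
  then show "x_min j \<le> x" using b c by (simp add: x_min_def tan_def field_simps)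
qed

text \<open>
  For \<open>\<beta>2 = pi / 2\<close> the butterfly imposes no bound; here the abscissas are bounded by the outer walls of
  the normalised hallway \<open>j\<close>.
\<close>
lemma x_range_hallway:
  assumes b: "\<beta>2 = pi / 2" and j: "j < k" and u: "u (2 * j) = 0" "u (2 * j + 1) \<le> 1 / co j" and g: "0 \<le> gap u u x"
  shows "x_min j \<le> x" "x \<le> x_max j"
proof -
  note o = gap_nonneg_outer(3,4)[OF g j]
  note s = si_pos[OF j] co_pos[OF j]
  have nb: "\<not> \<beta>2 < pi / 2" using b by simp
  have "x * co j \<le> 1" using o(1) s u(1) by (simp add: oR_def zero_le_divide_iff)
  then show "x \<le> x_max j" using nb s by (simp add: x_max_def field_simps)
  have "0 \<le> u (2 * j + 1) + 1 + x * si j" using o(2) s by (simp add: oL_def zero_le_divide_iff)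
  then have "- (1 + 1 / co j) \<le> x * si j" using u(2) by linarith
  then show "x_min j \<le> x" using nb s unfolding x_min_def by (simp add: pos_divide_le_eq)
qed

text \<open>
  A coordinate above its range is reduced to the upper end: over \<open>[x_min j, x_max j]\<close> the outer wall is then
  still above the line \<open>y = 1\<close>. No coordinate is below its range, since the outer wall would be negative
  on the whole interval.
\<close>
lemma clamp_into_box:
  assumes j: "j < k" and f: "feasible u u a b" and x: "\<And>x. x \<in> {a..b} \<Longrightarrow> x_min j \<le> x \<and> x \<le> x_max j"
    and special: "\<beta>2 = pi / 2 \<Longrightarrow> u (2 * j) = 0 \<and> - tan (\<alpha> ! j) - 1 \<le> u (2 * j + 1) \<and> u (2 * j + 1) \<le> 1 / co j"
  obtains v where "\<And>i. i < 2 * k \<Longrightarrow> box_min (initial_ibox \<alpha> \<beta>2 j) i \<le> v i \<and> v i \<le> box_max (initial_ibox \<alpha> \<beta>2 j) i"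
    "feasible v v a b" "area u u a b \<le> area v v a b"
proof -
  let ?E = "initial_ibox \<alpha> \<beta>2 j"
  define v where "v i = min (box_max ?E i) (u i)" for i
  have ab: "a \<in> {a..b}" "0 \<le> gap u u a" using f by (auto simp: feasible_def)
  have box: "box_min ?E i \<le> v i \<and> v i \<le> box_max ?E i" if i: "i < 2 * k" for i
  proof -
    have "box_min ?E i \<le> box_max ?E i" using initial_ibox_is_ibox[OF j] i nth_mem[of i ?E] by (fastforce simp: is_ibox_def)
    moreover have "box_min ?E i \<le> u i"
    proof -
      define m where "m = i div 2"
      have m: "m < k" and im: "i = 2 * m \<or> i = 2 * m + 1" using i by (auto simp: m_def)
      note s = si_pos[OF m] co_pos[OF m]
      show ?thesis
      proof (cases "\<beta>2 = pi / 2 \<and> m = j")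
        case True then show ?thesis using im special initial_ibox_nth(4,5)[OF j] by auto
      next
        case False
        have "x_min j * co m \<le> a * co m" "a * si m \<le> x_max j * si m" using s x[OF ab(1)] by (auto intro!: mult_right_mono)
        moreover have "a * co m \<le> u (2 * m) + 1" "0 \<le> u (2 * m + 1) + 1 + a * si m"
          using gap_nonneg_outer(3,4)[OF ab(2) m] s by (auto simp: oR_def oL_def zero_le_divide_iff)
        ultimately show ?thesis using im initial_ibox_nth(2,3)[OF m False] by (auto simp: I_range_def J_range_def)
      qed
    qed
    ultimately show ?thesis by (simp add: v_def)
  qed
  have gap: "gap u u x \<le> gap v v x" if xx: "x \<in> {a..b}" for x
  proof (rule dominate)
    show "v i \<le> u i" for i by (simp add: v_def)
    fix m assume m: "m < k"
    note s = si_pos[OF m] co_pos[OF m]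
    have sc: "x_min j * si m \<le> x * si m" "x * co m \<le> x_max j * co m" using s x[OF xx] by (auto intro!: mult_right_mono)
    show "up u x \<le> oR v m x"
    proof (cases "u (2 * m) \<le> box_max ?E (2 * m)")
      case True
      then have "v (2 * m) = u (2 * m)" by (simp add: v_def)
      then show ?thesis using up_le(3)[OF m, of u x] by (simp add: oR_def)
    next
      case False
      have ns: "\<not> (\<beta>2 = pi / 2 \<and> m = j)" using False special initial_ibox_nth(4)[OF j] by auto
      have "v (2 * m) = x_max j * co m + si m" using False initial_ibox_nth(2)[OF m ns] by (simp add: v_def I_range_def)
      then have "si m \<le> v (2 * m) + 1 - x * co m" using sc(2) by linarith
      then have "1 \<le> oR v m x" using s by (simp add: oR_def pos_le_divide_eq)
      then show ?thesis using up_le(1)[of u x] by linarith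
    qed
    show "up u x \<le> oL v m x"
    proof (cases "u (2 * m + 1) \<le> box_max ?E (2 * m + 1)")
      case True
      then have "v (2 * m + 1) = u (2 * m + 1)" by (simp add: v_def)
      then show ?thesis using up_le(4)[OF m, of u x] by (simp add: oL_def)
    next
      case False
      have ns: "\<not> (\<beta>2 = pi / 2 \<and> m = j)" using False special initial_ibox_nth(5)[OF j] by auto
      have "v (2 * m + 1) = - x_min j * si m + co m" using False initial_ibox_nth(3)[OF m ns] by (simp add: v_def J_range_def)
      then have "co m \<le> v (2 * m + 1) + 1 + x * si m" using sc(1) by linarith
      then have "1 \<le> oL v m x" using s by (simp add: oL_def pos_le_divide_eq)
      then show ?thesis using up_le(1)[of u x] by linarith
    qed
  qed
  show thesis by (rule that[OF box]) (use feasible_dominate[OF f gap] in auto)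
qed

definition translate :: "real \<Rightarrow> (nat \<Rightarrow> real) \<Rightarrow> nat \<Rightarrow> real" where
  "translate \<tau> u i = (if even i then u i + \<tau> * co (i div 2) else u i - \<tau> * si (i div 2))"

text \<open>
  For \<open>\<beta>2 = pi / 2\<close> the butterfly contains the strip, so the problem is invariant under horizontal
  translations.
\<close>
lemma gap_translate:
  assumes "\<beta>2 = pi / 2" shows "gap (translate \<tau> u) (translate \<tau> u) x = gap u u (x - \<tau>)"
proof -
  have o: "oR (translate \<tau> u) m x = oR u m (x - \<tau>)" "iR (translate \<tau> u) m x = iR u m (x - \<tau>)"
    "oL (translate \<tau> u) m x = oL u m (x - \<tau>)" "iL (translate \<tau> u) m x = iL u m (x - \<tau>)" for m
    by (auto simp: oR_def iR_def oL_def iL_def translate_def algebra_simps)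
  note W = W1_ge_1[OF assms] W0_le_0[OF assms]
  have "y \<le> up (translate \<tau> u) x \<longleftrightarrow> y \<le> up u (x - \<tau>)" for y
    unfolding up_ge_iff o using W(1)[of x] W(1)[of "x - \<tau>"] by fastforce
  then have "up (translate \<tau> u) x = up u (x - \<tau>)" by (meson order_antisym order_refl)
  moreover have "lo (translate \<tau> u) x \<le> y \<longleftrightarrow> lo u (x - \<tau>) \<le> y" for y
    unfolding lo_le_iff o using W(2)[of x] W(2)[of "x - \<tau>"] by fastforce
  then have "lo (translate \<tau> u) x = lo u (x - \<tau>)" by (meson order_antisym order_refl)
  ultimately show ?thesis by (simp add: gap_def)
qed

lemma feasible_translate:
  assumes "\<beta>2 = pi / 2" "feasible u u a b"
  shows "feasible (translate \<tau> u) (translate \<tau> u) (a + \<tau>) (b + \<tau>)"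
    "area (translate \<tau> u) (translate \<tau> u) (a + \<tau>) (b + \<tau>) = area u u a b"
proof -
  show "feasible (translate \<tau> u) (translate \<tau> u) (a + \<tau>) (b + \<tau>)"
    using assms(2) by (auto simp: feasible_def gap_translate[OF assms(1)])
  have "integral {a..b} (gap (translate \<tau> u) (translate \<tau> u) \<circ> (\<lambda>x. x + \<tau>))
      = integral {a + \<tau>..b + \<tau>} (gap (translate \<tau> u) (translate \<tau> u))"
    by (rule integral_shift) (rule continuous_gap)
  then show "area (translate \<tau> u) (translate \<tau> u) (a + \<tau>) (b + \<tau>) = area u u a b"
    unfolding area_def by (simp add: o_def gap_translate[OF assms(1)])
qed

text \<open>
  A horizontal translation makes the first coordinate of hallway \<open>j\<close> zero. If the second coordinate \<open>h\<close> then
  exceeds \<open>1 / co j\<close>, the apex is above the strip and the component lies on one side of it. On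
  the right side only the right inner wall matters, and \<open>h\<close> may be reduced to \<open>1 / co j\<close>. On the left side
  only the left inner wall matters: a further translation makes the second coordinate \<open>1 / co j\<close>, and
  then the first coordinate may be reduced to 0.
\<close>
lemma normalise_hallway:
  assumes b: "\<beta>2 = pi / 2" and j: "j < k" and f: "feasible u u a b"
  obtains v c d where "feasible v v c d" "area u u a b \<le> area v v c d" "v (2 * j) = 0" "v (2 * j + 1) \<le> 1 / co j"
proof -
  note s = si_pos[OF j] co_pos[OF j]
  have pyth: "si j * si j = 1 - co j * co j" using sin_cos_squared_add[of "\<alpha> ! j"] by (simp add: power2_eq_square)
  define t0 where "t0 = - u (2 * j) / co j"
  define w where "w = translate t0 u"
  define a' b' where "a' = a + t0" and "b' = b + t0"
  have w0: "w (2 * j) = 0" using s by (simp add: w_def translate_def t0_def)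
  have fw: "feasible w w a' b'" and ar: "area w w a' b' = area u u a b"
    unfolding w_def a'_def b'_def using feasible_translate[OF b f] by auto
  define h where "h = w (2 * j + 1)"
  show thesis
  proof (cases "h \<le> 1 / co j")
    case True
    then show thesis using that[OF fw] w0 ar by (simp add: h_def)
  next
    case False
    then have hc: "1 < h * co j" using s by (simp add: field_simps)
    \<comment> \<open>The left inner wall has height 1 at \<open>l\<close> and the right one at \<open>r\<close>; between them the corner is above the strip.\<close>
    define l r where "l = (co j - h) / si j" and "r = - tn j"
    have lr: "l < r"
    proof -
      have "(co j - h) * co j < - si j * si j" using hc pyth by (simp add: algebra_simps)
      then show ?thesis using s by (simp add: l_def r_def field_simps)
    qed
    have dich: "x \<le> l \<or> r \<le> x" if "x \<in> {a'..b'}" for x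
    proof -
      have "min (iR w j x) (iL w j x) \<le> 1" using fw that by (intro gap_nonneg_outer(5) j) (auto simp: feasible_def)
      then have "- x * co j \<le> si j \<or> h + x * si j \<le> co j"
        unfolding min_le_iff_disj iR_def iL_def w0 pos_divide_le_eq[OF s(1)] pos_divide_le_eq[OF s(2)] h_def by simp
      then show ?thesis using s by (auto simp: l_def r_def field_simps)
    qed
    have "b' \<le> l \<or> r \<le> a'"
    proof (rule ccontr)
      assume "\<not> ?thesis"
      then have "l < b'" "a' < r" by auto
      define x where "x = max a' ((l + r) / 2)"
      have x: "l < x" "x < r" "a' \<le> x" using lr \<open>a' < r\<close> by (auto simp: x_def less_max_iff_disj)
      have "a' \<le> b'" using fw by (simp add: feasible_def)
      show False
      proof (cases "x \<le> b'")
        case True then show ?thesis using dich[of x] x by auto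
      next
        case False then show ?thesis using dich[of b'] x \<open>l < b'\<close> \<open>a' \<le> b'\<close> by auto
      qed
    qed
    then show thesis
    proof
      assume R: "r \<le> a'"
      define v where "v = w (2 * j + 1 := 1 / co j)"
      have v: "v (2 * j) = 0" "v (2 * j + 1) = 1 / co j" using w0 by (auto simp: v_def)
      have "gap w w x \<le> gap v v x" if x: "x \<in> {a'..b'}" for x
      proof (rule dominate)
        show "v i \<le> w i" for i using False by (auto simp: v_def h_def)
        fix m assume m: "m < k"
        have "2 * m \<noteq> 2 * j + 1" by presburger
        then have "v (2 * m) = w (2 * m)" by (simp add: v_def)
        then show "up w x \<le> oR v m x" using up_le(3)[OF m, of w x] by (simp add: oR_def)
        show "up w x \<le> oL v m x"
        proof (cases "m = j")
          case True
          have "- (si j / co j) * si j \<le> x * si j" using R x s unfolding r_def by (intro mult_right_mono) auto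
          moreover have "- (si j / co j) * si j = co j - 1 / co j" using s pyth by (simp add: field_simps)
          ultimately have "co j \<le> 1 / co j + 1 + x * si j" by linarith
          then have "1 \<le> oL v m x" using s unfolding True oL_def v by (simp add: pos_le_divide_eq)
          then show ?thesis using up_le(1)[of w x] by linarith
        next
          case False
          then have "v (2 * m + 1) = w (2 * m + 1)" by (simp add: v_def)
          then show ?thesis using up_le(4)[OF m, of w x] by (simp add: oL_def)
        qed
      qed
      from feasible_dominate[OF fw this] show thesis using that v ar by auto
    next
      assume L: "b' \<le> l"
      define t1 where "t1 = (h - 1 / co j) / si j"
      have t1: "0 < t1" using False s by (simp add: t1_def)
      define z where "z = translate t1 w"
      have fz: "feasible z z (a' + t1) (b' + t1)" and az: "area z z (a' + t1) (b' + t1) = area w w a' b'"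
        unfolding z_def using feasible_translate[OF b fw] by auto
      have z: "z (2 * j) = t1 * co j" "z (2 * j + 1) = 1 / co j"
        using s w0 by (auto simp: z_def translate_def t1_def h_def)
      define v where "v = z (2 * j := 0)"
      have v: "v (2 * j) = 0" "v (2 * j + 1) = 1 / co j" using z by (auto simp: v_def)
      have "gap z z x \<le> gap v v x" if x: "x \<in> {a' + t1..b' + t1}" for x
      proof (rule dominate)
        show "v i \<le> z i" for i using z t1 s by (auto simp: v_def)
        fix m assume m: "m < k"
        have "2 * m + 1 \<noteq> 2 * j" by presburger
        then have "v (2 * m + 1) = z (2 * m + 1)" by (simp add: v_def)
        then show "up z x \<le> oL v m x" using up_le(4)[OF m, of z x] by (simp add: oL_def)
        show "up z x \<le> oR v m x"
        proof (cases "m = j")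
          case True
          have "x \<le> (co j - h) / si j + (h - 1 / co j) / si j" using L x by (simp add: l_def t1_def)
          also have "\<dots> = (co j - 1 / co j) / si j" by (simp add: add_divide_distrib[symmetric])
          also have "\<dots> \<le> 0"
          proof (rule divide_nonpos_pos[OF _ s(1)])
            have "1 \<le> 1 / co j" using s co_less_1[OF j] by simp
            then show "co j - 1 / co j \<le> 0" using co_less_1[OF j] by linarith
          qed
          finally have "x * co j \<le> 0" using s by (simp add: mult_nonpos_nonneg)
          then have "1 \<le> oR v m x" using s si_less_1[OF j] unfolding True oR_def v by (simp add: pos_le_divide_eq)
          then show ?thesis using up_le(1)[of z x] by linarith
        next
          case False
          then have "v (2 * m) = z (2 * m)" by (simp add: v_def)
          then show ?thesis using up_le(3)[OF m, of z x] by (simp add: oR_def)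
        qed
      qed
      from feasible_dominate[OF fz this] show thesis using that v ar az by auto
    qed
  qed
qed

lemma initial_box_dominates:
  assumes j: "j < k" and f: "feasible u u a b"
  obtains v where "\<And>i. i < 2 * k \<Longrightarrow> box_min (initial_ibox \<alpha> \<beta>2 j) i \<le> v i \<and> v i \<le> box_max (initial_ibox \<alpha> \<beta>2 j) i"
    "area u u a b \<le> maxarea v v"
proof (cases "\<beta>2 < pi / 2")
  case True
  obtain v where v: "\<And>i. i < 2 * k \<Longrightarrow> box_min (initial_ibox \<alpha> \<beta>2 j) i \<le> v i \<and> v i \<le> box_max (initial_ibox \<alpha> \<beta>2 j) i"
    "feasible v v a b" "area u u a b \<le> area v v a b"
    by (rule clamp_into_box[OF j f]) (use x_range_butterfly[OF True, of u] f True in \<open>auto simp: feasible_def\<close>)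
  show thesis using that[OF v(1)] area_le_maxarea[OF v(2)] v(3) by force
next
  case False
  then have b: "\<beta>2 = pi / 2" using beta_le_half_pi by simp
  obtain w c d where w: "feasible w w c d" "area u u a b \<le> area w w c d" "w (2 * j) = 0" "w (2 * j + 1) \<le> 1 / co j"
    by (rule normalise_hallway[OF b j f])
  note s = si_pos[OF j] co_pos[OF j]
  have xr: "x_min j \<le> x \<and> x \<le> x_max j" if "x \<in> {c..d}" for x
    using x_range_hallway[OF b j w(3,4), of x] w(1) that by (auto simp: feasible_def)
  have c: "c \<in> {c..d}" "0 \<le> gap w w c" using w(1) by (auto simp: feasible_def)
  have "0 \<le> w (2 * j + 1) + 1 + c * si j" using gap_nonneg_outer(4)[OF c(2) j] s by (simp add: oL_def zero_le_divide_iff)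
  moreover have "c * si j \<le> x_max j * si j" using xr[OF c(1)] s by (intro mult_right_mono) auto
  moreover have "x_max j * si j = tan (\<alpha> ! j)" using False by (simp add: x_max_def tan_def)
  ultimately have low: "- tan (\<alpha> ! j) - 1 \<le> w (2 * j + 1)" by linarith
  obtain v where v: "\<And>i. i < 2 * k \<Longrightarrow> box_min (initial_ibox \<alpha> \<beta>2 j) i \<le> v i \<and> v i \<le> box_max (initial_ibox \<alpha> \<beta>2 j) i"
    "feasible v v c d" "area w w c d \<le> area v v c d"
    by (rule clamp_into_box[OF j w(1) xr]) (use low w in auto)
  show thesis using that[OF v(1)] area_le_maxarea[OF v(2)] v(3) w(2) by force
qed

abbreviation G :: real where "G \<equiv> sofa_G \<alpha> \<beta>1 \<beta>2"

lemma bdd_above_sofa_g: "bdd_above (sofa_g \<alpha> \<beta>1 \<beta>2 ` {u. length u = 2 * k})"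
proof -
  have k0: "0 < k" using length_pos by linarith
  let ?E = "initial_ibox \<alpha> \<beta>2 0"
  let ?M = "maxarea (box_min ?E) (box_max ?E)"
  have "area u u a b \<le> ?M" if f: "feasible u u a b" for u a b
  proof -
    obtain v where v: "\<And>i. i < 2 * k \<Longrightarrow> box_min ?E i \<le> v i \<and> v i \<le> box_max ?E i" "area u u a b \<le> maxarea v v"
      by (rule initial_box_dominates[OF k0 f], rule that) assumption+
    have "maxarea v v \<le> ?M" using v(1) by (intro maxarea_mono gap_mono) auto
    then show ?thesis using v(2) by simp
  qed
  then show ?thesis by (intro bdd_aboveI[of _ ?M]) (auto simp: sofa_g_maxarea intro!: maxarea_le maxarea_nonneg)
qed

lemma maxarea_le_G: "maxarea u u \<le> G"
proof -
  have "sofa_g \<alpha> \<beta>1 \<beta>2 (map u [0..<2 * k]) \<le> G"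
    unfolding sofa_G_def by (rule cSUP_upper[OF _ bdd_above_sofa_g]) simp
  moreover have "maxarea ((!) (map u [0..<2 * k])) ((!) (map u [0..<2 * k])) = maxarea u u"
    by (rule maxarea_cong) auto
  ultimately show ?thesis by (simp add: sofa_g_maxarea)
qed

lemma G_approximated:
  assumes j: "j < k" and c: "0 \<le> c" "c < G"
  obtains v where "\<And>i. i < 2 * k \<Longrightarrow> box_min (initial_ibox \<alpha> \<beta>2 j) i \<le> v i \<and> v i \<le> box_max (initial_ibox \<alpha> \<beta>2 j) i"
    "c < maxarea v v"
proof -
  have ne: "{u :: real list. length u = 2 * k} \<noteq> {}" by (auto intro: exI[of _ "replicate (2 * k) 0"])
  obtain u :: "real list" where "c < sofa_g \<alpha> \<beta>1 \<beta>2 u"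
    using c(2) unfolding sofa_G_def less_cSUP_iff[OF ne bdd_above_sofa_g] by auto
  then obtain a b where f: "feasible ((!) u) ((!) u) a b" "c < area ((!) u) ((!) u) a b"
    by (auto simp: sofa_g_maxarea intro: less_maxarea[OF c(1)])
  show thesis by (rule initial_box_dominates[OF j f(1)]) (use f(2) that in force)
qed

text \<open>
  Put the midpoint of every hallway's corner square at the point \<open>(0, 1 / 2)\<close>; then this point lies in the
  interior of all sets involved.
\<close>
lemma G_pos: "0 < G"
proof -
  define u where "u i = (if even i then si (i div 2) / 2 - 1 / 2 else co (i div 2) / 2 - 1 / 2)" for i
  have u: "u (2 * m) = si m / 2 - 1 / 2" "u (2 * m + 1) = co m / 2 - 1 / 2" for m by (simp_all add: u_def)
  have "1 / 2 < up u 0"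
  proof (cases rule: up_cases[of u 0])
    case 2
    have "1 \<le> 1 / sin \<beta>1" using sin_beta_pos by simp
    then show ?thesis unfolding 2 by (simp add: W1_def less_max_iff_disj)
  next
    case (3 m) then show ?thesis using si_pos[OF 3(1)] unfolding 3(2) oR_def u by (simp add: field_simps)
  next
    case (4 m) then show ?thesis using co_pos[OF 4(1)] unfolding 4(2) oL_def u by (simp add: field_simps)
  qed simp
  moreover have "lo u 0 \<le> 1 / 2"
    unfolding lo_le_iff
  proof (intro conjI allI impI)
    fix m assume m: "m < k"
    have "iR u m 0 \<le> 1 / 2" using si_pos[OF m] si_less_1[OF m] unfolding iR_def u by (simp add: field_simps)
    then show "min (iR u m 0) (iL u m 0) \<le> 1 / 2" by linarith
  qed (simp_all add: W0_def)
  ultimately have g0: "0 < gap u u 0" by (simp add: gap_def)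
  obtain K where K: "0 < K"
    "\<And>d p q p' q' x x'. near d p p' \<Longrightarrow> near d q q' \<Longrightarrow> \<bar>x - x'\<bar> \<le> d \<Longrightarrow> \<bar>gap p q x - gap p' q' x'\<bar> \<le> K * d"
    using gap_lipschitz by metis
  define e where "e = gap u u 0 / (2 * K)"
  have e: "0 < e" using g0 K by (simp add: e_def)
  have ge: "gap u u 0 / 2 \<le> gap u u x" if "x \<in> {-e..e}" for x
  proof -
    have "\<bar>gap u u x - gap u u 0\<bar> \<le> K * e" using that e by (intro K(2)) (auto simp: near_def)
    moreover have "K * e = gap u u 0 / 2" using K by (simp add: e_def)
    ultimately show ?thesis by linarith
  qed
  have "integral {-e..e} (\<lambda>x. gap u u 0 / 2) \<le> area u u (-e) e"
    unfolding area_def by (intro integral_le gap_integrable ge) auto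
  moreover have "integral {-e..e} (\<lambda>x. gap u u 0 / 2) = e * gap u u 0" using e by simp
  moreover have "0 < e * gap u u 0" using e g0 by simp
  ultimately have pos: "0 < area u u (-e) e" by linarith
  have "0 \<le> gap u u x" if "x \<in> {-e..e}" for x using ge[OF that] g0 by linarith
  then have "feasible u u (-e) e" using e by (auto simp: feasible_def)
  from area_le_maxarea[OF this] show ?thesis using pos maxarea_le_G[of u] by linarith
qed

lemma area_G_optimal:
  assumes "feasible u u a b" "G \<le> area u u a b"
  shows "optimal u a b" "area u u a b = G"
proof -
  have le: "area v v c d \<le> G" if "feasible v v c d" for v c d
    using area_le_maxarea[OF that] maxarea_le_G[of v] by linarith
  show "optimal u a b" unfolding optimal_def using assms G_pos le by force
  show "area u u a b = G" using assms le[OF assms(1)] by linarith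
qed

text \<open>
  Sliding decreases coordinates, so it could only leave the box through the lower end of a range of a second
  coordinate. At such an end the left outer wall has height at most 0 for \<open>x \<le> x_max j\<close>, which
  leaves no room for an optimal component.
\<close>
lemma slide_in_initial_box:
  assumes j: "j < k" and opt: "optimal u a b"
    and box: "\<And>i. i < 2 * k \<Longrightarrow> box_min (initial_ibox \<alpha> \<beta>2 j) i \<le> u i \<and> u i \<le> box_max (initial_ibox \<alpha> \<beta>2 j) i"
  obtains d0 where "0 < d0" "\<And>d i. 0 \<le> d \<Longrightarrow> d < d0 \<Longrightarrow> i < 2 * k \<Longrightarrow>
    box_min (initial_ibox \<alpha> \<beta>2 j) i \<le> slide d u i \<and> slide d u i \<le> box_max (initial_ibox \<alpha> \<beta>2 j) i"
proof -
  let ?E = "initial_ibox \<alpha> \<beta>2 j"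
  have f: "feasible u u a b" "0 < area u u a b" using opt by (auto simp: optimal_def)
  have x: "x \<le> x_max j" if "x \<in> {a..b}" for x
  proof -
    have g: "0 \<le> gap u u x" using f(1) that by (auto simp: feasible_def)
    show ?thesis
    proof (cases "\<beta>2 < pi / 2")
      case True then show ?thesis using x_range_butterfly[OF True g] by blast
    next
      case False
      then have b: "\<beta>2 = pi / 2" using beta_le_half_pi by simp
      have "u (2 * j) = 0" "u (2 * j + 1) \<le> 1 / co j"
        using box[of "2 * j"] box[of "2 * j + 1"] j initial_ibox_nth(4,5)[OF j b] by auto
      then show ?thesis using x_range_hallway[OF b j _ _ g] by blast
    qed
  qed
  have bm: "box_min ?E (2 * m + 1) = - x_max j * si m - 1" if m: "m < k" for m
  proof (cases "\<beta>2 = pi / 2 \<and> m = j")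
    case True
    then show ?thesis using initial_ibox_nth(5)[OF j] unfolding x_max_def by (simp add: tan_def)
  next
    case False then show ?thesis using initial_ibox_nth(3)[OF m] by (simp add: J_range_def)
  qed
  have slack: "0 < u (2 * m + 1) - box_min ?E (2 * m + 1)" if m: "m \<in> {..<k}" for m
  proof (rule ccontr)
    assume "\<not> ?thesis"
    then have um: "u (2 * m + 1) \<le> - x_max j * si m - 1" using bm m by auto
    have "gap u u y \<le> 0" if y: "y \<in> {a..b}" for y
    proof -
      have "y * si m \<le> x_max j * si m" using x[OF y] si_pos[of m] m by (intro mult_right_mono) auto
      then have "oL u m y \<le> 0" using um co_pos m by (simp add: oL_def divide_nonpos_pos)
      then show ?thesis using up_le(4)[of m u y] lo_ge(1)[of u y] m by (simp add: gap_def)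
    qed
    then have "area u u a b \<le> integral {a..b} (\<lambda>x. 0)" unfolding area_def by (intro integral_le gap_integrable) auto
    then show False using f(2) by simp
  qed
  obtain d0 where d0: "0 < d0" "\<And>m. m \<in> {..<k} \<Longrightarrow> d0 \<le> u (2 * m + 1) - box_min ?E (2 * m + 1)"
    by (rule finite_pos_lower_bound[OF finite_lessThan[of k], where f = "\<lambda>m. u (2 * m + 1) - box_min ?E (2 * m + 1)"])
      (erule slack, rule that, assumption+)
  show thesis
  proof (rule that[OF d0(1)])
    fix d i assume d: "0 \<le> d" "d < d0" and i: "i < 2 * k"
    define m where "m = i div 2"
    have m: "m < k" and im: "i = 2 * m \<or> i = 2 * m + 1" using i by (auto simp: m_def)
    have "d * si m \<le> d" using d si_less_1[OF m] by (simp add: mult_left_le)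
    then have "box_min ?E i \<le> slide d u i"
      using im box[OF i] d0(2)[of m] m d slide_even[of d u m] slide_odd[OF m, of d u] by auto
    then show "box_min ?E i \<le> slide d u i \<and> slide d u i \<le> box_max ?E i"
      using slide_le[OF d(1), of u i] box[OF i] by linarith
  qed
qed

end

section \<open>The branch-and-bound algorithm\<close>

locale branch_and_bound = sofa +
  fixes j :: nat and ind :: "ibox \<Rightarrow> nat" and prio :: "ibox \<Rightarrow> real" and l0 :: real
    and Q :: "nat \<Rightarrow> ibox multiset" and UB l :: "nat \<Rightarrow> real"
  assumes j_less: "j < length \<alpha>"
    and rule: "splitting_rule (2 * length \<alpha>) ind"
    and prio_Gamma: "\<forall>E. is_ibox (2 * length \<alpha>) E \<longrightarrow> prio E = sofa_Gamma \<alpha> \<beta>1 \<beta>2 E"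
    and l0_le: "l0 \<le> sofa_G \<alpha> \<beta>1 \<beta>2"
    and run: "bb_run (sofa_g \<alpha> \<beta>1 \<beta>2) prio ind (initial_ibox \<alpha> \<beta>2 j) l0 Q UB l"
begin

abbreviation is_box :: "ibox \<Rightarrow> bool" where "is_box \<equiv> is_ibox (2 * k)"
abbreviation \<Omega> :: ibox where "\<Omega> \<equiv> initial_ibox \<alpha> \<beta>2 j"

text \<open>
  One of the two halves into which the rule splits a box; they coincide if the split side is degenerate.
\<close>
definition child :: "ibox \<Rightarrow> ibox \<Rightarrow> bool" where
  "child E' E \<longleftrightarrow> E' = split_lo (ind E) E \<or> E' = split_hi (ind E) E"
definition contains :: "ibox \<Rightarrow> (nat \<Rightarrow> real) \<Rightarrow> bool" where
  "contains E w \<longleftrightarrow> (\<forall>i<2 * k. box_min E i \<le> w i \<and> w i \<le> box_max E i)"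

lemma is_box_iff: "is_box E \<longleftrightarrow> length E = 2 * k \<and> (\<forall>i<2 * k. box_min E i \<le> box_max E i)"
  by (auto simp: is_ibox_def all_set_conv_all_nth case_prod_unfold)

lemma ind_less: "is_box E \<Longrightarrow> ind E < 2 * k"
  using rule by (auto simp: splitting_rule_def)

lemma box_split:
  assumes E: "is_box E" and i: "i < 2 * k"
  shows "box_min (split_lo (ind E) E) i = box_min E i"
    and "box_max (split_lo (ind E) E) i = (if i = ind E then (box_min E i + box_max E i) / 2 else box_max E i)"
    and "box_min (split_hi (ind E) E) i = (if i = ind E then (box_min E i + box_max E i) / 2 else box_min E i)"
    and "box_max (split_hi (ind E) E) i = box_max E i"
  using E i ind_less[OF E] by (auto simp: is_box_iff split_lo_def split_hi_def nth_list_update)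

lemma box_mid_nth: "is_box E \<Longrightarrow> i < 2 * k \<Longrightarrow> ibox_mid E ! i = (box_min E i + box_max E i) / 2"
  by (simp add: is_box_iff ibox_mid_def case_prod_unfold)

lemma child_bounds:
  assumes E: "is_box E" and c: "child E' E" and i: "i < 2 * k"
  shows "box_min E i \<le> box_min E' i" "box_max E' i \<le> box_max E i" "box_min E' i \<le> box_max E' i"
    "box_min E' i \<le> ibox_mid E ! i" "ibox_mid E ! i \<le> box_max E' i"
    "i = ind E \<Longrightarrow> box_max E' i - box_min E' i = (box_max E i - box_min E i) / 2"
proof -
  have le: "box_min E i \<le> box_max E i" using E i by (simp add: is_box_iff)
  show "box_min E i \<le> box_min E' i" "box_max E' i \<le> box_max E i" "box_min E' i \<le> box_max E' i"
    "box_min E' i \<le> ibox_mid E ! i" "ibox_mid E ! i \<le> box_max E' i"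
    "i = ind E \<Longrightarrow> box_max E' i - box_min E' i = (box_max E i - box_min E i) / 2"
    using c le unfolding child_def box_mid_nth[OF E i] by (auto simp: box_split[OF E i] box_split[OF E ind_less[OF E]] field_simps)
qed

lemma child_is_box: "is_box E \<Longrightarrow> child E' E \<Longrightarrow> is_box E'"
  using child_bounds(3)[of E E'] unfolding is_box_iff child_def by (auto simp: split_lo_def split_hi_def)

lemma child_contains_mid: "is_box E \<Longrightarrow> child E' E \<Longrightarrow> contains E' ((!) (ibox_mid E))"
  using child_bounds(4,5) by (simp add: contains_def)

lemma contains_child: "is_box E \<Longrightarrow> child E' E \<Longrightarrow> contains E' w \<Longrightarrow> contains E w"
  unfolding contains_def using child_bounds(1,2) by (meson order_trans)

lemma contains_lo:
  "is_box E \<Longrightarrow> contains E w \<Longrightarrow> w (ind E) \<le> ibox_mid E ! ind E \<Longrightarrow> contains (split_lo (ind E) E) w"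
  and contains_hi:
  "is_box E \<Longrightarrow> contains E w \<Longrightarrow> ibox_mid E ! ind E \<le> w (ind E) \<Longrightarrow> contains (split_hi (ind E) E) w"
  using ind_less[of E] by (auto simp: contains_def box_split box_mid_nth)

lemma contains_some_child:
  assumes "is_box E" "contains E w"
  obtains E' where "child E' E" "contains E' w"
proof (cases "w (ind E) \<le> ibox_mid E ! ind E")
  case True then show thesis using contains_lo[OF assms] that by (auto simp: child_def)
next
  case False then show thesis using contains_hi[OF assms] that by (auto simp: child_def)
qed

abbreviation \<Gamma> :: "ibox \<Rightarrow> real" where "\<Gamma> E \<equiv> maxarea (box_min E) (box_max E)"

lemma prio: "is_box E \<Longrightarrow> prio E = \<Gamma> E"
  using prio_Gamma sofa_Gamma_maxarea by simp

lemma \<Gamma>_mono: "is_box E \<Longrightarrow> child E' E \<Longrightarrow> \<Gamma> E' \<le> \<Gamma> E"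
  by (intro maxarea_mono gap_mono child_bounds(1,2))

lemma maxarea_le_\<Gamma>: "contains E w \<Longrightarrow> maxarea w w \<le> \<Gamma> E"
  by (intro maxarea_mono gap_mono) (auto simp: contains_def)

text \<open>
  Whether the supremum is attained is only known once boxes have been shrunk to a point, so the notion uses
  values near it.
\<close>
definition good :: "ibox \<Rightarrow> bool" where
  "good E \<longleftrightarrow> (\<forall>c. 0 \<le> c \<longrightarrow> c < G \<longrightarrow> (\<exists>w. contains E w \<and> c < maxarea w w))"

lemma good_\<Omega>: "good \<Omega>"
  unfolding good_def contains_def by (metis G_approximated[OF j_less])

lemma good_child:
  assumes E: "is_box E" "good E"
  obtains E' where "child E' E" "good E'"
proof (rule ccontr)
  assume no: "\<not> thesis"
  have "\<not> good (split_lo (ind E) E)" "\<not> good (split_hi (ind E) E)" using no that by (auto simp: child_def)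
  then obtain c1 c2 where c: "0 \<le> c1" "c1 < G" "\<And>w. contains (split_lo (ind E) E) w \<Longrightarrow> maxarea w w \<le> c1"
    "0 \<le> c2" "c2 < G" "\<And>w. contains (split_hi (ind E) E) w \<Longrightarrow> maxarea w w \<le> c2"
    unfolding good_def by (metis not_less)
  then obtain w where w: "contains E w" "max c1 c2 < maxarea w w"
    using E(2) unfolding good_def by (metis max_less_iff_conj max.coboundedI1)
  obtain E' where "child E' E" "contains E' w" by (rule contains_some_child[OF E(1) w(1)])
  then have "maxarea w w \<le> c1 \<or> maxarea w w \<le> c2" using c(3,6) by (auto simp: child_def)
  then show False using w(2) by auto
qed

lemma good_\<Gamma>:
  assumes "good E" shows "G \<le> \<Gamma> E"
proof (rule ccontr)
  assume "\<not> ?thesis"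
  then obtain w where "contains E w" "\<Gamma> E < maxarea w w"
    using assms maxarea_nonneg[of "box_min E" "box_max E"] unfolding good_def by (meson not_le)
  then show False using maxarea_le_\<Gamma> by fastforce
qed

lemma run_start: "Q 0 = {#\<Omega>#}" "l 0 = l0" using run by (auto simp: bb_run_def)

text \<open>
  One iteration as a case distinction. The idle case is ruled out by \<open>queue_good\<close>.
\<close>
lemma run_step:
  obtains (process) E where "E \<in># Q n" "\<And>F. F \<in># Q n \<Longrightarrow> prio F \<le> prio E"
    "l (Suc n) = max (l n) (sofa_g \<alpha> \<beta>1 \<beta>2 (ibox_mid E))" "UB (Suc n) = prio E"
    "Q (Suc n) = Q n - {#E#} + filter_mset (\<lambda>F. l (Suc n) \<le> prio F) {#split_lo (ind E) E, split_hi (ind E) E#}"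
  | (idle) "Q n = {#}" "Q (Suc n) = {#}" "l (Suc n) = l n"
proof -
  have "bb_step (sofa_g \<alpha> \<beta>1 \<beta>2) prio ind (Q n, UB n, l n) (Q (Suc n), UB (Suc n), l (Suc n))"
    using run by (simp add: bb_run_def)
  then show thesis by (cases rule: bb_step.cases) (auto intro: process idle)
qed

lemma queue_boxes: "E \<in># Q n \<Longrightarrow> is_box E"
proof (induction n arbitrary: E)
  case 0 then show ?case using initial_ibox_is_ibox[OF j_less] by (simp add: run_start)
next
  case (Suc n)
  show ?case
  proof (cases rule: run_step[of n])
    case (process F)
    have "E \<in># Q n \<or> child E F"
      using Suc.prems unfolding process(5) by (auto simp: child_def dest: in_diffD split: if_splits)
    then show ?thesis using Suc.IH process(1) child_is_box by blast
  qed (use Suc.prems in auto)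
qed

lemma lower_le_G: "l n \<le> G"
proof (induction n)
  case 0 then show ?case using l0_le by (simp add: run_start)
next
  case (Suc n)
  then show ?case by (cases rule: run_step[of n]) (auto simp: sofa_g_maxarea maxarea_le_G)
qed

lemma queue_good: "\<exists>E. E \<in># Q n \<and> good E"
proof (induction n)
  case 0 then show ?case using good_\<Omega> by (simp add: run_start)
next
  case (Suc n)
  then obtain F where F: "F \<in># Q n" "good F" by blast
  show ?case
  proof (cases rule: run_step[of n])
    case (process E)
    show ?thesis
    proof (cases "F = E")
      case True
      obtain E' where E': "child E' E" "good E'" using good_child F queue_boxes True by metis
      have "is_box E'" using child_is_box[OF queue_boxes[OF process(1)] E'(1)] .
      then have "l (Suc n) \<le> prio E'" using good_\<Gamma>[OF E'(2)] lower_le_G[of "Suc n"] prio by simp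
      then have "E' \<in># Q (Suc n)" unfolding process(5) using E'(1) by (auto simp: child_def)
      then show ?thesis using E'(2) by blast
    next
      case False
      then have "F \<in># Q (Suc n)" unfolding process(5) using F(1) by (simp add: in_diff_count)
      then show ?thesis using F(2) by blast
    qed
  qed (use F in auto)
qed

text \<open>
  The box processed in iteration \<open>n + 1\<close>.
\<close>
definition proc :: "nat \<Rightarrow> ibox" where
  "proc n = (SOME E. E \<in># Q n \<and> (\<forall>F. F \<in># Q n \<longrightarrow> prio F \<le> prio E) \<and>
    l (Suc n) = max (l n) (sofa_g \<alpha> \<beta>1 \<beta>2 (ibox_mid E)) \<and> UB (Suc n) = prio E \<and>
    Q (Suc n) = Q n - {#E#} + filter_mset (\<lambda>F. l (Suc n) \<le> prio F) {#split_lo (ind E) E, split_hi (ind E) E#})"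

lemma proc:
  shows "proc n \<in># Q n" and "F \<in># Q n \<Longrightarrow> prio F \<le> prio (proc n)"
    and "l (Suc n) = max (l n) (sofa_g \<alpha> \<beta>1 \<beta>2 (ibox_mid (proc n)))" and "UB (Suc n) = prio (proc n)"
    and "Q (Suc n) = Q n - {#proc n#} + filter_mset (\<lambda>F. l (Suc n) \<le> prio F) {#split_lo (ind (proc n)) (proc n), split_hi (ind (proc n)) (proc n)#}"
proof -
  have "\<exists>E. E \<in># Q n \<and> (\<forall>F. F \<in># Q n \<longrightarrow> prio F \<le> prio E) \<and>
    l (Suc n) = max (l n) (sofa_g \<alpha> \<beta>1 \<beta>2 (ibox_mid E)) \<and> UB (Suc n) = prio E \<and>
    Q (Suc n) = Q n - {#E#} + filter_mset (\<lambda>F. l (Suc n) \<le> prio F) {#split_lo (ind E) E, split_hi (ind E) E#}"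
    using queue_good[of n] by (cases rule: run_step[of n]) auto
  from someI_ex[OF this, folded proc_def]
  show "proc n \<in># Q n" "F \<in># Q n \<Longrightarrow> prio F \<le> prio (proc n)"
    "l (Suc n) = max (l n) (sofa_g \<alpha> \<beta>1 \<beta>2 (ibox_mid (proc n)))" "UB (Suc n) = prio (proc n)"
    "Q (Suc n) = Q n - {#proc n#} + filter_mset (\<lambda>F. l (Suc n) \<le> prio F) {#split_lo (ind (proc n)) (proc n), split_hi (ind (proc n)) (proc n)#}"
    by blast+
qed

lemma proc_is_box: "is_box (proc n)" using proc(1) queue_boxes by blast

lemma queue_Suc:
  "F \<in># Q (Suc n) \<Longrightarrow> F \<in># Q n \<or> child F (proc n)"
  "F \<in># Q n \<Longrightarrow> F \<noteq> proc n \<Longrightarrow> F \<in># Q (Suc n)"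
  "child F (proc n) \<Longrightarrow> l (Suc n) \<le> prio F \<Longrightarrow> F \<in># Q (Suc n)"
proof -
  show "F \<in># Q (Suc n) \<Longrightarrow> F \<in># Q n \<or> child F (proc n)"
    unfolding proc(5)[of n] by (auto simp: child_def dest: in_diffD split: if_splits)
  show "F \<in># Q n \<Longrightarrow> F \<noteq> proc n \<Longrightarrow> F \<in># Q (Suc n)"
    unfolding proc(5)[of n] by (simp add: in_diff_count)
  show "child F (proc n) \<Longrightarrow> l (Suc n) \<le> prio F \<Longrightarrow> F \<in># Q (Suc n)"
    unfolding proc(5)[of n] by (auto simp: child_def)
qed

lemma UB_ge_G: "G \<le> UB (Suc n)"
proof -
  obtain E where E: "E \<in># Q n" "good E" using queue_good by blast
  have "prio E \<le> UB (Suc n)" using proc(2)[OF E(1)] proc(4)[of n] by simp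
  then show ?thesis using good_\<Gamma>[OF E(2)] prio[OF queue_boxes[OF E(1)]] by simp
qed

lemma UB_decreasing: "UB (Suc (Suc n)) \<le> UB (Suc n)"
proof -
  have "proc (Suc n) \<in># Q n \<or> child (proc (Suc n)) (proc n)" by (rule queue_Suc(1)[OF proc(1)])
  then have "prio (proc (Suc n)) \<le> prio (proc n)"
    using proc(2)[of "proc (Suc n)" n] \<Gamma>_mono[OF proc_is_box, of "proc (Suc n)" n] prio[OF proc_is_box] by auto
  then show ?thesis using proc(4) by simp
qed

text \<open>
  A side that is split infinitely often is halved infinitely often. The sides that the rule may neglect
  are degenerate from the start.
\<close>
lemma chain_shrinks:
  assumes S0: "is_box (S 0)" and ch: "\<And>m. child (S (Suc m)) (S m)"
  obtains u where "\<And>i. i < 2 * k \<Longrightarrow> (\<lambda>m. box_min (S m) i) \<longlonglongrightarrow> u i" "\<And>i. i < 2 * k \<Longrightarrow> (\<lambda>m. box_max (S m) i) \<longlonglongrightarrow> u i"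
    "\<And>m. contains (S m) u"
proof -
  have box: "is_box (S m)" for m by (induction m) (auto intro: S0 child_is_box ch)
  have mono: "box_min (S m) i \<le> box_min (S (Suc m)) i" "box_max (S (Suc m)) i \<le> box_max (S m) i" if "i < 2 * k" for i m
    using child_bounds(1,2)[OF box ch that] by auto
  have le: "box_min (S m) i \<le> box_max (S m) i" if "i < 2 * k" for i m using box[of m] that by (simp add: is_box_iff)
  have inc: "incseq (\<lambda>m. box_min (S m) i)" and dec: "decseq (\<lambda>m. box_max (S m) i)" if "i < 2 * k" for i
    using mono[OF that] by (auto intro: incseq_SucI decseq_SucI)
  have "\<exists>x. (\<lambda>m. box_min (S m) i) \<longlonglongrightarrow> x \<and> (\<lambda>m. box_max (S m) i) \<longlonglongrightarrow> x \<and> (\<forall>m. box_min (S m) i \<le> x \<and> x \<le> box_max (S m) i)"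
    if i: "i < 2 * k" for i
  proof -
    have "box_min (S m) i \<le> box_max (S 0) i" for m
      using le[OF i, of m] dec[OF i] unfolding decseq_def by (meson le0 order_trans)
    then obtain x where x: "(\<lambda>m. box_min (S m) i) \<longlonglongrightarrow> x" "\<And>m. box_min (S m) i \<le> x"
      using incseq_convergent[OF inc[OF i]] by metis
    have "box_min (S 0) i \<le> box_max (S m) i" for m
      using le[OF i, of m] inc[OF i] unfolding incseq_def by (meson le0 order_trans)
    then obtain y where y: "(\<lambda>m. box_max (S m) i) \<longlonglongrightarrow> y" "\<And>m. y \<le> box_max (S m) i"
      using decseq_convergent[OF dec[OF i]] by metis
    have xy: "x \<le> y" using LIMSEQ_le[OF x(1) y(1)] le[OF i] by auto
    have "y \<le> x"
    proof (rule ccontr)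
      assume "\<not> y \<le> x"
      then have pos: "0 < y - x" by simp
      have "fst (S 0 ! i) < snd (S 0 ! i)" using x(2)[of 0] y(2)[of 0] pos by linarith
      then have inf: "infinite {m. ind (S m) = i}"
        using rule[unfolded splitting_rule_def, THEN conjunct2, rule_format, of S i] S0 ch i by (auto simp: child_def)
      have "(\<lambda>m. box_max (S m) i - box_min (S m) i) \<longlonglongrightarrow> y - x" by (intro tendsto_diff x y)
      then have "\<forall>\<^sub>F m in sequentially. box_max (S m) i - box_min (S m) i < 2 * (y - x)"
        using pos by (intro order_tendstoD(2)) auto
      then obtain N where N: "\<And>m. N \<le> m \<Longrightarrow> box_max (S m) i - box_min (S m) i < 2 * (y - x)"
        by (auto simp: eventually_sequentially)
      obtain m where m: "N \<le> m" "ind (S m) = i" using inf unfolding infinite_nat_iff_unbounded_le by auto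
      have "2 * (box_max (S (Suc m)) i - box_min (S (Suc m)) i) = box_max (S m) i - box_min (S m) i"
        using child_bounds(6)[OF box ch i, of m] m(2) by simp
      then show False using N[OF m(1)] x(2)[of "Suc m"] y(2)[of "Suc m"] by auto
    qed
    then show ?thesis using x y xy by auto
  qed
  then obtain u where u: "\<And>i. i < 2 * k \<Longrightarrow> (\<lambda>m. box_min (S m) i) \<longlonglongrightarrow> u i \<and> (\<lambda>m. box_max (S m) i) \<longlonglongrightarrow> u i \<and>
      (\<forall>m. box_min (S m) i \<le> u i \<and> u i \<le> box_max (S m) i)" by metis
  show thesis by (rule that[of u]) (use u in \<open>auto simp: contains_def\<close>)
qed

lemma chain_exists:
  assumes "\<Phi> E0" "\<And>E. \<Phi> E \<Longrightarrow> \<exists>E'. child E' E \<and> \<Phi> E'"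
  obtains S where "S 0 = E0" "\<And>m. \<Phi> (S m)" "\<And>m. child (S (Suc m)) (S m)"
proof -
  have "\<exists>S. \<forall>m. (\<Phi> (S m) \<and> (m = 0 \<longrightarrow> S m = E0)) \<and> child (S (Suc m)) (S m)"
    by (rule dependent_nat_choice) (use assms in auto)
  then show thesis using that by metis
qed

lemma chain_near:
  assumes lim: "\<And>i. i < 2 * k \<Longrightarrow> (\<lambda>m. box_min (S m) i) \<longlonglongrightarrow> u i" "\<And>i. i < 2 * k \<Longrightarrow> (\<lambda>m. box_max (S m) i) \<longlonglongrightarrow> u i"
    and r: "0 < r"
  obtains m where "\<And>w. contains (S m) w \<Longrightarrow> near r w u"
proof -
  have "\<forall>\<^sub>F m in sequentially. \<forall>i\<in>{..<2 * k}. u i - r < box_min (S m) i \<and> box_max (S m) i < u i + r"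
    using lim r by (intro eventually_ball_finite ballI eventually_conj order_tendstoD) auto
  then obtain m where m: "\<forall>i\<in>{..<2 * k}. u i - r < box_min (S m) i \<and> box_max (S m) i < u i + r"
    using eventually_happens by force
  show thesis
  proof (rule that[of m])
    fix w assume w: "contains (S m) w"
    show "near r w u"
      unfolding near_def
    proof (intro allI impI)
      fix i assume i: "i < 2 * k"
      have "u i - r < box_min (S m) i" "box_max (S m) i < u i + r" using m i by auto
      moreover have "box_min (S m) i \<le> w i" "w i \<le> box_max (S m) i" using w i by (auto simp: contains_def)
      ultimately show "\<bar>w i - u i\<bar> \<le> r" by linarith
    qed
  qed
qed

abbreviation processed :: "ibox \<Rightarrow> bool" where "processed E \<equiv> E \<in> range proc"

lemma processed_is_box: "processed E \<Longrightarrow> is_box E" using proc_is_box by auto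

text \<open>
  Restricted to boxes that are processed at some time, each iteration replaces one box of the queue by some
  of its halves. If the relation between boxes and halves were well-founded on processed boxes, so
  would be the multiset order, and the iterations could not go on for ever.
\<close>
lemma infinite_processed_chain:
  obtains S where "\<And>m. processed (S m)" "\<And>m. child (S (Suc m)) (S m)"
proof -
  define R where "R = {(E', E). processed E' \<and> processed E \<and> child E' E}"
  define M where "M n = filter_mset processed (Q n)" for n
  have "(M (Suc n), M n) \<in> mult1 R" for n
  proof -
    define N where "N = filter_mset processed (filter_mset (\<lambda>F. l (Suc n) \<le> prio F)
      {#split_lo (ind (proc n)) (proc n), split_hi (ind (proc n)) (proc n)#})"
    have "M (Suc n) = (M n - {#proc n#}) + N"
      unfolding M_def proc(5)[of n] N_def by (simp add: filter_diff_mset)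
    moreover have "M n = add_mset (proc n) (M n - {#proc n#})" using proc(1)[of n] by (simp add: M_def)
    moreover have "(b, proc n) \<in> R" if "b \<in># N" for b using that by (auto simp: N_def R_def child_def split: if_splits)
    ultimately show ?thesis unfolding mult1_def by blast
  qed
  then have "\<not> wf (mult1 R)" unfolding wf_iff_no_infinite_down_chain by blast
  then have "\<not> wf R" using wf_mult1 by blast
  then obtain S where "\<And>m. (S (Suc m), S m) \<in> R" unfolding wf_iff_no_infinite_down_chain by blast
  then show thesis using that by (auto simp: R_def)
qed

lemma processed_\<Gamma>:
  assumes "processed E" "\<And>n. c \<le> UB (Suc n)" shows "c \<le> \<Gamma> E"
proof -
  obtain n where n: "E = proc n" using assms(1) by blast
  show ?thesis using assms(2)[of n] prio[OF proc_is_box[of n]] unfolding n proc(4)[of n] by simp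
qed

text \<open>
  The decreasing bounds have a limit \<open>L\<close>, which all processed priorities exceed or equal. The limit position
  of an infinite chain of processed boxes has a component of area at least \<open>L\<close>, so \<open>L \<le> G\<close>.
\<close>
lemma UB_converges: "UB \<longlonglongrightarrow> G"
proof -
  have dec: "decseq (\<lambda>n. UB (Suc n))" using UB_decreasing by (rule decseq_SucI)
  obtain L where L: "(\<lambda>n. UB (Suc n)) \<longlonglongrightarrow> L" "\<And>n. L \<le> UB (Suc n)"
    using decseq_convergent[OF dec, of G] UB_ge_G by blast
  have GL: "G \<le> L" using L(1) UB_ge_G by (intro LIMSEQ_le_const) auto
  obtain S where S: "\<And>m. processed (S m)" "\<And>m. child (S (Suc m)) (S m)" using infinite_processed_chain by blast
  obtain u where u: "\<And>i. i < 2 * k \<Longrightarrow> (\<lambda>m. box_min (S m) i) \<longlonglongrightarrow> u i" "\<And>i. i < 2 * k \<Longrightarrow> (\<lambda>m. box_max (S m) i) \<longlonglongrightarrow> u i"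
    by (rule chain_shrinks[of S, OF processed_is_box[OF S(1)] S(2)], rule that) assumption+
  obtain a b where "feasible u u a b" "L \<le> area u u a b"
    by (rule feasible_limit[of "\<lambda>m. box_min (S m)" u "\<lambda>m. box_max (S m)" L, OF u _ processed_\<Gamma>[OF S(1) L(2)]])
      (use G_pos GL in auto)
  then have "L \<le> G" using area_le_maxarea maxarea_le_G[of u] by (meson order_trans)
  then have "L = G" using GL by (rule order_antisym)
  then have "(\<lambda>n. UB (Suc n)) \<longlonglongrightarrow> G" using L(1) by blast
  then show ?thesis by (rule LIMSEQ_imp_Suc)
qed

text \<open>
  The half enters the queue, since its priority exceeds every lower bound, and it cannot stay there, since the
  largest priority in the queue tends to G.
\<close>
lemma child_processed:
  assumes E: "processed E" and c: "child E' E" and g: "G < \<Gamma> E'"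
  shows "processed E'"
proof (rule ccontr)
  assume no: "\<not> processed E'"
  obtain n where n: "E = proc n" using E by auto
  have box: "is_box E'" by (rule child_is_box[OF processed_is_box[OF E] c])
  have "E' \<in># Q (Suc n + m)" for m
  proof (induction m)
    case 0
    have "l (Suc n) \<le> prio E'" using lower_le_G[of "Suc n"] g prio[OF box] by linarith
    then show ?case using queue_Suc(3)[of E' n] c n by simp
  next
    case (Suc m)
    have "E' \<noteq> proc (Suc n + m)" using no by auto
    then show ?case using queue_Suc(2)[OF Suc.IH] by simp
  qed
  then have "\<Gamma> E' \<le> UB (Suc (Suc n + m))" for m using proc(2)[of E' "Suc n + m"] proc(4) prio[OF box] by simp
  then have "\<Gamma> E' \<le> UB (m + Suc (Suc n))" for m by (simp add: add.commute)
  moreover have "(\<lambda>m. UB (m + Suc (Suc n))) \<longlonglongrightarrow> G" using UB_converges by (rule LIMSEQ_ignore_initial_segment)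
  ultimately have "\<Gamma> E' \<le> G" by (intro LIMSEQ_le_const) auto
  then show False using g by simp
qed

text \<open>
  Assume that all processed midpoints have values at most \<open>c\<close>. The position \<open>u\<close> to which an infinite chain
  shrinks is a maximiser, and by \<open>optimal_unpinched\<close> its optimal component has a pinch. First, boxes containing
  \<open>u\<close> together with \<open>slide d u\<close> for all small \<open>d\<close> (\<open>germ\<close>) are followed until they are small; all of
  them are processed, because their priorities exceed G. Then \<open>d\<close> is fixed, and from the small box
  on the halves containing \<open>slide d u\<close> are followed (\<open>follow\<close>); these are processed because their bad
  midpoints force the priority above G.
\<close>
lemma processed_mid_approximates:
  assumes c: "c < G"
  shows "\<exists>E. processed E \<and> c < sofa_g \<alpha> \<beta>1 \<beta>2 (ibox_mid E)"
proof (rule ccontr)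
  assume "\<not> ?thesis"
  then have bad: "maxarea ((!) (ibox_mid E)) ((!) (ibox_mid E)) \<le> c" if "processed E" for E
    using that sofa_g_maxarea by (metis not_less)
  obtain S where S: "\<And>m. processed (S m)" "\<And>m. child (S (Suc m)) (S m)" using infinite_processed_chain by blast
  obtain u where u: "\<And>i. i < 2 * k \<Longrightarrow> (\<lambda>m. box_min (S m) i) \<longlonglongrightarrow> u i" "\<And>i. i < 2 * k \<Longrightarrow> (\<lambda>m. box_max (S m) i) \<longlonglongrightarrow> u i"
    "\<And>m. contains (S m) u"
    by (rule chain_shrinks[of S, OF processed_is_box[OF S(1)] S(2)], rule that) assumption+
  obtain a b where ab: "feasible u u a b" "G \<le> area u u a b"
    by (rule feasible_limit[of "\<lambda>m. box_min (S m)" u "\<lambda>m. box_max (S m)" G, OF u(1,2) G_pos processed_\<Gamma>[OF S(1) UB_ge_G]])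
  note opt = area_G_optimal[OF ab]
  have c': "c < area u u a b" using c opt(2) by simp
  have in_\<Omega>: "contains \<Omega> w" if "processed E" "contains E w" for E w
  proof -
    have "E \<in># Q n \<Longrightarrow> contains E w \<Longrightarrow> contains \<Omega> w" for n E
    proof (induction n arbitrary: E)
      case 0 then show ?case by (simp add: run_start)
    next
      case (Suc n)
      then show ?case using queue_Suc(1)[of E n] contains_child[OF proc_is_box] proc(1)[of n] by blast
    qed
    then show ?thesis using that proc(1) by blast
  qed
  have not_robust: False
    if T: "\<And>m. processed (T m)" "\<And>m. child (T (Suc m)) (T m)"
      "\<And>i. i < 2 * k \<Longrightarrow> (\<lambda>m. box_min (T m) i) \<longlonglongrightarrow> v i" "\<And>i. i < 2 * k \<Longrightarrow> (\<lambda>m. box_max (T m) i) \<longlonglongrightarrow> v i"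
      "0 < r" "\<And>z. near r z v \<Longrightarrow> c < maxarea z z" for T v r
  proof -
    obtain m where m: "\<And>w. contains (T m) w \<Longrightarrow> near r w v" using chain_near[OF T(3,4,5)] by blast
    have b: "is_box (T m)" using T(1) processed_is_box by blast
    have "contains (T m) ((!) (ibox_mid (T m)))"
      using child_contains_mid[OF b T(2)] contains_child[OF b T(2)] by blast
    then show False using T(6)[OF m] bad[OF T(1)] by (meson not_less)
  qed
  show False
  proof (cases "\<exists>x. a < x \<and> x < b \<and> gap u u x = 0")
    case False
    then obtain r where "0 < r" "\<And>z. near r z u \<Longrightarrow> c < maxarea z z" using optimal_unpinched[OF opt(1) c'] by metis
    then show False using not_robust[OF S u(1,2)] by blast
  next
    case True
    then obtain x0 where x0: "a < x0" "x0 < b" "gap u u x0 = 0" by blast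
    obtain r d0 where r: "0 < r" "0 < d0"
      and keep: "\<And>d p q. 0 < d \<Longrightarrow> d < d0 \<Longrightarrow> (\<And>i. i < 2*k \<Longrightarrow> p i \<le> slide d u i \<and> slide d u i \<le> q i) \<Longrightarrow>
        (\<And>i. i < 2*k \<Longrightarrow> p i \<le> u i \<and> u i \<le> q i) \<Longrightarrow> area u u a b < maxarea p q"
      and keep_mid: "\<And>d p q z. 0 < d \<Longrightarrow> d < d0 \<Longrightarrow> (\<And>i. i < 2*k \<Longrightarrow> p i \<le> slide d u i \<and> slide d u i \<le> q i) \<Longrightarrow>
        (\<And>i. i < 2*k \<Longrightarrow> p i \<le> z i \<and> z i \<le> q i) \<Longrightarrow> near r z u \<Longrightarrow> maxarea z z \<le> c \<Longrightarrow> area u u a b < maxarea p q"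
      and robust: "\<And>d. 0 < d \<Longrightarrow> d < d0 \<Longrightarrow> \<exists>r'>0. \<forall>z. near r' z (slide d u) \<longrightarrow> c < maxarea z z"
      by (rule optimal_pinched[OF opt(1) c' x0]) blast
    define germ where "germ E \<longleftrightarrow> processed E \<and> contains E u \<and> (\<exists>\<delta>>0. \<forall>d. 0 < d \<longrightarrow> d < \<delta> \<longrightarrow> contains E (slide d u))" for E
    have "proc 0 = \<Omega>" using proc(1)[of 0] by (simp add: run_start)
    then have p0: "processed \<Omega>" by (metis rangeI)
    have u\<Omega>: "contains \<Omega> u" by (rule in_\<Omega>[OF S(1) u(3)])
    obtain \<delta> where "0 < \<delta>" "\<And>d i. 0 \<le> d \<Longrightarrow> d < \<delta> \<Longrightarrow> i < 2 * k \<Longrightarrow> box_min \<Omega> i \<le> slide d u i \<and> slide d u i \<le> box_max \<Omega> i"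
      by (rule slide_in_initial_box[OF j_less opt(1)]) (use u\<Omega> in \<open>auto simp: contains_def\<close>)
    then have g\<Omega>: "germ \<Omega>" unfolding germ_def using p0 u\<Omega> by (auto simp: contains_def intro!: exI[of _ \<delta>])
    have step: "\<exists>E'. child E' E \<and> germ E'" if E: "germ E" for E
    proof -
      have b: "is_box E" and uE: "contains E u" using E processed_is_box by (auto simp: germ_def)
      obtain \<delta> where \<delta>: "0 < \<delta>" "\<And>d. 0 < d \<Longrightarrow> d < \<delta> \<Longrightarrow> contains E (slide d u)" using E by (auto simp: germ_def)
      \<comment> \<open>Sliding only decreases coordinates, so the whole germ of positions stays in one of the two halves.\<close>
      have "\<exists>E' \<delta>'. child E' E \<and> contains E' u \<and> 0 < \<delta>' \<and> (\<forall>d. 0 < d \<longrightarrow> d < \<delta>' \<longrightarrow> contains E' (slide d u))"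
      proof (cases "u (ind E) \<le> ibox_mid E ! ind E")
        case True
        have "contains (split_lo (ind E) E) (slide d u)" if "0 < d" "d < \<delta>" for d
          using contains_lo[OF b \<delta>(2)[OF that]] slide_le[of d u "ind E"] True that by simp
        then show ?thesis using contains_lo[OF b uE True] \<delta>(1) unfolding child_def by blast
      next
        case False
        define \<eta> where "\<eta> = u (ind E) - ibox_mid E ! ind E"
        have \<eta>: "0 < \<eta>" using False by (simp add: \<eta>_def)
        have "contains (split_hi (ind E) E) (slide d u)" if "0 < d" "d < min \<delta> \<eta>" for d
        proof (rule contains_hi[OF b \<delta>(2)])
          have "\<bar>slide d u (ind E) - u (ind E)\<bar> \<le> d" using slide_near[of d u] that ind_less[OF b] by (auto simp: near_def)
          moreover have "d < u (ind E) - ibox_mid E ! ind E" using that by (simp add: \<eta>_def)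
          ultimately show "ibox_mid E ! ind E \<le> slide d u (ind E)" unfolding abs_le_iff by linarith
        qed (use that in auto)
        moreover have "contains (split_hi (ind E) E) u" using contains_hi[OF b uE] False by simp
        ultimately show ?thesis using \<delta>(1) \<eta> unfolding child_def by (metis min_less_iff_conj)
      qed
      then obtain E' \<delta>' where E': "child E' E" "contains E' u" "0 < \<delta>'"
        "\<And>d. 0 < d \<Longrightarrow> d < \<delta>' \<Longrightarrow> contains E' (slide d u)" by blast
      define d where "d = min \<delta>' d0 / 2"
      have d: "0 < d" "d < \<delta>'" "d < d0" using E'(3) r by (auto simp: d_def)
      have "area u u a b < \<Gamma> E'"
        using keep[OF d(1,3), of "box_min E'" "box_max E'"] E'(2) E'(4)[OF d(1,2)] by (auto simp: contains_def)
      then have "processed E'" using child_processed[of E E'] E E'(1) opt(2) by (simp add: germ_def)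
      then show ?thesis using E' unfolding germ_def by blast
    qed
    obtain T where T: "\<And>m. germ (T m)" "\<And>m. child (T (Suc m)) (T m)" using chain_exists[of germ, OF g\<Omega> step] by metis
    have pT: "processed (T m)" for m using T(1) by (simp add: germ_def)
    obtain v where v: "\<And>i. i < 2 * k \<Longrightarrow> (\<lambda>m. box_min (T m) i) \<longlonglongrightarrow> v i" "\<And>i. i < 2 * k \<Longrightarrow> (\<lambda>m. box_max (T m) i) \<longlonglongrightarrow> v i"
      by (rule chain_shrinks[of T, OF processed_is_box[OF pT] T(2)], rule that) assumption+
    obtain M where M: "\<And>w. contains (T M) w \<Longrightarrow> near (r / 2) w v" using chain_near[OF v, of "r / 2"] r by auto
    have nu: "near r w u" if w: "contains (T M) w" for w
      unfolding near_def
    proof (intro allI impI)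
      fix i assume i: "i < 2 * k"
      have "\<bar>w i - v i\<bar> \<le> r / 2" "\<bar>u i - v i\<bar> \<le> r / 2"
        using M[OF w] M[of u] T(1)[of M] i by (auto simp: near_def germ_def)
      then show "\<bar>w i - u i\<bar> \<le> r" by linarith
    qed
    obtain \<delta> where \<delta>: "0 < \<delta>" "\<And>d. 0 < d \<Longrightarrow> d < \<delta> \<Longrightarrow> contains (T M) (slide d u)" using T(1)[of M] by (auto simp: germ_def)
    define d where "d = min \<delta> d0 / 2"
    have d: "0 < d" "d < \<delta>" "d < d0" using \<delta>(1) r by (auto simp: d_def)
    define follow where "follow E \<longleftrightarrow> processed E \<and> (\<forall>w. contains E w \<longrightarrow> contains (T M) w) \<and> contains E (slide d u)" for E
    have f0: "follow (T M)" using pT \<delta>(2)[OF d(1,2)] by (simp add: follow_def)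
    have fstep: "\<exists>E'. child E' E \<and> follow E'" if E: "follow E" for E
    proof -
      have pE: "processed E" and b: "is_box E" using E processed_is_box by (auto simp: follow_def)
      obtain E' where E': "child E' E" "contains E' (slide d u)"
        using contains_some_child[OF b, of "slide d u"] E by (auto simp: follow_def)
      have mid: "contains E' ((!) (ibox_mid E))" by (rule child_contains_mid[OF b E'(1)])
      have sub: "contains (T M) w" if "contains E' w" for w
        using contains_child[OF b E'(1) that] E by (simp add: follow_def)
      have "area u u a b < \<Gamma> E'"
        using keep_mid[OF d(1,3), of "box_min E'" "box_max E'" "(!) (ibox_mid E)"] E'(2) mid nu[OF sub[OF mid]] bad[OF pE]
        by (auto simp: contains_def)
      then have "processed E'" using child_processed[OF pE E'(1)] opt(2) by simp
      then show ?thesis using E' sub unfolding follow_def by blast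
    qed
    obtain F where F: "\<And>m. follow (F m)" "\<And>m. child (F (Suc m)) (F m)" using chain_exists[of follow, OF f0 fstep] by metis
    have pF: "processed (F m)" for m using F(1) by (simp add: follow_def)
    obtain w where w: "\<And>i. i < 2 * k \<Longrightarrow> (\<lambda>m. box_min (F m) i) \<longlonglongrightarrow> w i" "\<And>i. i < 2 * k \<Longrightarrow> (\<lambda>m. box_max (F m) i) \<longlonglongrightarrow> w i"
      by (rule chain_shrinks[of F, OF processed_is_box[OF pF] F(2)], rule that) assumption+
    have ws: "w i = slide d u i" if i: "i < 2 * k" for i
    proof -
      have "box_min (F m) i \<le> slide d u i" "slide d u i \<le> box_max (F m) i" for m
        using F(1)[of m] i by (auto simp: follow_def contains_def)
      then have "w i \<le> slide d u i" "slide d u i \<le> w i"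
        using LIMSEQ_le_const2[OF w(1)[OF i]] LIMSEQ_le_const[OF w(2)[OF i]] by blast+
      then show ?thesis by simp
    qed
    obtain r' where r': "0 < r'" "\<And>z. near r' z (slide d u) \<Longrightarrow> c < maxarea z z" using robust[OF d(1,3)] by blast
    show False by (rule not_robust[of F "slide d u" r', OF pF F(2)]) (use w ws r' in auto)
  qed
qed

lemma lower_converges: "l \<longlonglongrightarrow> G"
proof -
  have inc: "incseq l" by (rule incseq_SucI) (simp add: proc(3))
  show ?thesis
  proof (rule increasing_tendsto)
    show "\<forall>\<^sub>F n in sequentially. l n \<le> G" using lower_le_G by simp
    fix c assume "c < G"
    then obtain n where "c < sofa_g \<alpha> \<beta>1 \<beta>2 (ibox_mid (proc n))" using processed_mid_approximates by blast
    then have "c < l (Suc n)" using proc(3)[of n] by simp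
    then show "\<forall>\<^sub>F n in sequentially. c < l n"
      using inc unfolding eventually_sequentially incseq_def by (meson less_le_trans)
  qed
qed

end

theorem theorem8:
  fixes \<alpha> :: "real list" and \<beta>1 \<beta>2 l0 :: real and j :: nat
    and ind :: "ibox \<Rightarrow> nat" and prio :: "ibox \<Rightarrow> real"
    and Q :: "nat \<Rightarrow> ibox multiset" and UB l :: "nat \<Rightarrow> real"
  assumes "length \<alpha> \<ge> 1"
    and "sorted_wrt (<) \<alpha>"
    and "\<forall>a\<in>set \<alpha>. 0 < a \<and> a < pi / 2"
    and "last \<alpha> < \<beta>1" and "\<beta>1 \<le> \<beta>2" and "\<beta>2 \<le> pi / 2"
    and "j < length \<alpha>"
    and "splitting_rule (2 * length \<alpha>) ind"
    and "\<forall>E. is_ibox (2 * length \<alpha>) E \<longrightarrow> prio E = sofa_Gamma \<alpha> \<beta>1 \<beta>2 E"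
    and "l0 \<le> sofa_G \<alpha> \<beta>1 \<beta>2"
    and "bb_run (sofa_g \<alpha> \<beta>1 \<beta>2) prio ind (initial_ibox \<alpha> \<beta>2 j) l0 Q UB l"
  shows "UB \<longlonglongrightarrow> sofa_G \<alpha> \<beta>1 \<beta>2 \<and> l \<longlonglongrightarrow> sofa_G \<alpha> \<beta>1 \<beta>2"
proof -
  interpret branch_and_bound \<alpha> \<beta>1 \<beta>2 j ind prio l0 Q UB l
    by unfold_locales (use assms in auto)
  show ?thesis using UB_converges lower_converges by blast
qed

end
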